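(* Let $\sigma$ be the canonical conformal co-symplectic structure on the space $\mathcal{G}_{\mathrm{traj}}$ of geodesic trajectories of four-dimensional Minkowski spacetime. Then: (1) On the open submanifolds $\mathcal{G}^{+}_{\mathrm{traj}}$ and $\mathcal{G}^{-}_{\mathrm{traj}}$ of space-like and time-like trajectories, the image of $\sigma$ is the full tangent space, $\operatorname{Im}(\sigma_\tau)=T_\tau\mathcal{G}^{\pm}_{\mathrm{traj}}$ for every $\tau\in\mathcal{G}^{\pm}_{\mathrm{traj}}$. The structure $\sigma$ is non-degenerate there and defines, by inversion, a canonical conformal class of symplectic forms. (2) On the submanifold $\mathcal{G}^{0}_{\mathrm{traj}}$ of null trajectories, the image $\tau\mapsto\operatorname{Im}(\sigma_\tau)$ is a codimension-1 distribution (in $T\mathcal{G}^{0}_{\mathrm{traj}}$) that is the canonical contact structure of $\mathcal{G}^{0}_{\mathrm{traj}}$.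
   Context: Minkowski spacetime is $(M,g)=(\mathbf{R}^4,g)$, with $g$ the flat metric (constant bilinear form) of signature $(+,+,+,-)$. The space of parametrized geodesics $t\mapsto X+tV$ is the 8-dimensional manifold $\mathcal{G}_{\mathrm{curv}}=\mathbf{R}^4\times(\mathbf{R}^4\setminus\{0\})$, with points $\gamma=(X,V)$ and tangent vectors $\delta\gamma=(\delta X,\delta V)$. It carries the Liouville 1-form $\varpi_\gamma(\delta\gamma)=g(V,\delta X)$ and the symplectic form $\omega=d\varpi$, $\omega_\gamma(\delta\gamma,\delta'\gamma)=g(\delta V,\delta'X)-g(\delta'V,\delta X)$. The group $\mathrm{Aff}^+(\mathbf{R})=\{(a,b): a>0,\ b\in\mathbf{R}\}$ of affine reparametrizations $t\mapsto at+b$ acts on $\mathcal{G}_{\mathrm{curv}}$ by $(a,b)\cdot(X,V)=(X+bV,\,aV)$. The action is free with 2-dimensional orbits, and the quotient map $\pi:\mathcal{G}_{\mathrm{curv}}\to\mathcal{G}_{\mathrm{traj}}=\mathcal{G}_{\mathrm{curv}}/\mathrm{Aff}^+(\mathbf{R})$ is a principal bundle over the 6-dimensional manifold $\mathcal{G}_{\mathrm{traj}}$ of geodesic trajectories. The subsets $\mathcal{G}^{+}_{\mathrm{traj}}$, $\mathcal{G}^{-}_{\mathrm{traj}}$, $\mathcal{G}^{0}_{\mathrm{traj}}$ consist of the trajectories $\pi(X,V)$ with $g(V,V)>0$ (space-like), $g(V,V)<0$ (time-like), $g(V,V)=0$ (null), respectively; the first two are open, and $\mathcal{G}^{0}_{\mathrm{traj}}$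 is a 5-dimensional submanifold. Write $\mathcal{G}^0_{\mathrm{curv}}=\pi^{-1}(\mathcal{G}^0_{\mathrm{traj}})$. The inverse $\omega^{-1}$ is the contravariant antisymmetric 2-tensor on $\mathcal{G}_{\mathrm{curv}}$ that, viewed as a map $\omega^{-1}_\gamma:T^*_\gamma\mathcal{G}_{\mathrm{curv}}\to T_\gamma\mathcal{G}_{\mathrm{curv}}$, is the inverse of the isomorphism defined by $\omega_\gamma$. Its conformal class $[\omega^{-1}]$ (its class up to positive scaling) is invariant under $\mathrm{Aff}^+(\mathbf{R})$. The canonical conformal co-symplectic structure is the field of rays of contravariant antisymmetric 2-tensors $\sigma:=\pi_*([\omega^{-1}])$ on $\mathcal{G}_{\mathrm{traj}}$: for $\tau=\pi(\gamma)$, $\sigma_\tau$ is the ray of positive multiples of $D\pi_\gamma\circ\omega^{-1}_\gamma\circ(D\pi_\gamma)^*:T^*_\tau\mathcal{G}_{\mathrm{traj}}\to T_\tau\mathcal{G}_{\mathrm{traj}}$, which does not depend on the choice of $\gamma$ over $\tau$. $\operatorname{Im}(\sigma_\tau)\subset T_\tau\mathcal{G}_{\mathrm{traj}}$ is the image of any representative of this ray; $\sigma$ is non-degenerate at $\tau$ if such a representative is invertible. A conformal class of symplectic forms means the set of all products $f\omega_0$ of a symplectic form $\omega_0$ by positive smooth functions $f$. The canonical contact structure of $\mathcal{G}^0_{\mathrm{traj}}$ is the hyperplane distribution induced by the kernel of the Liouville form: at $\tau=\pi(\gamma)$ it is $D\pi_\gamma(\ker\varpi_\gamma\cap T_\gamma\mathcal{G}^0_{\mathrm{curv}})\subset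 T_\tau\mathcal{G}^0_{\mathrm{traj}}$. A contact structure on a $(2k+1)$-dimensional manifold is a hyperplane distribution that is locally the kernel of a 1-form $\alpha$ with $\alpha\wedge(d\alpha)^k$ nowhere zero; part (2) includes the assertion that this distribution is contact. *)

theory Defs
  imports "HOL-Analysis.Analysis" "HOL-Library.Function_Algebras"
begin

section \<open>Smooth maps and differential forms on open subsets of Euclidean spaces\<close>

text \<open>Only meaningful for open \<open>S\<close>: all iterated directional derivatives exist and are continuous.\<close>

fun Ck_on :: "nat \<Rightarrow> 'a::euclidean_space set \<Rightarrow> ('a \<Rightarrow> 'b::euclidean_space) \<Rightarrow> bool" where
  "Ck_on 0 S f \<longleftrightarrow> continuous_on S f"
| "Ck_on (Suc k) S f \<longleftrightarrow> (\<forall>x\<in>S. f differentiable (at x)) \<and>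
     (\<forall>v. Ck_on k S (\<lambda>x. frechet_derivative f (at x) v))"

definition smooth_on :: "'a::euclidean_space set \<Rightarrow> ('a \<Rightarrow> 'b::euclidean_space) \<Rightarrow> bool" where
  "smooth_on S f \<longleftrightarrow> (\<forall>k. Ck_on k S f)"

text \<open>A differential \<open>k\<close>-form takes a point and a list of \<open>k\<close> tangent vectors; its values on
  lists of any other length are irrelevant.\<close>

type_synonym 'e form = "'e \<Rightarrow> 'e list \<Rightarrow> real"

definition ext_deriv :: "'e::euclidean_space form \<Rightarrow> 'e form" where
  "ext_deriv \<alpha> x vs = (\<Sum>i<length vs. (-1) ^ i *
     frechet_derivative (\<lambda>y. \<alpha> y (take i vs @ drop (Suc i) vs)) (at x) (vs ! i))"

definition wedge :: "nat \<Rightarrow> nat \<Rightarrow> 'e form \<Rightarrow> 'e form \<Rightarrow> 'e form" where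
  "wedge p q \<alpha> \<beta> x vs = (\<Sum>\<pi> | \<pi> permutes {..<p + q}. of_int (sign \<pi>) *
     \<alpha> x (map (\<lambda>i. vs ! \<pi> i) [0..<p]) * \<beta> x (map (\<lambda>i. vs ! \<pi> i) [p..<p + q])) / (fact p * fact q)"

fun wedge_power :: "nat \<Rightarrow> 'e form \<Rightarrow> nat \<Rightarrow> 'e form" where
  "wedge_power p \<beta> 0 = (\<lambda>x vs. 1)"
| "wedge_power p \<beta> (Suc k) = wedge p (p * k) \<beta> (wedge_power p \<beta> k)"

definition smooth_one_form :: "'e::euclidean_space set \<Rightarrow> 'e form \<Rightarrow> bool" where
  "smooth_one_form D \<alpha> \<longleftrightarrow> (\<forall>x\<in>D. linear (\<lambda>w. \<alpha> x [w])) \<and> (\<forall>w. smooth_on D (\<lambda>x. \<alpha> x [w]))"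

text \<open>Tangent space at \<open>x\<close> of a submanifold \<open>N\<close> of a Euclidean space: velocities of curves in \<open>N\<close>.\<close>

definition velocities :: "'e::euclidean_space set \<Rightarrow> 'e \<Rightarrow> 'e set" where
  "velocities N x = {v. \<exists>c \<epsilon>. 0 < \<epsilon> \<and> c 0 = x \<and> c ` {-\<epsilon><..<\<epsilon>} \<subseteq> N \<and>
     smooth_on {-\<epsilon><..<\<epsilon>} c \<and> (c has_vector_derivative v) (at (0::real))}"


section \<open>Manifolds given by an atlas\<close>

text \<open>Pointwise linear structure, so that tangent vectors (defined below as functions on charts)
  can be added and scaled.\<close>

instantiation "fun" :: (type, real_vector) real_vector
begin

definition scaleR_fun_def: "r *\<^sub>R f = (\<lambda>x. r *\<^sub>R f x)"

instance
  by standard (simp_all add: scaleR_fun_def fun_eq_iff scaleR_add_right scaleR_add_left)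

end

text \<open>A chart \<open>(U, \<phi>)\<close> has domain \<open>U\<close> and coordinate map \<open>\<phi>\<close>; values of \<open>\<phi>\<close> off \<open>U\<close> are irrelevant.\<close>

type_synonym ('q, 'e) chart = "'q set \<times> ('q \<Rightarrow> 'e)"

text \<open>A tangent vector at \<open>q\<close> is the family of its coordinate vectors in all charts at \<open>q\<close>,
  subject to the usual transformation rule (and \<open>0\<close> at all other charts).\<close>

type_synonym ('q, 'e) tangent = "('q, 'e) chart \<Rightarrow> 'e"

definition charts_at :: "('q, 'e) chart set \<Rightarrow> 'q \<Rightarrow> ('q, 'e) chart set" where
  "charts_at A q = {c \<in> A. q \<in> fst c}"

definition transition :: "('q, 'e) chart \<Rightarrow> ('q, 'e) chart \<Rightarrow> 'e \<Rightarrow> 'e" where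
  "transition c c' = snd c' \<circ> inv_into (fst c) (snd c)"

definition tangent_space ::
    "('q, 'e::euclidean_space) chart set \<Rightarrow> 'q \<Rightarrow> ('q, 'e) tangent set" where
  "tangent_space A q = {v.
     (\<forall>c\<in>charts_at A q. \<forall>c'\<in>charts_at A q.
        v c' = frechet_derivative (transition c c') (at (snd c q)) (v c)) \<and>
     (\<forall>c. c \<notin> charts_at A q \<longrightarrow> v c = 0)}"

definition linear_form_on :: "'v::real_vector set \<Rightarrow> ('v \<Rightarrow> real) \<Rightarrow> bool" where
  "linear_form_on T \<theta> \<longleftrightarrow> (\<forall>u\<in>T. \<forall>v\<in>T. \<theta> (u + v) = \<theta> u + \<theta> v) \<and> (\<forall>r. \<forall>u\<in>T. \<theta> (r *\<^sub>R u) = r * \<theta> u)"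

definition cotangent_space ::
    "('q, 'e::euclidean_space) chart set \<Rightarrow> 'q \<Rightarrow> (('q, 'e) tangent \<Rightarrow> real) set" where
  "cotangent_space A q = {\<theta>. linear_form_on (tangent_space A q) \<theta> \<and>
     (\<forall>v. v \<notin> tangent_space A q \<longrightarrow> \<theta> v = 0)}"

text \<open>The tangent spaces of an open submanifold are identified with those of the ambient manifold.\<close>

definition open_submanifold :: "('q, 'e::euclidean_space) chart set \<Rightarrow> 'q set \<Rightarrow> bool" where
  "open_submanifold A W \<longleftrightarrow> W \<subseteq> \<Union>(fst ` A) \<and> (\<forall>(U, \<phi>)\<in>A. open (\<phi> ` (U \<inter> W)))"

text \<open>Tangent space at \<open>q\<close> of a submanifold \<open>N\<close>, as a subspace of the ambient tangent space.\<close>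

definition sub_tangent_space ::
    "('q, 'e::euclidean_space) chart set \<Rightarrow> 'q set \<Rightarrow> 'q \<Rightarrow> ('q, 'e) tangent set" where
  "sub_tangent_space A N q = {v \<in> tangent_space A q. \<exists>c::real \<Rightarrow> 'q. c 0 = q \<and>
     (\<forall>(U, \<phi>)\<in>charts_at A q. \<exists>\<epsilon>>0. c ` {-\<epsilon><..<\<epsilon>} \<subseteq> N \<inter> U \<and>
        smooth_on {-\<epsilon><..<\<epsilon>} (\<phi> \<circ> c) \<and> (\<phi> \<circ> c has_vector_derivative v (U, \<phi>)) (at 0))}"

definition smooth_function ::
    "('q, 'e::euclidean_space) chart set \<Rightarrow> 'q set \<Rightarrow> ('q \<Rightarrow> real) \<Rightarrow> bool" where
  "smooth_function A W f \<longleftrightarrow> (\<forall>(U, \<phi>)\<in>A. smooth_on (\<phi> ` (U \<inter> W)) (f \<circ> inv_into U \<phi>))"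


subsection \<open>2-forms on open submanifolds\<close>

type_synonym ('q, 'e) two_form = "'q \<Rightarrow> ('q, 'e) tangent \<Rightarrow> ('q, 'e) tangent \<Rightarrow> real"

text \<open>The tangent vector at \<open>q\<close> with coordinates \<open>w\<close> in the chart \<open>c\<close>.\<close>

definition coord_vector ::
    "('q, 'e::euclidean_space) chart set \<Rightarrow> ('q, 'e) chart \<Rightarrow> 'q \<Rightarrow> 'e \<Rightarrow> ('q, 'e) tangent" where
  "coord_vector A c q w = (\<lambda>c'. if c' \<in> charts_at A q
     then frechet_derivative (transition c c') (at (snd c q)) w else 0)"

definition coord_form ::
    "('q, 'e::euclidean_space) chart set \<Rightarrow> ('q, 'e) two_form \<Rightarrow> ('q, 'e) chart \<Rightarrow> 'e form" where
  "coord_form A \<beta> c x ws = (let q = inv_into (fst c) (snd c) x in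
     \<beta> q (coord_vector A c q (ws ! 0)) (coord_vector A c q (ws ! 1)))"

text \<open>Forms are \<open>0\<close> off their domain, so that equality of forms on \<open>W\<close> is equality of functions
  and \<open>\<beta> q v\<close> is the covector \<open>\<beta>(v, \<cdot>)\<close>.\<close>

definition smooth_two_form ::
    "('q, 'e::euclidean_space) chart set \<Rightarrow> 'q set \<Rightarrow> ('q, 'e) two_form \<Rightarrow> bool" where
  "smooth_two_form A W \<beta> \<longleftrightarrow>
     (\<forall>q u v. \<not> (q \<in> W \<and> u \<in> tangent_space A q \<and> v \<in> tangent_space A q) \<longrightarrow> \<beta> q u v = 0) \<and>
     (\<forall>q\<in>W. \<forall>u\<in>tangent_space A q.
        linear_form_on (tangent_space A q) (\<beta> q u) \<and> (\<forall>v\<in>tangent_space A q. \<beta> q u v = - \<beta> q v u)) \<and>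
     (\<forall>c\<in>A. \<forall>w w'. smooth_on (snd c ` (fst c \<inter> W)) (\<lambda>x. coord_form A \<beta> c x [w, w']))"

definition symplectic_form ::
    "('q, 'e::euclidean_space) chart set \<Rightarrow> 'q set \<Rightarrow> ('q, 'e) two_form \<Rightarrow> bool" where
  "symplectic_form A W \<beta> \<longleftrightarrow> smooth_two_form A W \<beta> \<and>
     (\<forall>c\<in>A. \<forall>x\<in>snd c ` (fst c \<inter> W). \<forall>w\<^sub>1 w\<^sub>2 w\<^sub>3. ext_deriv (coord_form A \<beta> c) x [w\<^sub>1, w\<^sub>2, w\<^sub>3] = 0) \<and>
     (\<forall>q\<in>W. \<forall>u\<in>tangent_space A q. (\<forall>v\<in>tangent_space A q. \<beta> q u v = 0) \<longrightarrow> u = 0)"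

definition conformal_class ::
    "('q, 'e::euclidean_space) chart set \<Rightarrow> 'q set \<Rightarrow> ('q, 'e) two_form \<Rightarrow> ('q, 'e) two_form set" where
  "conformal_class A W \<beta> =
     {(\<lambda>q u v. f q * \<beta> q u v) |f. smooth_function A W f \<and> (\<forall>q\<in>W. 0 < f q)}"

definition conformal_symplectic_class ::
    "('q, 'e::euclidean_space) chart set \<Rightarrow> 'q set \<Rightarrow> ('q, 'e) two_form set \<Rightarrow> bool" where
  "conformal_symplectic_class A W \<Omega> \<longleftrightarrow> (\<exists>\<beta>. symplectic_form A W \<beta> \<and> \<Omega> = conformal_class A W \<beta>)"


subsection \<open>Hyperplane distributions and contact structures on submanifolds\<close>

definition hyperplane_distribution ::
    "('q, 'e::euclidean_space) chart set \<Rightarrow> 'q set \<Rightarrow> ('q \<Rightarrow> ('q, 'e) tangent set) \<Rightarrow> bool" where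
  "hyperplane_distribution A N H \<longleftrightarrow> (\<forall>q\<in>N. subspace (H q) \<and> H q \<subseteq> sub_tangent_space A N q \<and>
     dim (sub_tangent_space A N q) = dim (H q) + 1)"

text \<open>A slice chart for \<open>N\<close>; its first component then is a chart of \<open>N\<close> with values in \<open>'e\<close>.\<close>

definition slice_chart ::
    "('q, 'e::euclidean_space \<times> 'f::euclidean_space) chart set \<Rightarrow> 'q set \<Rightarrow> ('q, 'e \<times> 'f) chart \<Rightarrow> bool" where
  "slice_chart A N c \<longleftrightarrow> c \<in> A \<and> snd c ` (fst c \<inter> N) = {z \<in> snd c ` fst c. snd z = 0}"

definition contact_structure ::
    "('q, 'e::euclidean_space \<times> 'f::euclidean_space) chart set \<Rightarrow> 'q set
      \<Rightarrow> ('q \<Rightarrow> ('q, 'e \<times> 'f) tangent set) \<Rightarrow> bool" where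
  "contact_structure A N H \<longleftrightarrow> hyperplane_distribution A N H \<and>
     (\<exists>k. DIM('e) = 2 * k + 1 \<and>
       (\<forall>p\<in>N. \<exists>U \<phi> \<alpha>. slice_chart A N (U, \<phi>) \<and> p \<in> U \<and>
          smooth_one_form ((fst \<circ> \<phi>) ` (U \<inter> N)) \<alpha> \<and>
          (\<forall>q\<in>U \<inter> N. H q = {v \<in> sub_tangent_space A N q. \<alpha> (fst (\<phi> q)) [fst (v (U, \<phi>))] = 0}) \<and>
          (\<forall>x\<in>(fst \<circ> \<phi>) ` (U \<inter> N). \<exists>vs. length vs = 2 * k + 1 \<and>
             wedge 1 (2 * k) \<alpha> (wedge_power 2 (ext_deriv \<alpha>) k) x vs \<noteq> 0)))"


subsection \<open>Quotient manifolds\<close>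

text \<open>For \<open>M\<close> open and \<open>p\<close> a principal bundle with contractible structure group (so that sections
  exist over every chart domain), these are all the charts of the unique smooth structure on
  \<open>p ` M\<close> for which \<open>p\<close> is a submersion.\<close>

definition quotient_atlas ::
    "'m::euclidean_space set \<Rightarrow> ('m \<Rightarrow> 'q) \<Rightarrow> ('q, 'e::euclidean_space) chart set" where
  "quotient_atlas M p = {(U, \<phi>). U \<subseteq> p ` M \<and> open (M \<inter> p -` U) \<and> inj_on \<phi> U \<and> open (\<phi> ` U) \<and>
     smooth_on (M \<inter> p -` U) (\<phi> \<circ> p) \<and>
     (\<exists>s. smooth_on (\<phi> ` U) s \<and> (\<forall>q\<in>U. s (\<phi> q) \<in> M \<and> p (s (\<phi> q)) = q))}"

definition push_tangent ::
    "('q, 'e::euclidean_space) chart set \<Rightarrow> ('m::euclidean_space \<Rightarrow> 'q) \<Rightarrow> 'm \<Rightarrow> 'm \<Rightarrow> ('q, 'e) tangent" where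
  "push_tangent A p x \<xi> = (\<lambda>c. if c \<in> charts_at A (p x)
     then frechet_derivative (snd c \<circ> p) (at x) \<xi> else 0)"


section \<open>Geodesics of Minkowski spacetime\<close>

definition mink :: "real^4 \<Rightarrow> real^4 \<Rightarrow> real" where
  "mink x y = x $ 1 * y $ 1 + x $ 2 * y $ 2 + x $ 3 * y $ 3 - x $ 4 * y $ 4"

text \<open>The pair \<open>(X, V)\<close> stands for the parametrized geodesic \<open>t \<mapsto> X + t V\<close>.\<close>

type_synonym phase = "(real^4) \<times> (real^4)"

definition G_curv :: "phase set" where
  "G_curv = UNIV \<times> (UNIV - {0})"

definition liouville :: "phase \<Rightarrow> phase \<Rightarrow> real" where
  "liouville \<gamma> \<delta> = mink (snd \<gamma>) (fst \<delta>)"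

definition omega :: "phase \<Rightarrow> phase \<Rightarrow> phase \<Rightarrow> real" where
  "omega \<gamma> \<delta> \<delta>' = mink (snd \<delta>) (fst \<delta>') - mink (snd \<delta>') (fst \<delta>)"

lemma omega_eq_ext_deriv_liouville:
  "ext_deriv (\<lambda>\<gamma> vs. liouville \<gamma> (vs ! 0)) \<gamma> [\<delta>, \<delta>'] = omega \<gamma> \<delta> \<delta>'"
proof -
  have "linear (\<lambda>\<gamma>. liouville \<gamma> \<eta>)" for \<eta>
    by (rule linearI) (simp_all add: liouville_def mink_def algebra_simps)
  then have "frechet_derivative (\<lambda>\<gamma>. liouville \<gamma> \<eta>) (at \<gamma>) = (\<lambda>\<gamma>. liouville \<gamma> \<eta>)" for \<eta>
    by (metis frechet_derivative_at linear_imp_has_derivative)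
  then show ?thesis
    by (simp add: ext_deriv_def lessThan_Suc omega_def liouville_def)
qed

definition aff_act :: "real \<Rightarrow> real \<Rightarrow> phase \<Rightarrow> phase" where
  "aff_act a b \<gamma> = (fst \<gamma> + b *\<^sub>R snd \<gamma>, a *\<^sub>R snd \<gamma>)"

text \<open>The projection to trajectories: a trajectory is an orbit of the group of affine
  reparametrizations.\<close>

definition traj_of :: "phase \<Rightarrow> phase set" where
  "traj_of \<gamma> = {aff_act a b \<gamma> |a b. 0 < a}"

definition G_traj :: "phase set set" where
  "G_traj = traj_of ` G_curv"

definition G_traj_pos :: "phase set set" where
  "G_traj_pos = traj_of ` {\<gamma> \<in> G_curv. mink (snd \<gamma>) (snd \<gamma>) > 0}"

definition G_traj_neg :: "phase set set" where
  "G_traj_neg = traj_of ` {\<gamma> \<in> G_curv. mink (snd \<gamma>) (snd \<gamma>) < 0}"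

definition G_traj_null :: "phase set set" where
  "G_traj_null = traj_of ` {\<gamma> \<in> G_curv. mink (snd \<gamma>) (snd \<gamma>) = 0}"

definition G_curv_null :: "phase set" where
  "G_curv_null = G_curv \<inter> traj_of -` G_traj_null"

text \<open>The 6-dimensional model space is written as a product so that the 5-dimensional submanifold
  of null trajectories can be given by slice charts.\<close>

type_synonym model = "(real^5) \<times> real"

definition traj_atlas :: "(phase set, model) chart set" where
  "traj_atlas = quotient_atlas G_curv traj_of"

abbreviation Tan :: "phase set \<Rightarrow> (phase set, model) tangent set" where
  "Tan \<equiv> tangent_space traj_atlas"

abbreviation Cotan :: "phase set \<Rightarrow> ((phase set, model) tangent \<Rightarrow> real) set" where
  "Cotan \<equiv> cotangent_space traj_atlas"

abbreviation D_traj :: "phase \<Rightarrow> phase \<Rightarrow> (phase set, model) tangent" where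
  "D_traj \<equiv> push_tangent traj_atlas traj_of"

type_synonym cotensor = "((phase set, model) tangent \<Rightarrow> real) \<Rightarrow> (phase set, model) tangent"

text \<open>The tensor pushed forward from \<open>\<gamma>\<close>, as a map from cotangent to tangent vectors. Here
  \<open>inv (omega \<gamma>)\<close> inverts \<open>\<delta> \<mapsto> omega(\<delta>, \<cdot>)\<close>; it is applied to linear functionals only.\<close>

definition pushed_inverse :: "phase \<Rightarrow> cotensor" where
  "pushed_inverse \<gamma> \<theta> = D_traj \<gamma> (inv (omega \<gamma>) (\<lambda>\<delta>. \<theta> (D_traj \<gamma> \<delta>)))"

text \<open>The ray \<open>\<sigma>\<^sub>\<tau>\<close>; its elements are \<open>undefined\<close> off the cotangent space.\<close>

definition cosymp :: "phase set \<Rightarrow> cotensor set" where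
  "cosymp \<tau> = {restrict (\<lambda>\<theta>. r *\<^sub>R pushed_inverse \<gamma> \<theta>) (Cotan \<tau>) |r \<gamma>.
     0 < r \<and> \<gamma> \<in> G_curv \<and> traj_of \<gamma> = \<tau>}"

text \<open>All representatives of the ray have the same image, so the union is the image of any of them.\<close>

definition Im_cosymp :: "phase set \<Rightarrow> (phase set, model) tangent set" where
  "Im_cosymp \<tau> = (\<Union>r\<in>cosymp \<tau>. r ` Cotan \<tau>)"

definition nondegenerate_at :: "phase set \<Rightarrow> bool" where
  "nondegenerate_at \<tau> \<longleftrightarrow> (\<exists>r\<in>cosymp \<tau>. bij_betw r (Cotan \<tau>) (Tan \<tau>))"

text \<open>The smooth 2-forms on \<open>W\<close> that are pointwise the inverse of a representative of \<open>\<sigma>\<close>.\<close>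

definition inverse_forms :: "phase set set \<Rightarrow> (phase set, model) two_form set" where
  "inverse_forms W = {\<beta>. smooth_two_form traj_atlas W \<beta> \<and> (\<forall>\<tau>\<in>W. \<exists>r\<in>cosymp \<tau>.
     (\<forall>v\<in>Tan \<tau>. r (\<beta> \<tau> v) = v) \<and> (\<forall>\<theta>\<in>Cotan \<tau>. \<beta> \<tau> (r \<theta>) = \<theta>))}"

definition liouville_plane :: "phase \<Rightarrow> (phase set, model) tangent set" where
  "liouville_plane \<gamma> = D_traj \<gamma> ` ({\<delta>. liouville \<gamma> \<delta> = 0} \<inter> velocities G_curv_null \<gamma>)"

end

theory Submission
  imports Defs
begin

text \<open>
  Write \<open>V = snd \<gamma>\<close> and \<open>N = g(V, V)\<close>. The vertical space at \<open>\<gamma>\<close>, the kernel of \<open>D_traj \<gamma>\<close>, is spanned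
  by \<open>(V, 0)\<close> and \<open>(0, V)\<close> (\<open>D_traj_kernel\<close>). Covectors at the trajectory of \<open>\<gamma>\<close> correspond to linear
  functionals upstairs that vanish on the vertical space, hence through \<open>omega\<close> to the vectors \<open>\<delta>\<close> of
  the symplectic complement of the vertical space, which is given by \<open>g(V, \<delta>V) = 0\<close> and
  \<open>g(V, \<delta>X) = 0\<close>. So the image of \<open>\<sigma>\<close> is the projection of that complement (\<open>Im_cosymp_traj_of\<close>).

  If \<open>N \<noteq> 0\<close> the vertical space is symplectic, the complement is transversal to it, and the image is
  everything (\<open>Im_cosymp_nonnull\<close>). The inverse of \<open>\<sigma>\<close> is found by restricting \<open>omega\<close> to the level set
  \<open>\<bar>N\<bar> = 1\<close>, where its kernel is the line spanned by \<open>(V, 0)\<close>; the restriction descends to a 2-form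
  \<open>reduced_form\<close> on trajectories. In a chart, this form is the pull-back of the closed form
  \<open>omega\<close>, which has constant coefficients, by a smooth section with values in the level set; so it is
  smooth, and closed by the symmetry of second derivatives (\<open>symplectic_reduced_form\<close>). Every other inverse
  of \<open>\<sigma>\<close> is pointwise a positive multiple of it, and the factor is smooth because it is a quotient of
  coordinate expressions of the two forms.

  If \<open>N = 0\<close> the vertical space is isotropic for \<open>omega\<close>, and its complement is the intersection of
  the kernel of the Liouville form with the tangent space \<open>g(V, \<delta>V) = 0\<close> of the null cone
  (\<open>velocities_G_curv_null\<close>); this is the Liouville plane. For the contact condition, a frame adapted
  to a null vector \<open>n\<close> with \<open>g(n, V) > 0\<close> gives coordinates \<open>(a, b, c, p, q; w)\<close> in which the section normalized
  by \<open>g(n, V) = 1\<close>, \<open>g(n, X) = 0\<close> is polynomial, null trajectories are the slice \<open>w = 0\<close>,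
  and the Liouville form pulls back to \<open>dc + p da + q db\<close> (\<open>liouville_frame_section\<close>).
  The same charts cover all trajectories.
\<close>

section \<open>Calculus of smooth maps\<close>

lemma Ck_on_subset: "Ck_on k S f \<Longrightarrow> T \<subseteq> S \<Longrightarrow> Ck_on k T f"
  by (induction k arbitrary: f) (auto intro: continuous_on_subset)

lemma Ck_on_Suc_has_derivative:
  "Ck_on (Suc k) S f \<Longrightarrow> x \<in> S \<Longrightarrow> (f has_derivative frechet_derivative f (at x)) (at x)"
  using frechet_derivative_works by auto

lemma Ck_on_cong_open:
  assumes "open S" and "\<And>x. x \<in> S \<Longrightarrow> f x = g x" and "Ck_on k S f"
  shows "Ck_on k S g"
  using assms(2,3)
proof (induction k arbitrary: f g)
  case 0
  then show ?case
    using continuous_on_cong[of S S f g] by simp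
next
  case (Suc k)
  have D: "(g has_derivative frechet_derivative f (at x)) (at x)" if "x \<in> S" for x
    using has_derivative_transform_within_open[OF Ck_on_Suc_has_derivative[OF Suc.prems(2) that] assms(1) that]
      Suc.prems(1) by blast
  have eq: "frechet_derivative f (at x) = frechet_derivative g (at x)" if "x \<in> S" for x
    using frechet_derivative_at[OF D[OF that]] .
  have "Ck_on k S (\<lambda>x. frechet_derivative g (at x) v)" for v
  proof (rule Suc.IH)
    show "Ck_on k S (\<lambda>x. frechet_derivative f (at x) v)"
      using Suc.prems(2) by simp
  qed (simp add: eq)
  then show ?case
    using differentiableI[OF D] by auto
qed

lemma Ck_on_Suc_imp_continuous:
  "Ck_on (Suc k) S f \<Longrightarrow> continuous_on S f"
  by (simp add: continuous_at_imp_continuous_on differentiable_imp_continuous_within)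

lemma Ck_on_Suc_imp: "Ck_on (Suc k) S f \<Longrightarrow> Ck_on k S f"
proof (induction k arbitrary: f)
  case 0
  then show ?case using Ck_on_Suc_imp_continuous by (metis Ck_on.simps(1))
next
  case (Suc k)
  then show ?case using Ck_on.simps(2) by blast
qed

lemma Ck_on_const: "Ck_on k S (\<lambda>x. c)"
  by (induction k arbitrary: c) auto

lemma Ck_on_linear:
  assumes "linear f"
  shows "Ck_on k S f"
proof (cases k)
  case 0
  then show ?thesis using assms by (simp add: linear_continuous_on linear_conv_bounded_linear)
next
  case (Suc n)
  have D: "(f has_derivative f) (at x)" for x
    using assms by (rule linear_imp_has_derivative)
  then have "frechet_derivative f (at x) = f" for x
    using frechet_derivative_at by metis
  then show ?thesis
    using differentiableI[OF D] Suc by (simp add: Ck_on_const)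
qed

lemma Ck_on_add:
  assumes "open S" "Ck_on k S f" "Ck_on k S g"
  shows "Ck_on k S (\<lambda>x. f x + g x)"
  using assms(2,3)
proof (induction k arbitrary: f g)
  case 0
  then show ?case by (simp add: continuous_on_add)
next
  case (Suc k)
  have D: "((\<lambda>x. f x + g x) has_derivative
      (\<lambda>v. frechet_derivative f (at x) v + frechet_derivative g (at x) v)) (at x)" if "x \<in> S" for x
    by (intro has_derivative_add Ck_on_Suc_has_derivative[OF Suc.prems(1) that]
        Ck_on_Suc_has_derivative[OF Suc.prems(2) that])
  have "Ck_on k S (\<lambda>x. frechet_derivative (\<lambda>x. f x + g x) (at x) v)" for v
  proof (rule Ck_on_cong_open[OF assms(1)])
    show "Ck_on k S (\<lambda>x. frechet_derivative f (at x) v + frechet_derivative g (at x) v)"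
      using Suc by simp
    show "frechet_derivative f (at x) v + frechet_derivative g (at x) v =
        frechet_derivative (\<lambda>x. f x + g x) (at x) v" if "x \<in> S" for x
      by (rule fun_cong[OF frechet_derivative_at[OF D[OF that]]])
  qed
  then show ?case
    using differentiableI[OF D] by auto
qed

lemma Ck_on_bounded_bilinear:
  assumes b: "bounded_bilinear b" and "open S" "Ck_on k S f" "Ck_on k S g"
  shows "Ck_on k S (\<lambda>x. b (f x) (g x))"
  using assms(3,4)
proof (induction k arbitrary: f g)
  case 0
  then show ?case by (simp add: bounded_bilinear.continuous_on[OF b])
next
  case (Suc k)
  have D: "((\<lambda>x. b (f x) (g x)) has_derivative
      (\<lambda>v. b (f x) (frechet_derivative g (at x) v) + b (frechet_derivative f (at x) v) (g x))) (at x)"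
    if "x \<in> S" for x
    by (intro bounded_bilinear.FDERIV[OF b] Ck_on_Suc_has_derivative[OF Suc.prems(1) that]
        Ck_on_Suc_has_derivative[OF Suc.prems(2) that])
  have "Ck_on k S (\<lambda>x. frechet_derivative (\<lambda>x. b (f x) (g x)) (at x) v)" for v
  proof (rule Ck_on_cong_open[OF assms(2)])
    show "Ck_on k S (\<lambda>x. b (f x) (frechet_derivative g (at x) v) + b (frechet_derivative f (at x) v) (g x))"
      using Suc.prems Ck_on_Suc_imp[OF Suc.prems(1)] Ck_on_Suc_imp[OF Suc.prems(2)]
      by (intro Ck_on_add[OF assms(2)] Suc.IH) auto
    show "b (f x) (frechet_derivative g (at x) v) + b (frechet_derivative f (at x) v) (g x) =
        frechet_derivative (\<lambda>x. b (f x) (g x)) (at x) v" if "x \<in> S" for x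
      by (rule fun_cong[OF frechet_derivative_at[OF D[OF that]]])
  qed
  then show ?case
    using differentiableI[OF D] by auto
qed

lemma Ck_on_sum:
  assumes "open S" "finite I" "\<And>i. i \<in> I \<Longrightarrow> Ck_on k S (f i)"
  shows "Ck_on k S (\<lambda>x. \<Sum>i\<in>I. f i x)"
  using assms(2,3) by (induction I) (auto intro: Ck_on_const Ck_on_add[OF assms(1)])

text \<open>The induction is on derivatives in a fixed direction, but the chain rule evaluates the derivative of
  \<open>g\<close> in the moving direction \<open>Df(x) v\<close>. Expanding this direction in the basis leaves only derivatives of \<open>g\<close>
  in fixed directions, to which the induction hypothesis applies.\<close>

lemma Ck_on_compose:
  assumes "open S" "open T" "Ck_on k S f" "Ck_on k T g" "f ` S \<subseteq> T"
  shows "Ck_on k S (\<lambda>x. g (f x))"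
  using assms(3,4)
proof (induction k arbitrary: g)
  case 0
  then show ?case
    using assms(5) by (auto intro: continuous_on_compose2)
next
  case (Suc k)
  let ?Df = "\<lambda>x. frechet_derivative f (at x)"
  let ?Dg = "\<lambda>y. frechet_derivative g (at y)"
  have Dg: "(g has_derivative ?Dg (f x)) (at (f x))" if "x \<in> S" for x
    using that assms(5) by (intro Ck_on_Suc_has_derivative[OF Suc.prems(2)]) auto
  have D: "((\<lambda>x. g (f x)) has_derivative (\<lambda>v. ?Dg (f x) (?Df x v))) (at x)" if "x \<in> S" for x
    by (rule has_derivative_compose[OF Ck_on_Suc_has_derivative[OF Suc.prems(1) that] Dg[OF that]])
  have "Ck_on k S (\<lambda>x. frechet_derivative (\<lambda>x. g (f x)) (at x) v)" for v
  proof (rule Ck_on_cong_open[OF assms(1)])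
    show "Ck_on k S (\<lambda>x. \<Sum>b\<in>Basis. (?Df x v \<bullet> b) *\<^sub>R ?Dg (f x) b)"
      using Suc.prems Ck_on_Suc_imp[OF Suc.prems(1)]
      by (intro Ck_on_sum[OF assms(1)] Ck_on_bounded_bilinear[OF bounded_bilinear_scaleR assms(1)]
          Ck_on_bounded_bilinear[OF bounded_bilinear_inner assms(1)] Ck_on_const Suc.IH) auto
    fix x assume x: "x \<in> S"
    have "linear (?Dg (f x))"
      using Dg[OF x] by (rule has_derivative_linear)
    then have "?Dg (f x) (\<Sum>b\<in>Basis. (?Df x v \<bullet> b) *\<^sub>R b) =
        (\<Sum>b\<in>Basis. (?Df x v \<bullet> b) *\<^sub>R ?Dg (f x) b)"
      by (simp only: linear_sum linear_scale o_def)
    then show "(\<Sum>b\<in>Basis. (?Df x v \<bullet> b) *\<^sub>R ?Dg (f x) b) =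
        frechet_derivative (\<lambda>x. g (f x)) (at x) v"
      unfolding euclidean_representation
      using fun_cong[OF frechet_derivative_at[OF D[OF x]], of v] by metis
  qed
  then show ?case
    using differentiableI[OF D] by auto
qed

text \<open>All constants and exponents are treated at once, because differentiation changes both.\<close>

lemma Ck_on_powr: "Ck_on k {0<..} (\<lambda>x::real. c * x powr e)"
proof (induction k arbitrary: c e)
  case 0
  then show ?case by (auto intro!: continuous_intros)
next
  case (Suc k)
  have D: "((\<lambda>x::real. c * x powr e) has_derivative (\<lambda>v. (c * e * v) * x powr (e - 1))) (at x)"
    if "x > 0" for x
  proof -
    have "((\<lambda>x::real. c * x powr e) has_real_derivative c * (e * x powr (e - 1))) (at x)"
      using that by (intro DERIV_cmult has_real_derivative_powr)
    moreover have "(*) (c * (e * x powr (e - 1))) = (\<lambda>v. (c * e * v) * x powr (e - 1))"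
      by (rule ext) simp
    ultimately show ?thesis
      by (simp only: has_field_derivative_def)
  qed
  have "Ck_on k {0<..} (\<lambda>x. frechet_derivative (\<lambda>x::real. c * x powr e) (at x) v)" for v
  proof (rule Ck_on_cong_open)
    show "Ck_on k {0<..} (\<lambda>x::real. (c * e * v) * x powr (e - 1))" by (rule Suc.IH)
    fix x :: real assume "x \<in> {0<..}"
    then show "(c * e * v) * x powr (e - 1) = frechet_derivative (\<lambda>x. c * x powr e) (at x) v"
      by (intro fun_cong[OF frechet_derivative_at[OF D]]) simp
  qed simp
  then show ?case
    using differentiableI[OF D] by auto
qed

lemma smooth_on_subset: "smooth_on S f \<Longrightarrow> T \<subseteq> S \<Longrightarrow> smooth_on T f"
  unfolding smooth_on_def using Ck_on_subset by blast

lemma smooth_on_cong_open: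
  "open S \<Longrightarrow> smooth_on S f \<Longrightarrow> (\<And>x. x \<in> S \<Longrightarrow> f x = g x) \<Longrightarrow> smooth_on S g"
  unfolding smooth_on_def using Ck_on_cong_open by blast

lemma smooth_on_const: "smooth_on S (\<lambda>x. c)"
  by (simp add: smooth_on_def Ck_on_const)

lemma smooth_on_linear: "linear f \<Longrightarrow> smooth_on S f"
  by (simp add: smooth_on_def Ck_on_linear)

lemma smooth_on_add:
  "open S \<Longrightarrow> smooth_on S f \<Longrightarrow> smooth_on S g \<Longrightarrow> smooth_on S (\<lambda>x. f x + g x)"
  by (simp add: smooth_on_def Ck_on_add)

lemma smooth_on_sum:
  "open S \<Longrightarrow> finite I \<Longrightarrow> (\<And>i. i \<in> I \<Longrightarrow> smooth_on S (f i)) \<Longrightarrow> smooth_on S (\<lambda>x. \<Sum>i\<in>I. f i x)"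
  by (simp add: smooth_on_def Ck_on_sum)

lemma smooth_on_bounded_bilinear:
  "bounded_bilinear b \<Longrightarrow> open S \<Longrightarrow> smooth_on S f \<Longrightarrow> smooth_on S g \<Longrightarrow>
    smooth_on S (\<lambda>x. b (f x) (g x))"
  by (simp add: smooth_on_def Ck_on_bounded_bilinear)

lemmas smooth_on_scaleR = smooth_on_bounded_bilinear[OF bounded_bilinear_scaleR]
lemmas smooth_on_mult = smooth_on_bounded_bilinear[OF bounded_bilinear_mult[where 'a = real]]

lemma smooth_on_compose:
  "open S \<Longrightarrow> open T \<Longrightarrow> smooth_on S f \<Longrightarrow> smooth_on T g \<Longrightarrow> f ` S \<subseteq> T \<Longrightarrow>
    smooth_on S (\<lambda>x. g (f x))"
  unfolding smooth_on_def using Ck_on_compose by blast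

lemma smooth_on_linear_compose:
  "linear h \<Longrightarrow> open S \<Longrightarrow> smooth_on S f \<Longrightarrow> smooth_on S (\<lambda>x. h (f x))"
  using smooth_on_compose[of S UNIV f h] smooth_on_linear by auto

lemma smooth_on_uminus: "open S \<Longrightarrow> smooth_on S f \<Longrightarrow> smooth_on S (\<lambda>x. - f x)"
  by (rule smooth_on_linear_compose[where h = uminus]) (auto intro: linearI)

lemma smooth_on_diff:
  "open S \<Longrightarrow> smooth_on S f \<Longrightarrow> smooth_on S g \<Longrightarrow> smooth_on S (\<lambda>x. f x - g x)"
  using smooth_on_add[of S f "\<lambda>x. - g x"] smooth_on_uminus[of S g] by simp

lemma smooth_on_fst: "open S \<Longrightarrow> smooth_on S f \<Longrightarrow> smooth_on S (\<lambda>x. fst (f x))"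
  by (rule smooth_on_linear_compose) (auto intro: linearI)

lemma smooth_on_snd: "open S \<Longrightarrow> smooth_on S f \<Longrightarrow> smooth_on S (\<lambda>x. snd (f x))"
  by (rule smooth_on_linear_compose) (auto intro: linearI)

lemma smooth_on_Pair:
  assumes "open S" "smooth_on S f" "smooth_on S g"
  shows "smooth_on S (\<lambda>x. (f x, g x))"
proof -
  have "smooth_on S (\<lambda>x. (f x, 0) + (0, g x))"
    by (intro smooth_on_add assms smooth_on_linear_compose[where h = "\<lambda>y. (y, 0)"]
        smooth_on_linear_compose[where h = "\<lambda>y. (0, y)"]) (auto intro: linearI)
  then show ?thesis by simp
qed

lemma smooth_on_powr:
  fixes f :: "'a::euclidean_space \<Rightarrow> real"
  assumes "open S" "smooth_on S f" "\<And>x. x \<in> S \<Longrightarrow> 0 < f x"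
  shows "smooth_on S (\<lambda>x. f x powr e)"
proof -
  have "smooth_on {0<..} (\<lambda>x::real. x powr e)"
    using Ck_on_powr[of _ 1 e] by (simp add: smooth_on_def)
  moreover have "f ` S \<subseteq> {0<..}"
    using assms(3) by blast
  ultimately show ?thesis
    by (rule smooth_on_compose[OF assms(1) open_greaterThan assms(2)])
qed

lemma smooth_on_divide:
  fixes f g :: "'a::euclidean_space \<Rightarrow> real"
  assumes "open S" "smooth_on S f" "smooth_on S g" "\<And>x. x \<in> S \<Longrightarrow> 0 < g x"
  shows "smooth_on S (\<lambda>x. f x / g x)"
proof (rule smooth_on_cong_open[OF assms(1)])
  show "smooth_on S (\<lambda>x. f x * g x powr (- 1))"
    by (rule smooth_on_mult[OF assms(1,2) smooth_on_powr[OF assms(1,3,4)]])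
  show "f x * g x powr (- 1) = f x / g x" if "x \<in> S" for x
    using assms(4)[OF that] by (simp add: powr_minus field_simps)
qed

lemma smooth_on_imp_continuous_on: "smooth_on S f \<Longrightarrow> continuous_on S f"
  unfolding smooth_on_def using Ck_on.simps(1) by blast

lemma smooth_on_imp_has_derivative:
  "smooth_on S f \<Longrightarrow> x \<in> S \<Longrightarrow> (f has_derivative frechet_derivative f (at x)) (at x)"
  unfolding smooth_on_def using Ck_on_Suc_has_derivative by blast

lemma smooth_on_frechet_derivative:
  "smooth_on S f \<Longrightarrow> smooth_on S (\<lambda>x. frechet_derivative f (at x) v)"
  unfolding smooth_on_def using Ck_on.simps(2) by blast

subsection \<open>Symmetry of second derivatives\<close>

text \<open>The second difference on the left is symmetric in \<open>v\<close> and \<open>w\<close>; two applications of the mean value theorem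
  express it by an iterated derivative, in either order.\<close>

lemma second_difference_mean_value:
  fixes f :: "'a::euclidean_space \<Rightarrow> real"
  assumes f: "smooth_on S f" and h: "h > 0"
    and S: "\<And>s t. \<lbrakk>0 \<le> s; s \<le> h; 0 \<le> t; t \<le> h\<rbrakk> \<Longrightarrow> x + s *\<^sub>R v + t *\<^sub>R w \<in> S"
  obtains s t where "0 \<le> s" "s \<le> h" "0 \<le> t" "t \<le> h"
    "f (x + h *\<^sub>R v + h *\<^sub>R w) - f (x + h *\<^sub>R v) - f (x + h *\<^sub>R w) + f x =
      h * h * frechet_derivative (\<lambda>y. frechet_derivative f (at y) v) (at (x + s *\<^sub>R v + t *\<^sub>R w)) w"
proof -
  let ?Df = "\<lambda>y. frechet_derivative f (at y)"
  let ?g = "\<lambda>y. ?Df y v"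
  have line: "((\<lambda>s. F (a + s *\<^sub>R u)) has_real_derivative frechet_derivative F (at (a + s *\<^sub>R u)) u) (at s)"
    if F: "smooth_on S F" "a + s *\<^sub>R u \<in> S" for F :: "'a \<Rightarrow> real" and a u s
  proof -
    have D: "(F has_derivative frechet_derivative F (at (a + s *\<^sub>R u))) (at (a + s *\<^sub>R u))"
      using smooth_on_imp_has_derivative[OF F] .
    have "((\<lambda>s. F (a + s *\<^sub>R u)) has_derivative
        (\<lambda>r. frechet_derivative F (at (a + s *\<^sub>R u)) (r *\<^sub>R u))) (at s)"
      by (rule has_derivative_compose[where f = "\<lambda>s. a + s *\<^sub>R u" and f' = "\<lambda>r. r *\<^sub>R u", OF _ D])
        (auto intro!: derivative_eq_intros)
    moreover have "frechet_derivative F (at (a + s *\<^sub>R u)) (r *\<^sub>R u) =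
        frechet_derivative F (at (a + s *\<^sub>R u)) u * r" for r
      using linear_scale[OF has_derivative_linear[OF D], of r u] by simp
    ultimately show ?thesis
      by (simp add: has_field_derivative_def)
  qed
  let ?k = "\<lambda>s. f (x + h *\<^sub>R w + s *\<^sub>R v) - f (x + s *\<^sub>R v)"
  let ?k' = "\<lambda>s. ?g (x + h *\<^sub>R w + s *\<^sub>R v) - ?g (x + s *\<^sub>R v)"
  have "(?k has_real_derivative ?k' s) (at s)" if s: "0 \<le> s" "s \<le> h" for s
  proof -
    have "x + h *\<^sub>R w + s *\<^sub>R v \<in> S" "x + s *\<^sub>R v \<in> S"
      using S[of s h] S[of s 0] s h by (simp_all add: algebra_simps)
    then show ?thesis
      by (intro DERIV_diff line f)
  qed
  then obtain s where s: "0 < s" "s < h" "?k h - ?k 0 = (h - 0) * ?k' s"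
    using MVT2[OF h, of ?k ?k'] by blast
  have "((\<lambda>t. ?g (x + s *\<^sub>R v + t *\<^sub>R w)) has_real_derivative
      frechet_derivative ?g (at (x + s *\<^sub>R v + t *\<^sub>R w)) w) (at t)" if "0 \<le> t" "t \<le> h" for t
    using S s that by (intro line smooth_on_frechet_derivative f) auto
  then obtain t where t: "0 < t" "t < h"
    "?g (x + s *\<^sub>R v + h *\<^sub>R w) - ?g (x + s *\<^sub>R v + 0 *\<^sub>R w) =
      (h - 0) * frechet_derivative ?g (at (x + s *\<^sub>R v + t *\<^sub>R w)) w"
    using MVT2[OF h, of "\<lambda>t. ?g (x + s *\<^sub>R v + t *\<^sub>R w)"
      "\<lambda>t. frechet_derivative ?g (at (x + s *\<^sub>R v + t *\<^sub>R w)) w"] by blast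
  have swap: "x + h *\<^sub>R w + r *\<^sub>R v = x + r *\<^sub>R v + h *\<^sub>R w" for r
    by simp
  have "f (x + h *\<^sub>R v + h *\<^sub>R w) - f (x + h *\<^sub>R v) - f (x + h *\<^sub>R w) + f x = ?k h - ?k 0"
    unfolding swap by simp
  also have "\<dots> = h * (?g (x + s *\<^sub>R v + h *\<^sub>R w) - ?g (x + s *\<^sub>R v))"
    using s(3) unfolding swap by simp
  also have "\<dots> = h * h * frechet_derivative ?g (at (x + s *\<^sub>R v + t *\<^sub>R w)) w"
    using t(3) by simp
  finally show ?thesis
    using s t by (intro that[of s t]) auto
qed

lemma second_derivative_symmetric_real:
  fixes f :: "'a::euclidean_space \<Rightarrow> real"
  assumes S: "open S" and f: "smooth_on S f" and x: "x \<in> S"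
  shows "frechet_derivative (\<lambda>y. frechet_derivative f (at y) v) (at x) w =
    frechet_derivative (\<lambda>y. frechet_derivative f (at y) w) (at x) v"
proof -
  define A where "A v w y = frechet_derivative (\<lambda>y. frechet_derivative f (at y) v) (at y) w" for v w y
  have A: "continuous (at x) (A v w)" for v w
    using smooth_on_imp_continuous_on[OF smooth_on_frechet_derivative[OF smooth_on_frechet_derivative[OF f]], of v w]
      S x unfolding A_def by (simp add: continuous_on_eq_continuous_at)
  have close: "dist (A v w x) (A w v x) < e" if e: "e > 0" for e
  proof -
    obtain d1 where d1: "d1 > 0" "\<And>y. dist y x < d1 \<Longrightarrow> dist (A v w y) (A v w x) < e / 2"
      using A[of v w] e unfolding continuous_at_eps_delta by (meson half_gt_zero)
    obtain d2 where d2: "d2 > 0" "\<And>y. dist y x < d2 \<Longrightarrow> dist (A w v y) (A w v x) < e / 2"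
      using A[of w v] e unfolding continuous_at_eps_delta by (meson half_gt_zero)
    obtain d3 where d3: "d3 > 0" "ball x d3 \<subseteq> S"
      using S x open_contains_ball by blast
    define d where "d = min d1 (min d2 d3)"
    define h where "h = d / (norm v + norm w + 1)"
    have d: "d > 0" "d \<le> d1" "d \<le> d2" "d \<le> d3"
      using d1 d2 d3 by (auto simp: d_def)
    have n: "norm v + norm w + 1 > 0"
      by (smt (verit) norm_ge_zero)
    have h: "h > 0" using d n by (simp add: h_def)
    have hd: "h * (norm v + norm w) < d"
      using h n by (simp add: h_def field_simps)
    have near: "dist (x + s *\<^sub>R v + t *\<^sub>R w) x < d" if "0 \<le> s" "s \<le> h" "0 \<le> t" "t \<le> h" for s t
    proof -
      have "dist (x + s *\<^sub>R v + t *\<^sub>R w) x = norm (s *\<^sub>R v + t *\<^sub>R w)"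
        by (simp add: dist_norm add.assoc)
      also have "\<dots> \<le> s * norm v + t * norm w"
        using that by (metis abs_of_nonneg norm_scaleR norm_triangle_ineq)
      also have "\<dots> \<le> h * norm v + h * norm w"
        using that by (intro add_mono mult_right_mono) auto
      finally show ?thesis using hd by (simp add: algebra_simps)
    qed
    have inS: "x + s *\<^sub>R v + t *\<^sub>R w \<in> S" if "0 \<le> s" "s \<le> h" "0 \<le> t" "t \<le> h" for s t
      using near[OF that] d3 d by (auto simp: dist_commute)
    obtain s t where st: "0 \<le> s" "s \<le> h" "0 \<le> t" "t \<le> h"
      "f (x + h *\<^sub>R v + h *\<^sub>R w) - f (x + h *\<^sub>R v) - f (x + h *\<^sub>R w) + f x = h * h * A v w (x + s *\<^sub>R v + t *\<^sub>R w)"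
      unfolding A_def using second_difference_mean_value[OF f h inS] by blast
    have inS': "x + s *\<^sub>R w + t *\<^sub>R v \<in> S" if "0 \<le> s" "s \<le> h" "0 \<le> t" "t \<le> h" for s t
    proof -
      have "x + s *\<^sub>R w + t *\<^sub>R v = x + t *\<^sub>R v + s *\<^sub>R w" by simp
      then show ?thesis using inS[OF that(3,4,1,2)] by (simp only:)
    qed
    obtain s' t' where st': "0 \<le> s'" "s' \<le> h" "0 \<le> t'" "t' \<le> h"
      "f (x + h *\<^sub>R w + h *\<^sub>R v) - f (x + h *\<^sub>R w) - f (x + h *\<^sub>R v) + f x = h * h * A w v (x + s' *\<^sub>R w + t' *\<^sub>R v)"
      unfolding A_def using second_difference_mean_value[OF f h inS'] by blast
    have swap: "f (x + h *\<^sub>R w + h *\<^sub>R v) = f (x + h *\<^sub>R v + h *\<^sub>R w)"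
      by (simp add: add_ac)
    have "h * h * A v w (x + s *\<^sub>R v + t *\<^sub>R w) = h * h * A w v (x + s' *\<^sub>R w + t' *\<^sub>R v)"
      using st(5) st'(5) swap by linarith
    then have "A v w (x + s *\<^sub>R v + t *\<^sub>R w) = A w v (x + s' *\<^sub>R w + t' *\<^sub>R v)"
      using h by simp
    moreover have "dist (A v w (x + s *\<^sub>R v + t *\<^sub>R w)) (A v w x) < e / 2"
      using near[OF st(1-4)] d by (intro d1) auto
    moreover have "dist (x + s' *\<^sub>R w + t' *\<^sub>R v) x < d"
    proof -
      have "x + s' *\<^sub>R w + t' *\<^sub>R v = x + t' *\<^sub>R v + s' *\<^sub>R w" by simp
      then show ?thesis using near[OF st'(3,4,1,2)] by (simp only:)
    qed
    then have "dist (A w v (x + s' *\<^sub>R w + t' *\<^sub>R v)) (A w v x) < e / 2"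
      using d by (intro d2) auto
    ultimately show ?thesis
      unfolding dist_real_def by linarith
  qed
  have "\<not> 0 < dist (A v w x) (A w v x)"
    using close by blast
  then show ?thesis
    unfolding A_def by simp
qed

lemma second_derivative_symmetric:
  fixes f :: "'a::euclidean_space \<Rightarrow> 'b::euclidean_space"
  assumes S: "open S" and f: "smooth_on S f" and x: "x \<in> S"
  shows "frechet_derivative (\<lambda>y. frechet_derivative f (at y) v) (at x) w =
    frechet_derivative (\<lambda>y. frechet_derivative f (at y) w) (at x) v"
proof (rule euclidean_eqI)
  fix b :: 'b assume "b \<in> Basis"
  have fb: "smooth_on S (\<lambda>y. f y \<bullet> b)"
    using smooth_on_linear_compose[OF _ S f, of "\<lambda>y. y \<bullet> b"] bounded_linear_inner_left
    by (metis bounded_linear.linear)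
  have inner: "frechet_derivative (\<lambda>y. g y \<bullet> b) (at y) u = frechet_derivative g (at y) u \<bullet> b"
    if "smooth_on S g" "y \<in> S" for g :: "'a \<Rightarrow> 'b" and y u
    using fun_cong[OF frechet_derivative_at[OF has_derivative_inner_left[OF smooth_on_imp_has_derivative[OF that], of b]], of u]
    by simp
  have second: "frechet_derivative (\<lambda>y. frechet_derivative (\<lambda>y. f y \<bullet> b) (at y) v) (at x) w =
      frechet_derivative (\<lambda>y. frechet_derivative f (at y) v) (at x) w \<bullet> b" for v w
  proof -
    have "frechet_derivative (\<lambda>y. frechet_derivative (\<lambda>y. f y \<bullet> b) (at y) v) (at x) =
        frechet_derivative (\<lambda>y. frechet_derivative f (at y) v \<bullet> b) (at x)"
      using smooth_on_imp_has_derivative[OF smooth_on_frechet_derivative[OF fb] x]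
      by (intro frechet_derivative_transform_within_open[OF _ S x])
         (auto simp: differentiable_def inner[OF f])
    then show ?thesis
      using inner[OF smooth_on_frechet_derivative[OF f] x] by simp
  qed
  show "frechet_derivative (\<lambda>y. frechet_derivative f (at y) v) (at x) w \<bullet> b =
      frechet_derivative (\<lambda>y. frechet_derivative f (at y) w) (at x) v \<bullet> b"
    using second_derivative_symmetric_real[OF S fb x, of v w] by (simp add: second)
qed

section \<open>Tangent vectors of quotient manifolds\<close>

definition local_section ::
    "'m::euclidean_space set \<Rightarrow> ('m \<Rightarrow> 'q) \<Rightarrow> ('q, 'e::euclidean_space) chart \<Rightarrow> ('e \<Rightarrow> 'm) \<Rightarrow> bool" where
  "local_section M p c s \<longleftrightarrow>
     smooth_on (snd c ` fst c) s \<and> (\<forall>q\<in>fst c. s (snd c q) \<in> M \<and> p (s (snd c q)) = q)"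

lemma quotient_atlasD:
  assumes "c \<in> quotient_atlas M p"
  shows "fst c \<subseteq> p ` M" "open (M \<inter> p -` fst c)" "inj_on (snd c) (fst c)" "open (snd c ` fst c)"
    "smooth_on (M \<inter> p -` fst c) (snd c \<circ> p)" "\<exists>s. local_section M p c s"
  using assms by (auto simp: quotient_atlas_def local_section_def)

lemma local_sectionD:
  assumes "local_section M p c s"
  shows "smooth_on (snd c ` fst c) s"
    and "q \<in> fst c \<Longrightarrow> s (snd c q) \<in> M" and "q \<in> fst c \<Longrightarrow> p (s (snd c q)) = q"
  using assms by (auto simp: local_section_def)

lemma coordinate_map_has_derivative:
  assumes "c \<in> quotient_atlas M p" "x \<in> M" "p x \<in> fst c"
  shows "(snd c \<circ> p has_derivative frechet_derivative (snd c \<circ> p) (at x)) (at x)"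
  by (rule smooth_on_imp_has_derivative[OF quotient_atlasD(5)[OF assms(1)]]) (use assms in auto)

lemma local_section_has_derivative:
  assumes "c \<in> quotient_atlas M p" "local_section M p c s" "q \<in> fst c"
  shows "(s has_derivative frechet_derivative s (at (snd c q))) (at (snd c q))"
  by (rule smooth_on_imp_has_derivative[OF local_sectionD(1)[OF assms(2)]]) (use assms in auto)

lemma open_overlap:
  assumes c: "c \<in> quotient_atlas M p" and s: "local_section M p c s" and T: "open T" "T \<subseteq> M"
  shows "open (snd c ` fst c \<inter> s -` T)"
  using continuous_open_preimage[OF smooth_on_imp_continuous_on[OF local_sectionD(1)[OF s]]
      quotient_atlasD(4)[OF c] T(1)] .

lemma transition_eq:
  assumes "c \<in> quotient_atlas M p" "local_section M p c s" "y \<in> snd c ` fst c"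
  shows "transition c c' y = snd c' (p (s y))"
  using assms(3) inv_into_f_f[OF quotient_atlasD(3)[OF assms(1)]] local_sectionD(3)[OF assms(2)]
  by (auto simp: transition_def)

text \<open>A transition map is the second coordinate map composed with the projection and a local section; this
  reduces the calculus of tangent vectors of the quotient to calculus on \<open>M\<close>.\<close>

lemma transition_has_derivative:
  assumes c: "c \<in> quotient_atlas M p" and c': "c' \<in> quotient_atlas M p" and s: "local_section M p c s"
    and q: "q \<in> fst c" "q \<in> fst c'"
  shows "(transition c c' has_derivative
      (\<lambda>w. frechet_derivative (snd c' \<circ> p) (at (s (snd c q))) (frechet_derivative s (at (snd c q)) w)))
      (at (snd c q))"
proof -
  have 1: "(snd c' \<circ> p has_derivative frechet_derivative (snd c' \<circ> p) (at (s (snd c q)))) (at (s (snd c q)))"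
    using local_sectionD(2,3)[OF s q(1)] q(2) by (intro coordinate_map_has_derivative[OF c']) auto
  have 2: "((\<lambda>y. (snd c' \<circ> p) (s y)) has_derivative
      (\<lambda>w. frechet_derivative (snd c' \<circ> p) (at (s (snd c q))) (frechet_derivative s (at (snd c q)) w)))
      (at (snd c q))"
    by (rule has_derivative_compose[OF local_section_has_derivative[OF c s q(1)] 1])
  show ?thesis
    by (rule has_derivative_transform_within_open[OF 2 quotient_atlasD(4)[OF c]])
      (use q transition_eq[OF c s] in auto)
qed

lemma coordinate_derivative_local_section:
  assumes c: "c \<in> quotient_atlas M p" and s: "local_section M p c s" and q: "q \<in> fst c"
  shows "frechet_derivative (snd c \<circ> p) (at (s (snd c q))) (frechet_derivative s (at (snd c q)) w) = w"
proof -
  have "transition c c y = y" if "y \<in> snd c ` fst c" for y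
    using transition_eq[OF c s that] local_sectionD(3)[OF s] that by auto
  then have "((\<lambda>y. y) has_derivative
      (\<lambda>w. frechet_derivative (snd c \<circ> p) (at (s (snd c q))) (frechet_derivative s (at (snd c q)) w)))
      (at (snd c q))"
    by (intro has_derivative_transform_within_open[OF transition_has_derivative[OF c c s q q]
          quotient_atlasD(4)[OF c]]) (use q in auto)
  from has_derivative_unique[OF this has_derivative_ident] show ?thesis
    by (rule fun_cong)
qed

lemma linear_push_tangent:
  fixes M :: "'m::euclidean_space set" and p :: "'m \<Rightarrow> 'q"
  defines "A \<equiv> quotient_atlas M p :: ('q, 'e::euclidean_space) chart set"
  assumes x: "x \<in> M"
  shows "linear (push_tangent A p x)"
proof -
  have lin: "linear (frechet_derivative (snd c \<circ> p) (at x))" if "c \<in> charts_at A (p x)" for c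
  proof -
    have "c \<in> quotient_atlas M p" "p x \<in> fst c"
      using that by (simp_all add: charts_at_def A_def)
    then show ?thesis
      by (rule has_derivative_linear[OF coordinate_map_has_derivative[OF _ x]])
  qed
  show ?thesis
  proof (rule linearI; rule ext)
    fix \<xi> \<eta> and c :: "('q, 'e) chart" and r :: real
    show "push_tangent A p x (\<xi> + \<eta>) c = (push_tangent A p x \<xi> + push_tangent A p x \<eta>) c"
      by (cases "c \<in> charts_at A (p x)") (simp_all add: push_tangent_def linear_add[OF lin])
    show "push_tangent A p x (r *\<^sub>R \<xi>) c = (r *\<^sub>R push_tangent A p x \<xi>) c"
      by (cases "c \<in> charts_at A (p x)") (simp_all add: push_tangent_def linear_scale[OF lin] scaleR_fun_def)
  qed
qed

lemma push_tangent_in_tangent_space: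
  assumes x: "x \<in> M"
  shows "push_tangent (quotient_atlas M p) p x \<xi> \<in> tangent_space (quotient_atlas M p) (p x)"
proof -
  have "frechet_derivative (snd c' \<circ> p) (at x) \<xi> =
      frechet_derivative (transition c c') (at (snd c (p x))) (frechet_derivative (snd c \<circ> p) (at x) \<xi>)"
    if c: "c \<in> charts_at (quotient_atlas M p) (p x)" "c' \<in> charts_at (quotient_atlas M p) (p x)" for c c'
  proof -
    have cA: "c \<in> quotient_atlas M p" "p x \<in> fst c" and cA': "c' \<in> quotient_atlas M p" "p x \<in> fst c'"
      using c by (auto simp: charts_at_def)
    obtain s where s: "local_section M p c s"
      using quotient_atlasD(6)[OF cA(1)] by blast
    have t: "(transition c c' has_derivative frechet_derivative (transition c c') (at ((snd c \<circ> p) x))) (at ((snd c \<circ> p) x))"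
      using differentiableI[OF transition_has_derivative[OF cA(1) cA'(1) s cA(2) cA'(2)]]
      by (simp add: frechet_derivative_works)
    have "((\<lambda>y. transition c c' ((snd c \<circ> p) y)) has_derivative
        (\<lambda>\<xi>. frechet_derivative (transition c c') (at ((snd c \<circ> p) x)) (frechet_derivative (snd c \<circ> p) (at x) \<xi>))) (at x)"
      by (rule has_derivative_compose[OF coordinate_map_has_derivative[OF cA(1) x cA(2)] t])
    moreover have "x \<in> M \<inter> p -` fst c"
      using x cA by simp
    moreover have "transition c c' ((snd c \<circ> p) y) = (snd c' \<circ> p) y" if "y \<in> M \<inter> p -` fst c" for y
      using that transition_eq[OF cA(1) s, of "snd c (p y)" c'] local_sectionD(3)[OF s, of "p y"] by simp
    ultimately have "(snd c' \<circ> p has_derivative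
        (\<lambda>\<xi>. frechet_derivative (transition c c') (at ((snd c \<circ> p) x)) (frechet_derivative (snd c \<circ> p) (at x) \<xi>))) (at x)"
      using has_derivative_transform_within_open[OF _ quotient_atlasD(2)[OF cA(1)]] by blast
    from fun_cong[OF frechet_derivative_at[OF this], of \<xi>] show ?thesis by simp
  qed
  then show ?thesis
    by (auto simp: tangent_space_def push_tangent_def)
qed

lemma coord_vector_eq_push_tangent:
  assumes c: "c \<in> quotient_atlas M p" and s: "local_section M p c s" and q: "q \<in> fst c"
  shows "coord_vector (quotient_atlas M p) c q w =
    push_tangent (quotient_atlas M p) p (s (snd c q)) (frechet_derivative s (at (snd c q)) w)"
proof (rule ext)
  fix c'
  have "frechet_derivative (transition c c') (at (snd c q)) w =
      frechet_derivative (snd c' \<circ> p) (at (s (snd c q))) (frechet_derivative s (at (snd c q)) w)"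
    if "c' \<in> charts_at (quotient_atlas M p) q"
    using fun_cong[OF frechet_derivative_at[OF transition_has_derivative[OF c _ s q]], of c' w] that
    by (simp add: charts_at_def)
  then show "coord_vector (quotient_atlas M p) c q w c' =
      push_tangent (quotient_atlas M p) p (s (snd c q)) (frechet_derivative s (at (snd c q)) w) c'"
    using local_sectionD(3)[OF s q] by (simp add: coord_vector_def push_tangent_def)
qed

lemma tangent_eq_coord_vector:
  assumes "v \<in> tangent_space A q" "c \<in> charts_at A q"
  shows "v = coord_vector A c q (v c)"
proof (rule ext)
  fix c'
  show "v c' = coord_vector A c q (v c) c'"
  proof (cases "c' \<in> charts_at A q")
    case True
    then have "v c' = frechet_derivative (transition c c') (at (snd c q)) (v c)"
      using assms unfolding tangent_space_def by blast
    then show ?thesis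
      unfolding coord_vector_def if_P[OF True] .
  next
    case False
    then have "v c' = 0"
      using assms unfolding tangent_space_def by blast
    with False show ?thesis
      by (simp add: coord_vector_def)
  qed
qed

text \<open>In particular \<open>push_tangent\<close> is onto the tangent space at every point on the image of a local section.\<close>

lemma tangent_eq_push_tangent:
  assumes c: "c \<in> quotient_atlas M p" and s: "local_section M p c s" and q: "q \<in> fst c"
    and v: "v \<in> tangent_space (quotient_atlas M p) q"
  shows "v = push_tangent (quotient_atlas M p) p (s (snd c q)) (frechet_derivative s (at (snd c q)) (v c))"
proof -
  have "c \<in> charts_at (quotient_atlas M p) q"
    using c q by (simp add: charts_at_def)
  from tangent_eq_coord_vector[OF v this] show ?thesis
    unfolding coord_vector_eq_push_tangent[OF c s q] .
qed

lemma push_tangent_coordinate: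
  assumes c: "c \<in> quotient_atlas M p" and s: "local_section M p c s" and q: "q \<in> fst c"
  shows "push_tangent (quotient_atlas M p) p (s (snd c q)) (frechet_derivative s (at (snd c q)) w) c = w"
  using coordinate_derivative_local_section[OF c s q] local_sectionD(3)[OF s q] c q
  by (simp add: push_tangent_def charts_at_def)

text \<open>The bound \<open>\<delta>\<close> depends on the chart, since the projected curve may leave the chart domain before \<open>k\<close>
  reaches the ends of its interval.\<close>

lemma push_tangent_curve_coordinate:
  assumes c: "c \<in> quotient_atlas M p" and x: "x \<in> M" "p x \<in> fst c"
    and k: "k 0 = x" "0 < \<epsilon>" "smooth_on {-\<epsilon><..<\<epsilon>} k" "(k has_vector_derivative \<xi>) (at (0::real))"
  obtains \<delta> where "0 < \<delta>" "\<delta> \<le> \<epsilon>" "k ` {-\<delta><..<\<delta>} \<subseteq> M \<inter> p -` fst c"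
    "smooth_on {-\<delta><..<\<delta>} (snd c \<circ> (\<lambda>t. p (k t)))"
    "(snd c \<circ> (\<lambda>t. p (k t)) has_vector_derivative push_tangent (quotient_atlas M p) p x \<xi> c) (at 0)"
proof -
  have "open ({-\<epsilon><..<\<epsilon>} \<inter> k -` (M \<inter> p -` fst c))"
    by (rule continuous_open_preimage[OF smooth_on_imp_continuous_on[OF k(3)] _ quotient_atlasD(2)[OF c]]) simp
  moreover have "0 \<in> {-\<epsilon><..<\<epsilon>} \<inter> k -` (M \<inter> p -` fst c)"
    using x k by simp
  ultimately obtain \<delta> where \<delta>: "0 < \<delta>" "ball 0 \<delta> \<subseteq> {-\<epsilon><..<\<epsilon>} \<inter> k -` (M \<inter> p -` fst c)"
    using open_contains_ball by blast
  have b: "ball 0 \<delta> = {-\<delta><..<\<delta>}"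
    by (auto simp: dist_real_def)
  have sub: "{-\<delta><..<\<delta>} \<subseteq> {-\<epsilon><..<\<epsilon>}" "k ` {-\<delta><..<\<delta>} \<subseteq> M \<inter> p -` fst c"
    using \<delta>(2) unfolding b by blast+
  show ?thesis
  proof (rule that[OF \<delta>(1) _ sub(2)])
    show "\<delta> \<le> \<epsilon>"
      using sub(1) \<delta>(1) k(2) by (simp add: greaterThanLessThan_subseteq_greaterThanLessThan)
    have "smooth_on {-\<delta><..<\<delta>} (\<lambda>t. (snd c \<circ> p) (k t))"
      by (rule smooth_on_compose[OF _ quotient_atlasD(2)[OF c] smooth_on_subset[OF k(3) sub(1)]
            quotient_atlasD(5)[OF c] sub(2)]) simp
    then show "smooth_on {-\<delta><..<\<delta>} (snd c \<circ> (\<lambda>t. p (k t)))"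
      by (simp add: o_def)
    have D: "(snd c \<circ> p has_derivative frechet_derivative (snd c \<circ> p) (at x)) (at (k 0))"
      using coordinate_map_has_derivative[OF c x] k(1) by simp
    have "((\<lambda>t. (snd c \<circ> p) (k t)) has_derivative (\<lambda>r. frechet_derivative (snd c \<circ> p) (at x) (r *\<^sub>R \<xi>))) (at 0)"
      by (rule has_derivative_compose[OF k(4)[unfolded has_vector_derivative_def] D])
    moreover have "push_tangent (quotient_atlas M p) p x \<xi> c = frechet_derivative (snd c \<circ> p) (at x) \<xi>"
      using c x by (simp add: push_tangent_def charts_at_def)
    ultimately show "(snd c \<circ> (\<lambda>t. p (k t)) has_vector_derivative push_tangent (quotient_atlas M p) p x \<xi> c) (at 0)"
      using linear_scale[OF has_derivative_linear[OF D]]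
      by (simp add: has_vector_derivative_def o_def)
  qed
qed

section \<open>Minkowski space and affine reparametrizations\<close>

lemma mink_sym: "mink x y = mink y x"
  by (simp add: mink_def mult.commute)

lemma mink_linear_simps [simp]:
  "mink (x + y) z = mink x z + mink y z" "mink x (y + z) = mink x y + mink x z"
  "mink (x - y) z = mink x z - mink y z" "mink x (y - z) = mink x y - mink x z"
  "mink (r *\<^sub>R x) y = r * mink x y" "mink x (r *\<^sub>R y) = r * mink x y"
  "mink (- x) y = - mink x y" "mink x (- y) = - mink x y" "mink 0 y = 0" "mink x 0 = 0"
  by (simp_all add: mink_def algebra_simps)

lemma bounded_bilinear_mink: "bounded_bilinear mink"
  by (rule bilinear_conv_bounded_bilinear[THEN iffD1]) (auto simp: bilinear_def intro!: linearI)

lemma snd_G_curv: "\<gamma> \<in> G_curv \<longleftrightarrow> snd \<gamma> \<noteq> 0"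
  by (cases \<gamma>) (simp add: G_curv_def)

lemma open_G_curv: "open G_curv"
  unfolding G_curv_def by (intro open_Times) auto

lemma aff_act_sel [simp]:
  "fst (aff_act a b \<gamma>) = fst \<gamma> + b *\<^sub>R snd \<gamma>" "snd (aff_act a b \<gamma>) = a *\<^sub>R snd \<gamma>"
  by (simp_all add: aff_act_def)

lemma linear_aff_act: "linear (aff_act a b)"
  by (rule linearI) (simp_all add: aff_act_def algebra_simps)

lemma aff_act_compose: "aff_act a b (aff_act a' b' \<gamma>) = aff_act (a * a') (b' + b * a') \<gamma>"
  by (simp add: aff_act_def algebra_simps)

lemma aff_act_1_0 [simp]: "aff_act 1 0 \<gamma> = \<gamma>"
  by (simp add: aff_act_def)

lemma aff_act_in_G_curv: "0 < a \<Longrightarrow> aff_act a b \<gamma> \<in> G_curv \<longleftrightarrow> \<gamma> \<in> G_curv"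
  by (simp add: snd_G_curv)

lemma traj_of_aff_act:
  assumes "0 < a"
  shows "traj_of (aff_act a b \<gamma>) = traj_of \<gamma>"
proof
  show "traj_of (aff_act a b \<gamma>) \<subseteq> traj_of \<gamma>"
    unfolding traj_of_def using assms by (force simp: aff_act_compose)
  show "traj_of \<gamma> \<subseteq> traj_of (aff_act a b \<gamma>)"
  proof
    fix \<eta> assume "\<eta> \<in> traj_of \<gamma>"
    then obtain a' b' where \<eta>: "\<eta> = aff_act a' b' \<gamma>" "0 < a'"
      unfolding traj_of_def by blast
    have "\<eta> = aff_act (a' / a) ((b' - b) / a) (aff_act a b \<gamma>)"
      using assms \<eta> by (simp add: aff_act_compose)
    moreover have "0 < a' / a"
      using assms \<eta> by simp
    ultimately show "\<eta> \<in> traj_of (aff_act a b \<gamma>)"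
      unfolding traj_of_def by blast
  qed
qed

lemma mem_traj_of: "\<gamma> \<in> traj_of \<gamma>"
  unfolding traj_of_def using aff_act_1_0[of \<gamma>] zero_less_one[where 'a = real] by (metis (mono_tags, lifting) mem_Collect_eq)

lemma traj_of_eqE:
  assumes "traj_of \<gamma> = traj_of \<gamma>'"
  obtains a b where "0 < a" "\<gamma>' = aff_act a b \<gamma>"
proof -
  have "\<gamma>' \<in> traj_of \<gamma>"
    using mem_traj_of[of \<gamma>'] assms by simp
  then show ?thesis
    unfolding traj_of_def using that by blast
qed

text \<open>Coordinates of trajectories are constant on orbits, and the transformations \<open>aff_act a b\<close> are linear,
  so each of them is its own derivative.\<close>

lemma D_traj_equivariant:
  assumes a: "0 < a" and \<gamma>: "\<gamma> \<in> G_curv"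
  shows "D_traj (aff_act a b \<gamma>) (aff_act a b \<delta>) = D_traj \<gamma> \<delta>"
proof (rule ext)
  fix c :: "(phase set, model) chart"
  show "D_traj (aff_act a b \<gamma>) (aff_act a b \<delta>) c = D_traj \<gamma> \<delta> c"
  proof (cases "c \<in> charts_at traj_atlas (traj_of \<gamma>)")
    case True
    then have c: "c \<in> quotient_atlas G_curv traj_of" "traj_of (aff_act a b \<gamma>) \<in> fst c"
      by (simp_all add: charts_at_def traj_atlas_def traj_of_aff_act a)
    have \<gamma>': "aff_act a b \<gamma> \<in> G_curv"
      using a \<gamma> by (simp add: aff_act_in_G_curv)
    have "((\<lambda>\<gamma>. (snd c \<circ> traj_of) (aff_act a b \<gamma>)) has_derivative
        (\<lambda>\<delta>. frechet_derivative (snd c \<circ> traj_of) (at (aff_act a b \<gamma>)) (aff_act a b \<delta>))) (at \<gamma>)"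
      by (rule has_derivative_compose[OF linear_imp_has_derivative[OF linear_aff_act]
            coordinate_map_has_derivative[OF c(1) \<gamma>' c(2)]])
    moreover have "(\<lambda>\<gamma>. (snd c \<circ> traj_of) (aff_act a b \<gamma>)) = snd c \<circ> traj_of"
      by (rule ext) (simp add: traj_of_aff_act[OF a])
    ultimately have "(snd c \<circ> traj_of has_derivative
        (\<lambda>\<delta>. frechet_derivative (snd c \<circ> traj_of) (at (aff_act a b \<gamma>)) (aff_act a b \<delta>))) (at \<gamma>)"
      by (simp only:)
    from fun_cong[OF frechet_derivative_at[OF this], of \<delta>] show ?thesis
      using True by (simp add: push_tangent_def traj_of_aff_act[OF a])
  qed (simp add: push_tangent_def traj_of_aff_act[OF a])
qed

text \<open>Translating a section by a fixed group element moves it to any prescribed point of a fibre.\<close>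

lemma local_section_through:
  assumes c: "c \<in> traj_atlas" and \<gamma>: "\<gamma> \<in> G_curv" "traj_of \<gamma> \<in> fst c"
  obtains s where "local_section G_curv traj_of c s" "s (snd c (traj_of \<gamma>)) = \<gamma>"
proof -
  obtain s where s: "local_section G_curv traj_of c s"
    using quotient_atlasD(6) c unfolding traj_atlas_def by blast
  obtain a b where ab: "0 < a" "\<gamma> = aff_act a b (s (snd c (traj_of \<gamma>)))"
    using traj_of_eqE[of "s (snd c (traj_of \<gamma>))" \<gamma>] local_sectionD(3)[OF s \<gamma>(2)] by metis
  have "local_section G_curv traj_of c (\<lambda>x. aff_act a b (s x))"
    unfolding local_section_def
  proof (intro conjI ballI)
    show "smooth_on (snd c ` fst c) (\<lambda>x. aff_act a b (s x))"
      using c unfolding traj_atlas_def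
      by (intro smooth_on_linear_compose[OF linear_aff_act quotient_atlasD(4) local_sectionD(1)[OF s]])
  qed (simp_all add: traj_of_aff_act[OF ab(1)] aff_act_in_G_curv[OF ab(1)] local_sectionD(2,3)[OF s])
  with ab(2) show ?thesis
    using that by metis
qed

lemma D_traj_linear: "\<gamma> \<in> G_curv \<Longrightarrow> linear (D_traj \<gamma>)"
  unfolding traj_atlas_def by (rule linear_push_tangent)

lemma D_traj_in_Tan: "\<gamma> \<in> G_curv \<Longrightarrow> D_traj \<gamma> \<delta> \<in> Tan (traj_of \<gamma>)"
  unfolding traj_atlas_def by (rule push_tangent_in_tangent_space)

text \<open>For small \<open>t\<close> the line \<open>\<gamma> + t (x V, y V)\<close> stays in the orbit of \<open>\<gamma>\<close>.\<close>

lemma D_traj_vertical: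
  assumes "\<gamma> \<in> G_curv"
  shows "D_traj \<gamma> (x *\<^sub>R snd \<gamma>, y *\<^sub>R snd \<gamma>) = 0"
proof (rule ext)
  fix c :: "(phase set, model) chart"
  let ?\<xi> = "(x *\<^sub>R snd \<gamma>, y *\<^sub>R snd \<gamma>)"
  show "D_traj \<gamma> ?\<xi> c = 0 c"
  proof (cases "c \<in> charts_at traj_atlas (traj_of \<gamma>)")
    case True
    then have c: "c \<in> quotient_atlas G_curv traj_of" "traj_of \<gamma> \<in> fst c"
      by (simp_all add: charts_at_def traj_atlas_def)
    let ?D = "frechet_derivative (snd c \<circ> traj_of) (at \<gamma>)"
    have k: "((\<lambda>t::real. \<gamma> + t *\<^sub>R ?\<xi>) has_derivative (\<lambda>t. t *\<^sub>R ?\<xi>)) (at 0)"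
      by (auto intro!: derivative_eq_intros)
    have D: "(snd c \<circ> traj_of has_derivative ?D) (at (\<gamma> + 0 *\<^sub>R ?\<xi>))"
      using coordinate_map_has_derivative[OF c(1) assms c(2)] by (simp add: zero_prod_def[symmetric])
    have 1: "((\<lambda>t. (snd c \<circ> traj_of) (\<gamma> + t *\<^sub>R ?\<xi>)) has_derivative (\<lambda>t. ?D (t *\<^sub>R ?\<xi>))) (at 0)"
      by (rule has_derivative_compose[OF k D])
    have "((\<lambda>t::real. (snd c \<circ> traj_of) \<gamma>) has_derivative (\<lambda>t. ?D (t *\<^sub>R ?\<xi>))) (at 0)"
    proof (rule has_derivative_transform_within_open[OF 1])
      show "open {t::real. 0 < 1 + t * y}"
        by (intro open_Collect_less continuous_intros)
      fix t :: real assume "t \<in> {t. 0 < 1 + t * y}"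
      moreover have "\<gamma> + t *\<^sub>R ?\<xi> = aff_act (1 + t * y) (t * x) \<gamma>"
        by (cases \<gamma>) (simp add: aff_act_def algebra_simps)
      ultimately show "(snd c \<circ> traj_of) (\<gamma> + t *\<^sub>R ?\<xi>) = (snd c \<circ> traj_of) \<gamma>"
        using traj_of_aff_act[of "1 + t * y" "t * x" \<gamma>] by simp
    qed simp
    then have "(\<lambda>t. ?D (t *\<^sub>R ?\<xi>)) = (\<lambda>t::real. 0)"
      using has_derivative_unique has_derivative_const by blast
    from fun_cong[OF this, of 1] show ?thesis
      using True by (simp add: push_tangent_def)
  qed (simp add: push_tangent_def)
qed

subsection \<open>Charts from null frames\<close>

text \<open>With \<open>u = g(n, z)\<close> and \<open>v = g(l, z)\<close> the metric reads \<open>2 u v + g(e, z)\<^sup>2 + g(f, z)\<^sup>2\<close>. It is linear in \<open>v\<close>,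
  so on the hyperplane \<open>u = 1\<close> the value \<open>g(z, z)\<close> can replace \<open>v\<close> as a coordinate by a polynomial change.\<close>

definition null_frame :: "real^4 \<Rightarrow> real^4 \<Rightarrow> real^4 \<Rightarrow> real^4 \<Rightarrow> bool" where
  "null_frame n l e f \<longleftrightarrow>
     mink n n = 0 \<and> mink l l = 0 \<and> mink n l = 1 \<and> mink e e = 1 \<and> mink f f = 1 \<and> mink e f = 0 \<and>
     mink n e = 0 \<and> mink n f = 0 \<and> mink l e = 0 \<and> mink l f = 0 \<and>
     (\<forall>z. z = mink l z *\<^sub>R n + mink n z *\<^sub>R l + mink e z *\<^sub>R e + mink f z *\<^sub>R f)"

lemma null_frame_rules:
  assumes "null_frame n l e f"
  shows "mink n n = 0" "mink l l = 0" "mink n l = 1" "mink l n = 1" "mink e e = 1" "mink f f = 1"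
    "mink e f = 0" "mink f e = 0" "mink n e = 0" "mink e n = 0" "mink n f = 0" "mink f n = 0"
    "mink l e = 0" "mink e l = 0" "mink l f = 0" "mink f l = 0"
  using assms unfolding null_frame_def by (simp_all add: mink_sym)

lemma null_frame_expand:
  assumes "null_frame n l e f"
  shows "z = mink l z *\<^sub>R n + mink n z *\<^sub>R l + mink e z *\<^sub>R e + mink f z *\<^sub>R f"
  using assms unfolding null_frame_def by blast

lemma null_frame_mink:
  assumes "null_frame n l e f"
  shows "mink z z = 2 * mink n z * mink l z + (mink e z)\<^sup>2 + (mink f z)\<^sup>2"
proof -
  have "mink z z = mink z (mink l z *\<^sub>R n + mink n z *\<^sub>R l + mink e z *\<^sub>R e + mink f z *\<^sub>R f)"
    using null_frame_expand[OF assms, of z] by (rule arg_cong)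
  then show ?thesis
    by (simp add: mink_sym[of z n] mink_sym[of z l] mink_sym[of z e] mink_sym[of z f] power2_eq_square)
qed

text \<open>One of the six null vectors \<open>e\<^sub>i \<plusminus> e\<^sub>4\<close> has a nonzero product with \<open>V\<close>: otherwise \<open>V\<^sub>i = V\<^sub>4 = - V\<^sub>4\<close>
  for all \<open>i\<close>. Its sign is then corrected by \<open>\<sigma>\<close>.\<close>

lemma null_frame_exists:
  assumes "V \<noteq> 0"
  obtains n l e f where "null_frame n l e f" "0 < mink n V"
proof -
  have frame: "\<exists>n l e f. null_frame n l e f \<and> mink n V = \<sigma> * (V $ i - \<epsilon> * V $ 4)"
    if ijk: "(i, j, k) = (1, 2, 3) \<or> (i, j, k) = (2, 3, 1) \<or> (i, j, k) = (3, 1, 2)"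
      and \<sigma>: "\<sigma> * \<sigma> = 1" and \<epsilon>: "\<epsilon> * \<epsilon> = 1"
    for i j k :: 4 and \<sigma> \<epsilon> :: real
  proof (intro exI conjI)
    let ?n = "\<sigma> *\<^sub>R (axis i 1 + \<epsilon> *\<^sub>R axis 4 1) :: real^4"
    let ?l = "(\<sigma> / 2) *\<^sub>R (axis i 1 - \<epsilon> *\<^sub>R axis 4 1) :: real^4"
    have sq: "\<sigma> * (\<sigma> * r) = r" "\<epsilon> * (\<epsilon> * r) = r" for r
      using \<sigma> \<epsilon> by (simp_all add: mult.assoc[symmetric])
    show "null_frame ?n ?l (axis j 1) (axis k 1)"
      using ijk unfolding null_frame_def vec_eq_iff forall_4
      by (elim disjE) (simp_all add: mink_def axis_def algebra_simps \<sigma> \<epsilon> sq)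
    show "mink ?n V = \<sigma> * (V $ i - \<epsilon> * V $ 4)"
      using ijk by (elim disjE) (simp_all add: mink_def axis_def algebra_simps)
  qed
  have "\<exists>i\<in>{1, 2, 3}. \<exists>\<epsilon>\<in>{1, -1}. V $ i - \<epsilon> * V $ 4 \<noteq> 0"
  proof (rule ccontr)
    assume "\<not> ?thesis"
    then have "V $ 1 = 0" "V $ 2 = 0" "V $ 3 = 0" "V $ 4 = 0"
      by auto
    then have "V = 0"
      by (simp add: vec_eq_iff forall_4)
    with assms show False by simp
  qed
  then obtain i \<epsilon> where i: "i \<in> {1, 2, 3}" and \<epsilon>: "\<epsilon> \<in> {1, -1}" and ne: "V $ i - \<epsilon> * V $ 4 \<noteq> 0"
    by blast
  define \<sigma> where "\<sigma> = sgn (V $ i - \<epsilon> * V $ 4)"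
  have "\<sigma> * \<sigma> = 1" "0 < \<sigma> * (V $ i - \<epsilon> * V $ 4)"
    using ne by (auto simp: \<sigma>_def sgn_real_def)
  moreover have "\<epsilon> * \<epsilon> = 1"
    using \<epsilon> by auto
  ultimately show ?thesis
    using frame[of i _ _ \<sigma> \<epsilon>] i that by (metis empty_iff insert_iff)
qed

text \<open>The representative \<open>(X, V)\<close> of a trajectory with \<open>g(n, V) = 1\<close> and \<open>g(n, X) = 0\<close>.\<close>

definition gauge :: "real^4 \<Rightarrow> phase \<Rightarrow> phase" where
  "gauge n \<gamma> = aff_act (1 / mink n (snd \<gamma>)) (- mink n (fst \<gamma>) / mink n (snd \<gamma>)) \<gamma>"

lemma gauge_sel:
  "fst (gauge n \<gamma>) = fst \<gamma> - (mink n (fst \<gamma>) / mink n (snd \<gamma>)) *\<^sub>R snd \<gamma>"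
  "snd (gauge n \<gamma>) = (1 / mink n (snd \<gamma>)) *\<^sub>R snd \<gamma>"
  by (simp_all add: gauge_def)

lemma gauge_aff_act:
  assumes "0 < a" "mink n (snd \<gamma>) \<noteq> 0"
  shows "gauge n (aff_act a b \<gamma>) = gauge n \<gamma>"
  using assms by (simp add: gauge_def aff_act_compose field_simps)

lemma traj_of_gauge: "0 < mink n (snd \<gamma>) \<Longrightarrow> traj_of (gauge n \<gamma>) = traj_of \<gamma>"
  by (simp add: gauge_def traj_of_aff_act)

definition vec5 :: "real \<Rightarrow> real \<Rightarrow> real \<Rightarrow> real \<Rightarrow> real \<Rightarrow> real^5" where
  "vec5 a b c p q = a *\<^sub>R axis 1 1 + b *\<^sub>R axis 2 1 + c *\<^sub>R axis 3 1 + p *\<^sub>R axis 4 1 + q *\<^sub>R axis 5 1"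

lemma exhaust_5: "(i::5) = 1 \<or> i = 2 \<or> i = 3 \<or> i = 4 \<or> i = 5"
proof (induct i)
  case (of_int z)
  then have "z = 0 \<or> z = 1 \<or> z = 2 \<or> z = 3 \<or> z = 4" by fastforce
  then show ?case by auto
qed

lemma vec5_nth [simp]:
  "vec5 a b c p q $ 1 = a" "vec5 a b c p q $ 2 = b" "vec5 a b c p q $ 3 = c"
  "vec5 a b c p q $ 4 = p" "vec5 a b c p q $ 5 = q"
  by (simp_all add: vec5_def axis_def)

lemma vec5_eta [simp]: "vec5 (z $ 1) (z $ 2) (z $ 3) (z $ 4) (z $ 5) = z"
  unfolding vec_eq_iff
proof
  show "vec5 (z $ 1) (z $ 2) (z $ 3) (z $ 4) (z $ 5) $ i = z $ i" for i
    using exhaust_5[of i] by (elim disjE) simp_all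
qed

text \<open>The last coordinate is \<open>g(V, V)\<close> for the normalized direction, so that null trajectories form a slice.
  The chart with these coordinates is onto \<open>\<real>\<^sup>6\<close>, with inverse induced by \<open>frame_section\<close>.\<close>

definition frame_coords :: "real^4 \<Rightarrow> real^4 \<Rightarrow> real^4 \<Rightarrow> real^4 \<Rightarrow> phase \<Rightarrow> model" where
  "frame_coords n l e f \<gamma> = (let (X, V) = gauge n \<gamma> in
     (vec5 (mink e X) (mink f X) (mink l X) (mink e V) (mink f V), mink V V))"

definition frame_section :: "real^4 \<Rightarrow> real^4 \<Rightarrow> real^4 \<Rightarrow> real^4 \<Rightarrow> model \<Rightarrow> phase" where
  "frame_section n l e f = (\<lambda>(z, w). (z $ 1 *\<^sub>R e + z $ 2 *\<^sub>R f + z $ 3 *\<^sub>R n,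
     l + z $ 4 *\<^sub>R e + z $ 5 *\<^sub>R f + ((w - z $ 4 * z $ 4 - z $ 5 * z $ 5) / 2) *\<^sub>R n))"

definition frame_chart :: "real^4 \<Rightarrow> real^4 \<Rightarrow> real^4 \<Rightarrow> real^4 \<Rightarrow> (phase set, model) chart" where
  "frame_chart n l e f =
     (traj_of ` {\<gamma>. 0 < mink n (snd \<gamma>)}, \<lambda>\<tau>. frame_coords n l e f (SOME \<gamma>. \<gamma> \<in> \<tau>))"

lemma frame_section_gauge:
  assumes "null_frame n l e f"
  shows "mink n (fst (frame_section n l e f z)) = 0" "mink n (snd (frame_section n l e f z)) = 1"
  by (simp_all add: frame_section_def case_prod_beta null_frame_rules[OF assms])

lemma frame_coords_section:
  assumes "null_frame n l e f"
  shows "frame_coords n l e f (frame_section n l e f z) = z"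
proof -
  have "gauge n (frame_section n l e f z) = frame_section n l e f z"
    by (simp add: gauge_def frame_section_gauge[OF assms])
  then show ?thesis
    by (cases z) (simp add: frame_coords_def frame_section_def null_frame_rules[OF assms])
qed

lemma frame_section_coords:
  assumes fr: "null_frame n l e f" and \<gamma>: "0 < mink n (snd \<gamma>)"
  shows "frame_section n l e f (frame_coords n l e f \<gamma>) = gauge n \<gamma>"
proof -
  obtain X V where XV: "gauge n \<gamma> = (X, V)"
    by fastforce
  have "X = fst \<gamma> - (mink n (fst \<gamma>) / mink n (snd \<gamma>)) *\<^sub>R snd \<gamma>" "V = (1 / mink n (snd \<gamma>)) *\<^sub>R snd \<gamma>"
    using XV gauge_sel[of n \<gamma>] by simp_all
  then have n: "mink n X = 0" "mink n V = 1"
    using \<gamma> by simp_all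
  have "X = mink l X *\<^sub>R n + mink e X *\<^sub>R e + mink f X *\<^sub>R f"
    using null_frame_expand[OF fr, of X] n by simp
  moreover have "V = mink l V *\<^sub>R n + l + mink e V *\<^sub>R e + mink f V *\<^sub>R f"
    using null_frame_expand[OF fr, of V] n by simp
  moreover have "(mink V V - mink e V * mink e V - mink f V * mink f V) / 2 = mink l V"
    using null_frame_mink[OF fr, of V] n by (simp add: power2_eq_square)
  ultimately show ?thesis
    by (simp add: frame_coords_def frame_section_def XV add_ac)
qed

lemma frame_chart_traj_of:
  assumes "0 < mink n (snd \<gamma>)"
  shows "snd (frame_chart n l e f) (traj_of \<gamma>) = frame_coords n l e f \<gamma>"
proof -
  have "(SOME \<gamma>'. \<gamma>' \<in> traj_of \<gamma>) \<in> traj_of \<gamma>"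
    by (rule someI[of "\<lambda>\<gamma>'. \<gamma>' \<in> traj_of \<gamma>", OF mem_traj_of])
  then obtain a b where "0 < a" "(SOME \<gamma>'. \<gamma>' \<in> traj_of \<gamma>) = aff_act a b \<gamma>"
    unfolding traj_of_def by blast
  then show ?thesis
    using gauge_aff_act[of a n \<gamma> b] assms by (simp add: frame_chart_def frame_coords_def)
qed

lemma traj_of_in_frame_chart: "traj_of \<gamma> \<in> fst (frame_chart n l e f) \<longleftrightarrow> 0 < mink n (snd \<gamma>)"
proof
  assume "traj_of \<gamma> \<in> fst (frame_chart n l e f)"
  then obtain \<gamma>' where \<gamma>': "traj_of \<gamma>' = traj_of \<gamma>" "0 < mink n (snd \<gamma>')"
    by (auto simp: frame_chart_def)
  then obtain a b where "0 < a" "\<gamma> = aff_act a b \<gamma>'"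
    using traj_of_eqE by blast
  with \<gamma>' show "0 < mink n (snd \<gamma>)" by simp
qed (simp add: frame_chart_def)

lemma smooth_on_vec5:
  assumes "open S" "smooth_on S a" "smooth_on S b" "smooth_on S c" "smooth_on S p" "smooth_on S q"
  shows "smooth_on S (\<lambda>x. vec5 (a x) (b x) (c x) (p x) (q x))"
  unfolding vec5_def
  by (intro smooth_on_add smooth_on_scaleR smooth_on_const assms)

lemma smooth_on_frame_coords: "smooth_on {\<gamma>. 0 < mink n (snd \<gamma>)} (frame_coords n l e f)"
proof -
  let ?S = "{\<gamma>::phase. 0 < mink n (snd \<gamma>)}"
  have S: "open ?S"
    unfolding mink_def by (intro open_Collect_less continuous_intros)
  have lin: "smooth_on ?S (\<lambda>\<gamma>. mink u (fst \<gamma>))" "smooth_on ?S (\<lambda>\<gamma>. mink u (snd \<gamma>))" for u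
    by (auto intro!: smooth_on_linear linearI)
  have X: "smooth_on ?S (\<lambda>\<gamma>. mink u (fst (gauge n \<gamma>)))" for u
    unfolding gauge_sel mink_linear_simps
    by (rule smooth_on_diff[OF S lin(1) smooth_on_mult[OF S smooth_on_divide[OF S lin] lin(2)]]) simp
  have V: "smooth_on ?S (\<lambda>\<gamma>. mink u (snd (gauge n \<gamma>)))" for u
    unfolding gauge_sel mink_linear_simps
    by (rule smooth_on_mult[OF S smooth_on_divide[OF S smooth_on_const lin(2)] lin(2)]) simp
  have "smooth_on ?S (\<lambda>\<gamma>. snd (gauge n \<gamma>))"
    unfolding gauge_sel
    by (rule smooth_on_scaleR[OF S smooth_on_divide[OF S smooth_on_const lin(2)]])
       (auto intro!: smooth_on_linear linearI)
  then have VV: "smooth_on ?S (\<lambda>\<gamma>. mink (snd (gauge n \<gamma>)) (snd (gauge n \<gamma>)))"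
    by (intro smooth_on_bounded_bilinear[OF bounded_bilinear_mink S])
  show ?thesis
    unfolding frame_coords_def case_prod_beta Let_def
    by (rule smooth_on_Pair[OF S smooth_on_vec5[OF S X X X V V] VV])
qed

lemma smooth_on_frame_section: "smooth_on UNIV (frame_section n l e f)"
proof -
  have z: "smooth_on UNIV (\<lambda>x::model. fst x $ i)" "smooth_on UNIV (\<lambda>x::model. snd x)" for i
    by (auto intro!: smooth_on_linear linearI)
  have w: "smooth_on UNIV (\<lambda>x::model. (snd x - fst x $ 4 * fst x $ 4 - fst x $ 5 * fst x $ 5) / 2)"
    by (rule smooth_on_divide[OF open_UNIV smooth_on_diff[OF open_UNIV smooth_on_diff[OF open_UNIV z(2)
          smooth_on_mult[OF open_UNIV z(1) z(1)]] smooth_on_mult[OF open_UNIV z(1) z(1)]] smooth_on_const]) simp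
  show ?thesis
    unfolding frame_section_def case_prod_beta
    by (intro smooth_on_Pair smooth_on_add smooth_on_scaleR smooth_on_const z w open_UNIV)
qed

lemma frame_chart_image:
  assumes fr: "null_frame n l e f"
  shows "snd (frame_chart n l e f) ` fst (frame_chart n l e f) = UNIV"
proof -
  have "z \<in> snd (frame_chart n l e f) ` fst (frame_chart n l e f)" for z
  proof
    have pos: "0 < mink n (snd (frame_section n l e f z))"
      by (simp add: frame_section_gauge[OF fr])
    show "traj_of (frame_section n l e f z) \<in> fst (frame_chart n l e f)"
      using pos by (simp add: traj_of_in_frame_chart)
    show "z = snd (frame_chart n l e f) (traj_of (frame_section n l e f z))"
      using frame_coords_section[OF fr] by (simp add: frame_chart_traj_of[OF pos])
  qed
  then show ?thesis by blast
qed

lemma local_section_frame: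
  assumes fr: "null_frame n l e f"
  shows "local_section G_curv traj_of (frame_chart n l e f) (frame_section n l e f)"
  unfolding local_section_def
proof (intro conjI ballI)
  show "smooth_on (snd (frame_chart n l e f) ` fst (frame_chart n l e f)) (frame_section n l e f)"
    using smooth_on_frame_section by (simp add: frame_chart_image[OF fr])
  fix q assume "q \<in> fst (frame_chart n l e f)"
  then obtain \<gamma> where \<gamma>: "q = traj_of \<gamma>" "0 < mink n (snd \<gamma>)"
    by (auto simp: frame_chart_def)
  have s: "frame_section n l e f (snd (frame_chart n l e f) q) = gauge n \<gamma>"
    unfolding \<gamma>(1) frame_chart_traj_of[OF \<gamma>(2)] frame_section_coords[OF fr \<gamma>(2)] ..
  show "traj_of (frame_section n l e f (snd (frame_chart n l e f) q)) = q"
    unfolding s traj_of_gauge[OF \<gamma>(2)] by (rule \<gamma>(1)[symmetric])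
  show "frame_section n l e f (snd (frame_chart n l e f) q) \<in> G_curv"
    unfolding s using \<gamma>(2) by (auto simp: snd_G_curv gauge_sel)
qed

lemma frame_chart_in_traj_atlas:
  assumes fr: "null_frame n l e f"
  shows "frame_chart n l e f \<in> traj_atlas"
proof -
  let ?c = "frame_chart n l e f"
  have pre: "G_curv \<inter> traj_of -` fst ?c = {\<gamma>. 0 < mink n (snd \<gamma>)}"
    by (auto simp: traj_of_in_frame_chart snd_G_curv)
  have op: "open {\<gamma>::phase. 0 < mink n (snd \<gamma>)}"
    unfolding mink_def by (intro open_Collect_less continuous_intros)
  have inj: "inj_on (snd ?c) (fst ?c)"
    using local_sectionD(3)[OF local_section_frame[OF fr]] by (rule inj_on_inverseI)
  have sm: "smooth_on {\<gamma>. 0 < mink n (snd \<gamma>)} (snd ?c \<circ> traj_of)"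
    by (rule smooth_on_cong_open[OF op smooth_on_frame_coords]) (simp add: frame_chart_traj_of)
  have sub: "fst ?c \<subseteq> traj_of ` G_curv"
    unfolding frame_chart_def fst_conv by (rule image_mono) (auto simp: snd_G_curv)
  have "(fst ?c, snd ?c) \<in> quotient_atlas G_curv traj_of"
    unfolding quotient_atlas_def mem_Collect_eq prod.case pre
    using sub op inj sm frame_chart_image[OF fr] local_section_frame[OF fr, unfolded local_section_def]
    by auto
  then show ?thesis
    by (simp add: traj_atlas_def)
qed

text \<open>A vector killed by the coordinate map is killed by the derivative of \<open>gauge n\<close>, which factors through the
  chart. Since \<open>gauge n \<gamma>\<close> is \<open>(X + b V, a V)\<close> with \<open>a\<close>, \<open>b\<close> depending on \<open>\<gamma>\<close>, this makes first \<open>\<delta>V\<close> and then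
  \<open>\<delta>X\<close> a multiple of \<open>V\<close>.\<close>

lemma D_traj_kernel:
  assumes \<gamma>: "\<gamma> \<in> G_curv" and 0: "D_traj \<gamma> \<delta> = 0"
  obtains x y where "\<delta> = (x *\<^sub>R snd \<gamma>, y *\<^sub>R snd \<gamma>)"
proof -
  obtain n l e f where fr: "null_frame n l e f" and pos: "0 < mink n (snd \<gamma>)"
    using null_frame_exists \<gamma> snd_G_curv by blast
  let ?c = "frame_chart n l e f" and ?s = "frame_section n l e f"
  have c: "?c \<in> quotient_atlas G_curv traj_of" "traj_of \<gamma> \<in> fst ?c"
    using frame_chart_in_traj_atlas[OF fr] pos by (simp_all add: traj_atlas_def traj_of_in_frame_chart)
  let ?x = "snd ?c (traj_of \<gamma>)"
  have "frechet_derivative (snd ?c \<circ> traj_of) (at \<gamma>) \<delta> = D_traj \<gamma> \<delta> ?c"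
    using c by (simp add: push_tangent_def charts_at_def traj_atlas_def)
  then have 0: "frechet_derivative (snd ?c \<circ> traj_of) (at \<gamma>) \<delta> = 0"
    using 0 by simp
  have s: "(?s has_derivative frechet_derivative ?s (at ?x)) (at ((snd ?c \<circ> traj_of) \<gamma>))"
    using local_section_has_derivative[OF c(1) local_section_frame[OF fr] c(2)] by simp
  have 1: "((\<lambda>\<gamma>. ?s ((snd ?c \<circ> traj_of) \<gamma>)) has_derivative
      (\<lambda>\<delta>. frechet_derivative ?s (at ?x) (frechet_derivative (snd ?c \<circ> traj_of) (at \<gamma>) \<delta>))) (at \<gamma>)"
    by (rule has_derivative_compose[OF coordinate_map_has_derivative[OF c(1) \<gamma> c(2)] s])
  have op: "open {\<gamma>::phase. 0 < mink n (snd \<gamma>)}"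
    unfolding mink_def by (intro open_Collect_less continuous_intros)
  have 2: "(gauge n has_derivative
      (\<lambda>\<delta>. frechet_derivative ?s (at ?x) (frechet_derivative (snd ?c \<circ> traj_of) (at \<gamma>) \<delta>))) (at \<gamma>)"
    by (rule has_derivative_transform_within_open[OF 1 op])
      (use pos in \<open>simp_all add: frame_chart_traj_of frame_section_coords[OF fr]\<close>)
  have m: "((\<lambda>\<gamma>. mink n (fst \<gamma>)) has_derivative (\<lambda>\<delta>. mink n (fst \<delta>))) (at \<gamma>)"
      "((\<lambda>\<gamma>. mink n (snd \<gamma>)) has_derivative (\<lambda>\<delta>. mink n (snd \<delta>))) (at \<gamma>)"
    by (auto intro!: linear_imp_has_derivative linearI)
  have 3: "(gauge n has_derivative (\<lambda>\<delta>.
      (fst \<delta> - ((mink n (fst \<gamma>) / mink n (snd \<gamma>)) *\<^sub>R snd \<delta> +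
        ((mink n (fst \<delta>) * mink n (snd \<gamma>) - mink n (fst \<gamma>) * mink n (snd \<delta>)) / (mink n (snd \<gamma>) * mink n (snd \<gamma>))) *\<^sub>R snd \<gamma>),
       (1 / mink n (snd \<gamma>)) *\<^sub>R snd \<delta> +
        ((0 * mink n (snd \<gamma>) - 1 * mink n (snd \<delta>)) / (mink n (snd \<gamma>) * mink n (snd \<gamma>))) *\<^sub>R snd \<gamma>))) (at \<gamma>)"
    (is "(_ has_derivative ?D) _")
  proof -
    have "gauge n = (\<lambda>\<gamma>. (fst \<gamma> - (mink n (fst \<gamma>) / mink n (snd \<gamma>)) *\<^sub>R snd \<gamma>, (1 / mink n (snd \<gamma>)) *\<^sub>R snd \<gamma>))"
      by (rule ext) (metis gauge_sel prod.collapse)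
    then show ?thesis
      using pos
      by (simp only:) (intro has_derivative_Pair has_derivative_diff has_derivative_scaleR has_derivative_divide' m
          has_derivative_fst has_derivative_snd has_derivative_ident has_derivative_const; simp)
  qed
  have "frechet_derivative ?s (at ?x) 0 = 0"
    using linear_0[OF has_derivative_linear[OF s]] .
  then have "?D \<delta> = 0"
    using fun_cong[OF has_derivative_unique[OF 2 3], of \<delta>] 0 by simp
  then have D: "fst \<delta> = (mink n (fst \<gamma>) / mink n (snd \<gamma>)) *\<^sub>R snd \<delta> +
        ((mink n (fst \<delta>) * mink n (snd \<gamma>) - mink n (fst \<gamma>) * mink n (snd \<delta>)) / (mink n (snd \<gamma>) * mink n (snd \<gamma>))) *\<^sub>R snd \<gamma>"
      "(1 / mink n (snd \<gamma>)) *\<^sub>R snd \<delta> = (mink n (snd \<delta>) / (mink n (snd \<gamma>) * mink n (snd \<gamma>))) *\<^sub>R snd \<gamma>"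
    by (simp_all add: zero_prod_def)
  define y where "y = mink n (snd \<delta>) / mink n (snd \<gamma>)"
  have "snd \<delta> = mink n (snd \<gamma>) *\<^sub>R ((1 / mink n (snd \<gamma>)) *\<^sub>R snd \<delta>)"
    using pos by simp
  also have "\<dots> = y *\<^sub>R snd \<gamma>"
    unfolding D(2) using pos by (simp add: y_def)
  finally have y: "snd \<delta> = y *\<^sub>R snd \<gamma>" .
  obtain k m where "fst \<delta> = k *\<^sub>R snd \<delta> + m *\<^sub>R snd \<gamma>"
    using D(1) by blast
  then have "fst \<delta> = (k * y + m) *\<^sub>R snd \<gamma>"
    by (simp add: y scaleR_add_left)
  with y show ?thesis
    using that by (metis prod.collapse)
qed

section \<open>The image of the conformal co-symplectic structure\<close>

lemma mink_nondegenerate: "(\<And>y. mink x y = 0) \<Longrightarrow> x = 0"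
proof -
  assume 0: "\<And>y. mink x y = 0"
  have "x $ i = 0" for i
    using 0[of "axis i 1"] exhaust_4[of i] by (auto simp: mink_def axis_def)
  then show "x = 0"
    by (simp add: vec_eq_iff)
qed

lemma omega_simps [simp]:
  "omega \<gamma> (\<delta> + \<delta>') \<eta> = omega \<gamma> \<delta> \<eta> + omega \<gamma> \<delta>' \<eta>" "omega \<gamma> \<delta> (\<eta> + \<eta>') = omega \<gamma> \<delta> \<eta> + omega \<gamma> \<delta> \<eta>'"
  "omega \<gamma> (\<delta> - \<delta>') \<eta> = omega \<gamma> \<delta> \<eta> - omega \<gamma> \<delta>' \<eta>" "omega \<gamma> \<delta> (\<eta> - \<eta>') = omega \<gamma> \<delta> \<eta> - omega \<gamma> \<delta> \<eta>'"
  "omega \<gamma> (r *\<^sub>R \<delta>) \<eta> = r * omega \<gamma> \<delta> \<eta>" "omega \<gamma> \<delta> (r *\<^sub>R \<eta>) = r * omega \<gamma> \<delta> \<eta>"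
  by (simp_all add: omega_def algebra_simps)

lemma omega_antisym: "omega \<gamma> \<delta> \<eta> = - omega \<gamma> \<eta> \<delta>"
  by (simp add: omega_def)

lemma inj_omega: "inj (omega \<gamma>)"
proof (rule injI)
  fix \<delta> \<delta>' assume "omega \<gamma> \<delta> = omega \<gamma> \<delta>'"
  then have 0: "omega \<gamma> (\<delta> - \<delta>') \<eta> = 0" for \<eta>
    by simp
  have "mink (snd (\<delta> - \<delta>')) y = 0" for y
    using 0[of "(y, 0)"] by (simp add: omega_def)
  moreover have "mink (fst (\<delta> - \<delta>')) y = 0" for y
    using 0[of "(0, y)"] by (simp add: omega_def mink_sym[of y])
  ultimately have "snd (\<delta> - \<delta>') = 0" "fst (\<delta> - \<delta>') = 0"
    using mink_nondegenerate by blast+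
  then show "\<delta> = \<delta>'"
    by (simp add: prod_eq_iff)
qed

lemma omega_represents:
  assumes "linear L"
  obtains \<delta> where "\<And>\<eta>. omega \<gamma> \<delta> \<eta> = L \<eta>"
proof -
  define flip where "flip x = (\<chi> i. if i = 4 then - x $ 4 else x $ i)" for x :: "real^4"
  have flip: "mink (flip x) y = x \<bullet> y" for x y
    by (simp add: mink_def flip_def inner_vec_def sum_4)
  define g where "g = adjoint L 1"
  have "L \<eta> = \<eta> \<bullet> g" for \<eta>
    using adjoint_works[OF assms, of \<eta> 1] by (simp add: g_def)
  then have L: "L \<eta> = fst \<eta> \<bullet> fst g + snd \<eta> \<bullet> snd g" for \<eta>
    by (simp add: inner_prod_def)
  have "omega \<gamma> (- flip (snd g), flip (fst g)) \<eta> = L \<eta>" for \<eta>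
    using flip[of "fst g" "fst \<eta>"] flip[of "snd g" "snd \<eta>"] L[of \<eta>]
    by (simp add: omega_def mink_sym[of "snd \<eta>"] inner_commute)
  then show ?thesis
    by (rule that)
qed

lemma omega_aff_act: "omega \<gamma>' (aff_act a b \<delta>) (aff_act a b \<eta>) = a * omega \<gamma> \<delta> \<eta>"
  by (simp add: omega_def algebra_simps mink_sym[of "snd \<eta>" "snd \<delta>"])

lemma omega_vertical: "omega \<gamma>' \<delta> (x *\<^sub>R snd \<gamma>, y *\<^sub>R snd \<gamma>) = x * mink (snd \<gamma>) (snd \<delta>) - y * mink (snd \<gamma>) (fst \<delta>)"
  by (simp add: omega_def mink_sym[of _ "snd \<gamma>"])

text \<open>The symplectic complement of the vertical space, by \<open>omega_vertical\<close>.\<close>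

definition vertical_orthogonal :: "phase \<Rightarrow> phase set" where
  "vertical_orthogonal \<gamma> = {\<delta>. mink (snd \<gamma>) (snd \<delta>) = 0 \<and> mink (snd \<gamma>) (fst \<delta>) = 0}"

lemma traj_chart_exists:
  assumes "\<gamma> \<in> G_curv"
  obtains c where "c \<in> traj_atlas" "traj_of \<gamma> \<in> fst c"
proof -
  obtain n l e f where "null_frame n l e f" "0 < mink n (snd \<gamma>)"
    using null_frame_exists assms snd_G_curv by blast
  then show ?thesis
    using that frame_chart_in_traj_atlas traj_of_in_frame_chart by blast
qed

lemma tangent_lift:
  assumes \<gamma>: "\<gamma> \<in> G_curv" and v: "v \<in> Tan (traj_of \<gamma>)"
  obtains \<delta> where "D_traj \<gamma> \<delta> = v"
proof -
  obtain c where c: "c \<in> traj_atlas" "traj_of \<gamma> \<in> fst c"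
    using traj_chart_exists[OF \<gamma>] .
  obtain s where s: "local_section G_curv traj_of c s" "s (snd c (traj_of \<gamma>)) = \<gamma>"
    using local_section_through[OF c(1) \<gamma> c(2)] .
  show ?thesis
    using that tangent_eq_push_tangent[OF c(1)[unfolded traj_atlas_def] s(1) c(2) v[unfolded traj_atlas_def]] s(2)
    unfolding traj_atlas_def by metis
qed

lemma D_traj_eq_imp:
  assumes \<gamma>: "\<gamma> \<in> G_curv" and "D_traj \<gamma> \<eta> = D_traj \<gamma> \<eta>'"
  obtains x y where "\<eta>' = \<eta> + (x *\<^sub>R snd \<gamma>, y *\<^sub>R snd \<gamma>)"
proof -
  have "D_traj \<gamma> (\<eta>' - \<eta>) = 0"
    using assms by (simp add: linear_diff[OF D_traj_linear[OF \<gamma>]])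
  then obtain x y where "\<eta>' - \<eta> = (x *\<^sub>R snd \<gamma>, y *\<^sub>R snd \<gamma>)"
    using D_traj_kernel[OF \<gamma>] by blast
  then show ?thesis
    using that by (metis add.commute diff_add_cancel)
qed

text \<open>Well defined because two lifts of a tangent vector differ by a vertical vector.\<close>

lemma covector_descends:
  assumes \<gamma>: "\<gamma> \<in> G_curv" and L: "linear L" and 0: "\<And>x y. L (x *\<^sub>R snd \<gamma>, y *\<^sub>R snd \<gamma>) = 0"
  obtains \<theta> where "\<theta> \<in> Cotan (traj_of \<gamma>)" "\<And>\<eta>. \<theta> (D_traj \<gamma> \<eta>) = L \<eta>"
proof
  define \<theta> where "\<theta> v = (if v \<in> Tan (traj_of \<gamma>) then L (SOME \<eta>. D_traj \<gamma> \<eta> = v) else 0)" for v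
  show \<theta>: "\<theta> (D_traj \<gamma> \<eta>) = L \<eta>" for \<eta>
  proof -
    define p where "p = (SOME \<eta>'. D_traj \<gamma> \<eta>' = D_traj \<gamma> \<eta>)"
    have "D_traj \<gamma> p = D_traj \<gamma> \<eta>"
      unfolding p_def by (rule someI[where P = "\<lambda>\<eta>'. D_traj \<gamma> \<eta>' = D_traj \<gamma> \<eta>"]) simp
    then obtain x y where "\<eta> = p + (x *\<^sub>R snd \<gamma>, y *\<^sub>R snd \<gamma>)"
      by (rule D_traj_eq_imp[OF \<gamma>])
    from arg_cong[OF this, of L] have "L p = L \<eta>"
      by (simp only: linear_add[OF L] 0 add_0_right)
    then show ?thesis
      using D_traj_in_Tan[OF \<gamma>] by (simp add: \<theta>_def p_def)
  qed
  show "\<theta> \<in> Cotan (traj_of \<gamma>)"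
    unfolding cotangent_space_def mem_Collect_eq linear_form_on_def
  proof (intro conjI ballI allI impI)
    fix u v assume "u \<in> Tan (traj_of \<gamma>)" "v \<in> Tan (traj_of \<gamma>)"
    then obtain \<eta> \<eta>' where "u = D_traj \<gamma> \<eta>" "v = D_traj \<gamma> \<eta>'"
      using tangent_lift[OF \<gamma>] by metis
    then show "\<theta> (u + v) = \<theta> u + \<theta> v"
      by (simp add: linear_add[OF D_traj_linear[OF \<gamma>], symmetric] \<theta> linear_add[OF L])
  next
    fix r u assume "u \<in> Tan (traj_of \<gamma>)"
    then obtain \<eta> where "u = D_traj \<gamma> \<eta>"
      using tangent_lift[OF \<gamma>] by metis
    then show "\<theta> (r *\<^sub>R u) = r * \<theta> u"
      by (simp add: linear_scale[OF D_traj_linear[OF \<gamma>], symmetric] \<theta> linear_scale[OF L])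
  qed (simp add: \<theta>_def)
qed

lemma linear_covector_lift:
  assumes \<gamma>: "\<gamma> \<in> G_curv" and \<theta>: "\<theta> \<in> Cotan (traj_of \<gamma>)"
  shows "linear (\<lambda>\<eta>. \<theta> (D_traj \<gamma> \<eta>))"
  using \<theta> D_traj_in_Tan[OF \<gamma>]
  by (intro linearI)
    (simp_all add: cotangent_space_def linear_form_on_def linear_add[OF D_traj_linear[OF \<gamma>]]
      linear_scale[OF D_traj_linear[OF \<gamma>]])

lemma covector_lift:
  assumes \<gamma>: "\<gamma> \<in> G_curv" and \<theta>: "\<theta> \<in> Cotan (traj_of \<gamma>)"
  obtains \<delta> where "\<delta> \<in> vertical_orthogonal \<gamma>" "\<And>\<eta>. omega \<gamma> \<delta> \<eta> = \<theta> (D_traj \<gamma> \<eta>)"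
proof -
  have lin: "linear (\<lambda>\<eta>. \<theta> (D_traj \<gamma> \<eta>))"
    by (rule linear_covector_lift[OF \<gamma> \<theta>])
  obtain \<delta> where \<delta>: "\<And>\<eta>. omega \<gamma> \<delta> \<eta> = \<theta> (D_traj \<gamma> \<eta>)"
    using omega_represents[OF lin] by blast
  have "\<theta> 0 = 0"
    using linear_0[OF lin] linear_0[OF D_traj_linear[OF \<gamma>]] by simp
  then have "omega \<gamma> \<delta> (x *\<^sub>R snd \<gamma>, y *\<^sub>R snd \<gamma>) = 0" for x y
    by (simp add: \<delta> D_traj_vertical[OF \<gamma>])
  from this[of 1 0] this[of 0 1] have "\<delta> \<in> vertical_orthogonal \<gamma>"
    unfolding omega_vertical vertical_orthogonal_def by simp
  with \<delta> show ?thesis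
    using that by blast
qed

lemma pushed_inverse_eq:
  assumes "\<And>\<eta>. omega \<gamma> \<delta> \<eta> = \<theta> (D_traj \<gamma> \<eta>)"
  shows "pushed_inverse \<gamma> \<theta> = D_traj \<gamma> \<delta>"
proof -
  have "(\<lambda>\<eta>. \<theta> (D_traj \<gamma> \<eta>)) = omega \<gamma> \<delta>"
    by (rule ext) (rule assms[symmetric])
  then show ?thesis
    by (simp add: pushed_inverse_def inv_f_f[OF inj_omega])
qed

text \<open>The action scales \<open>omega\<close> by \<open>a\<close>, hence its inverse by \<open>1 / a\<close>. This is why only the ray of the pushed
  tensor is attached to a trajectory, and why any point of the fibre may be used to compute it.\<close>

lemma pushed_inverse_aff_act:
  assumes \<gamma>: "\<gamma> \<in> G_curv" and a: "0 < a" and \<theta>: "\<theta> \<in> Cotan (traj_of \<gamma>)"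
  shows "pushed_inverse (aff_act a b \<gamma>) \<theta> = (1 / a) *\<^sub>R pushed_inverse \<gamma> \<theta>"
proof -
  obtain \<delta> where \<delta>: "\<And>\<eta>. omega \<gamma> \<delta> \<eta> = \<theta> (D_traj \<gamma> \<eta>)"
    using covector_lift[OF \<gamma> \<theta>] by blast
  have "omega (aff_act a b \<gamma>) (aff_act a b ((1 / a) *\<^sub>R \<delta>)) \<eta>' = \<theta> (D_traj (aff_act a b \<gamma>) \<eta>')" for \<eta>'
  proof -
    define \<eta> where "\<eta> = aff_act (1 / a) (- b / a) \<eta>'"
    have \<eta>': "\<eta>' = aff_act a b \<eta>"
      using a by (simp add: \<eta>_def aff_act_compose)
    show ?thesis
      unfolding \<eta>' D_traj_equivariant[OF a \<gamma>] omega_aff_act[of _ a b _ _ \<gamma>] using a by (simp add: \<delta>)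
  qed
  then have "pushed_inverse (aff_act a b \<gamma>) \<theta> = D_traj (aff_act a b \<gamma>) (aff_act a b ((1 / a) *\<^sub>R \<delta>))"
    by (rule pushed_inverse_eq)
  also have "\<dots> = (1 / a) *\<^sub>R D_traj \<gamma> \<delta>"
    unfolding D_traj_equivariant[OF a \<gamma>] by (rule linear_scale[OF D_traj_linear[OF \<gamma>]])
  finally show ?thesis
    unfolding pushed_inverse_eq[OF \<delta>] .
qed

lemma pushed_inverse_image:
  assumes \<gamma>: "\<gamma> \<in> G_curv"
  shows "pushed_inverse \<gamma> ` Cotan (traj_of \<gamma>) = D_traj \<gamma> ` vertical_orthogonal \<gamma>"
proof
  show "pushed_inverse \<gamma> ` Cotan (traj_of \<gamma>) \<subseteq> D_traj \<gamma> ` vertical_orthogonal \<gamma>"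
  proof
    fix v assume "v \<in> pushed_inverse \<gamma> ` Cotan (traj_of \<gamma>)"
    then obtain \<theta> where \<theta>: "\<theta> \<in> Cotan (traj_of \<gamma>)" "v = pushed_inverse \<gamma> \<theta>"
      by blast
    then show "v \<in> D_traj \<gamma> ` vertical_orthogonal \<gamma>"
      using covector_lift[OF \<gamma> \<theta>(1)] pushed_inverse_eq by (metis image_eqI)
  qed
  show "D_traj \<gamma> ` vertical_orthogonal \<gamma> \<subseteq> pushed_inverse \<gamma> ` Cotan (traj_of \<gamma>)"
  proof
    fix v assume "v \<in> D_traj \<gamma> ` vertical_orthogonal \<gamma>"
    then obtain \<delta> where \<delta>: "\<delta> \<in> vertical_orthogonal \<gamma>" "v = D_traj \<gamma> \<delta>"
      by blast
    have "linear (omega \<gamma> \<delta>)"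
      by (rule linearI) simp_all
    moreover have "omega \<gamma> \<delta> (x *\<^sub>R snd \<gamma>, y *\<^sub>R snd \<gamma>) = 0" for x y
      using \<delta>(1) by (simp add: omega_vertical vertical_orthogonal_def)
    ultimately obtain \<theta> where \<theta>: "\<theta> \<in> Cotan (traj_of \<gamma>)" "\<And>\<eta>. \<theta> (D_traj \<gamma> \<eta>) = omega \<gamma> \<delta> \<eta>"
      using covector_descends[OF \<gamma>] by blast
    then have "pushed_inverse \<gamma> \<theta> = v"
      unfolding \<delta>(2) by (intro pushed_inverse_eq) simp
    with \<theta>(1) show "v \<in> pushed_inverse \<gamma> ` Cotan (traj_of \<gamma>)"
      by blast
  qed
qed

lemma mem_cosympE:
  assumes \<gamma>: "\<gamma> \<in> G_curv" and r: "r \<in> cosymp (traj_of \<gamma>)"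
  obtains k where "0 < k" "\<And>\<theta>. \<theta> \<in> Cotan (traj_of \<gamma>) \<Longrightarrow> r \<theta> = k *\<^sub>R pushed_inverse \<gamma> \<theta>"
proof -
  obtain k \<gamma>' where k: "0 < k" "traj_of \<gamma>' = traj_of \<gamma>"
    and r: "r = restrict (\<lambda>\<theta>. k *\<^sub>R pushed_inverse \<gamma>' \<theta>) (Cotan (traj_of \<gamma>))"
    using r unfolding cosymp_def by blast
  obtain a b where ab: "0 < a" "\<gamma>' = aff_act a b \<gamma>"
    using traj_of_eqE k(2) by metis
  show ?thesis
  proof (rule that)
    show "0 < k / a"
      using k ab by simp
    show "r \<theta> = (k / a) *\<^sub>R pushed_inverse \<gamma> \<theta>" if "\<theta> \<in> Cotan (traj_of \<gamma>)" for \<theta>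
      using that by (simp add: r ab(2) pushed_inverse_aff_act[OF \<gamma> ab(1) that])
  qed
qed

lemma mem_cosympI:
  assumes "\<gamma> \<in> G_curv" "0 < k"
  shows "restrict (\<lambda>\<theta>. k *\<^sub>R pushed_inverse \<gamma> \<theta>) (Cotan (traj_of \<gamma>)) \<in> cosymp (traj_of \<gamma>)"
  using assms unfolding cosymp_def by blast

lemma subspace_vertical_orthogonal: "subspace (vertical_orthogonal \<gamma>)"
  by (rule subspaceI) (simp_all add: vertical_orthogonal_def)

lemma Im_cosymp_traj_of:
  assumes \<gamma>: "\<gamma> \<in> G_curv"
  shows "Im_cosymp (traj_of \<gamma>) = D_traj \<gamma> ` vertical_orthogonal \<gamma>"
proof
  show "Im_cosymp (traj_of \<gamma>) \<subseteq> D_traj \<gamma> ` vertical_orthogonal \<gamma>"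
  proof
    fix v assume "v \<in> Im_cosymp (traj_of \<gamma>)"
    then obtain r \<theta> where r: "r \<in> cosymp (traj_of \<gamma>)" and \<theta>: "\<theta> \<in> Cotan (traj_of \<gamma>)" and v: "v = r \<theta>"
      by (auto simp: Im_cosymp_def)
    obtain k where "0 < k" and k: "\<And>\<theta>. \<theta> \<in> Cotan (traj_of \<gamma>) \<Longrightarrow> r \<theta> = k *\<^sub>R pushed_inverse \<gamma> \<theta>"
      using mem_cosympE[OF \<gamma> r] by metis
    have "pushed_inverse \<gamma> \<theta> \<in> D_traj \<gamma> ` vertical_orthogonal \<gamma>"
      using \<theta> pushed_inverse_image[OF \<gamma>] by blast
    then show "v \<in> D_traj \<gamma> ` vertical_orthogonal \<gamma>"
      unfolding v k[OF \<theta>]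
      by (intro subspace_scale linear_subspace_image D_traj_linear \<gamma> subspace_vertical_orthogonal)
  qed
  show "D_traj \<gamma> ` vertical_orthogonal \<gamma> \<subseteq> Im_cosymp (traj_of \<gamma>)"
  proof
    fix v assume "v \<in> D_traj \<gamma> ` vertical_orthogonal \<gamma>"
    then obtain \<theta> where \<theta>: "\<theta> \<in> Cotan (traj_of \<gamma>)" "v = pushed_inverse \<gamma> \<theta>"
      using pushed_inverse_image[OF \<gamma>] by blast
    then have "v = restrict (\<lambda>\<theta>. 1 *\<^sub>R pushed_inverse \<gamma> \<theta>) (Cotan (traj_of \<gamma>)) \<theta>"
      by simp
    then show "v \<in> Im_cosymp (traj_of \<gamma>)"
      unfolding Im_cosymp_def using mem_cosympI[OF \<gamma> zero_less_one] \<theta>(1) by blast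
  qed
qed

text \<open>When \<open>N \<noteq> 0\<close>, adding multiples of \<open>(V, 0)\<close> and \<open>(0, V)\<close> to a lift makes both \<open>g(V, \<delta>X)\<close> and
  \<open>g(V, \<delta>V)\<close> vanish.\<close>

lemma Im_cosymp_nonnull:
  assumes \<gamma>: "\<gamma> \<in> G_curv" and N: "mink (snd \<gamma>) (snd \<gamma>) \<noteq> 0"
  shows "Im_cosymp (traj_of \<gamma>) = Tan (traj_of \<gamma>)"
proof
  show "Im_cosymp (traj_of \<gamma>) \<subseteq> Tan (traj_of \<gamma>)"
    unfolding Im_cosymp_traj_of[OF \<gamma>] using D_traj_in_Tan[OF \<gamma>] by blast
  show "Tan (traj_of \<gamma>) \<subseteq> Im_cosymp (traj_of \<gamma>)"
  proof
    fix v assume "v \<in> Tan (traj_of \<gamma>)"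
    then obtain \<delta> where \<delta>: "D_traj \<gamma> \<delta> = v"
      using tangent_lift[OF \<gamma>] by blast
    define x y where "x = mink (snd \<gamma>) (fst \<delta>) / mink (snd \<gamma>) (snd \<gamma>)"
      and "y = mink (snd \<gamma>) (snd \<delta>) / mink (snd \<gamma>) (snd \<gamma>)"
    have "\<delta> - (x *\<^sub>R snd \<gamma>, y *\<^sub>R snd \<gamma>) \<in> vertical_orthogonal \<gamma>"
      using N by (simp add: vertical_orthogonal_def x_def y_def)
    moreover have "D_traj \<gamma> (\<delta> - (x *\<^sub>R snd \<gamma>, y *\<^sub>R snd \<gamma>)) = v"
      using \<delta> by (simp add: linear_diff[OF D_traj_linear[OF \<gamma>]] D_traj_vertical[OF \<gamma>])
    ultimately show "v \<in> Im_cosymp (traj_of \<gamma>)"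
      unfolding Im_cosymp_traj_of[OF \<gamma>] by blast
  qed
qed

section \<open>Null trajectories\<close>

lemma traj_sign_invariant:
  assumes "traj_of \<gamma> = traj_of \<gamma>'"
  obtains k where "0 < k" "mink (snd \<gamma>') (snd \<gamma>') = k * mink (snd \<gamma>) (snd \<gamma>)"
proof -
  obtain a b where "0 < a" "\<gamma>' = aff_act a b \<gamma>"
    using traj_of_eqE[OF assms] .
  then show ?thesis
    using that[of "a * a"] by simp
qed

lemma traj_of_in_G_traj_null:
  assumes "\<gamma> \<in> G_curv"
  shows "traj_of \<gamma> \<in> G_traj_null \<longleftrightarrow> mink (snd \<gamma>) (snd \<gamma>) = 0"
proof
  assume "traj_of \<gamma> \<in> G_traj_null"
  then obtain \<gamma>' where \<gamma>': "traj_of \<gamma>' = traj_of \<gamma>" "mink (snd \<gamma>') (snd \<gamma>') = 0"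
    unfolding G_traj_null_def by force
  obtain k where "mink (snd \<gamma>) (snd \<gamma>) = k * mink (snd \<gamma>') (snd \<gamma>')"
    using traj_sign_invariant[OF \<gamma>'(1)] by blast
  with \<gamma>'(2) show "mink (snd \<gamma>) (snd \<gamma>) = 0"
    by simp
next
  assume "mink (snd \<gamma>) (snd \<gamma>) = 0"
  with assms show "traj_of \<gamma> \<in> G_traj_null"
    unfolding G_traj_null_def by blast
qed

lemma mem_G_curv_null: "\<gamma> \<in> G_curv_null \<longleftrightarrow> \<gamma> \<in> G_curv \<and> mink (snd \<gamma>) (snd \<gamma>) = 0"
  using traj_of_in_G_traj_null[of \<gamma>] by (auto simp: G_curv_null_def)

text \<open>For the inclusion from right to left a curve in the null cone with given velocity is needed. With a null
  vector \<open>n\<close> transversal to \<open>V\<close> and \<open>\<delta>V = k V + W\<close>, \<open>g(n, W) = 0\<close>, adding a quadratic multiple of \<open>n\<close> to the line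
  \<open>V + t W\<close> keeps it null, and the factor \<open>1 + k t\<close> restores the component along \<open>V\<close>.\<close>

lemma velocities_G_curv_null:
  assumes \<gamma>: "\<gamma> \<in> G_curv_null"
  shows "velocities G_curv_null \<gamma> = {\<delta>. mink (snd \<gamma>) (snd \<delta>) = 0}"
proof
  show "velocities G_curv_null \<gamma> \<subseteq> {\<delta>. mink (snd \<gamma>) (snd \<delta>) = 0}"
  proof
    fix \<delta> assume "\<delta> \<in> velocities G_curv_null \<gamma>"
    then obtain c \<epsilon> where c: "0 < \<epsilon>" "c 0 = \<gamma>" "c ` {-\<epsilon><..<\<epsilon>} \<subseteq> G_curv_null" "(c has_vector_derivative \<delta>) (at (0::real))"
      unfolding velocities_def by blast
    have s: "((\<lambda>t. snd (c t)) has_vector_derivative snd \<delta>) (at 0)"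
      by (rule bounded_linear.has_vector_derivative[OF bounded_linear_snd c(4)])
    have "((\<lambda>t. mink (snd (c t)) (snd (c t))) has_vector_derivative
        (mink (snd (c 0)) (snd \<delta>) + mink (snd \<delta>) (snd (c 0)))) (at 0)"
      by (rule bounded_bilinear.has_vector_derivative[OF bounded_bilinear_mink s s])
    moreover have "((\<lambda>t. mink (snd (c t)) (snd (c t))) has_vector_derivative 0) (at 0)"
    proof (rule has_vector_derivative_transform_within_open[OF has_vector_derivative_const])
      show "0 = mink (snd (c t)) (snd (c t))" if "t \<in> {-\<epsilon><..<\<epsilon>}" for t
      proof -
        have "c t \<in> G_curv_null"
          using c(3) that by blast
        then show ?thesis
          by (simp add: mem_G_curv_null)
      qed
    qed (use c(1) in auto)
    ultimately have "mink (snd (c 0)) (snd \<delta>) + mink (snd \<delta>) (snd (c 0)) = 0"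
      by (rule vector_derivative_unique_at)
    then show "\<delta> \<in> {\<delta>. mink (snd \<gamma>) (snd \<delta>) = 0}"
      using c(2) mink_sym[of "snd \<delta>" "snd \<gamma>"] by simp
  qed
  show "{\<delta>. mink (snd \<gamma>) (snd \<delta>) = 0} \<subseteq> velocities G_curv_null \<gamma>"
  proof
    fix \<delta> :: phase assume "\<delta> \<in> {\<delta>. mink (snd \<gamma>) (snd \<delta>) = 0}"
    then have \<delta>: "mink (snd \<gamma>) (snd \<delta>) = 0" by simp
    define V where "V = snd \<gamma>"
    have V: "V \<noteq> 0" "mink V V = 0" "mink V (snd \<delta>) = 0"
      using \<gamma> \<delta> by (simp_all add: V_def mem_G_curv_null snd_G_curv)
    obtain n where n: "mink n n = 0" "0 < mink n V"
      using null_frame_exists[OF V(1)] null_frame_rules(1) by metis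
    define k where "k = mink n (snd \<delta>) / mink n V"
    define W where "W = snd \<delta> - k *\<^sub>R V"
    \<comment> \<open>the solution of \<open>g(W, W) + 2 m g(n, V) = 0\<close>\<close>
    define m where "m = - mink W W / (2 * mink n V)"
    have W: "mink n W = 0" "mink V W = 0"
      using n V by (simp_all add: W_def k_def)
    define c where "c t = (fst \<gamma> + t *\<^sub>R fst \<delta>, (1 + k * t) *\<^sub>R (V + t *\<^sub>R W + (t * t) *\<^sub>R m *\<^sub>R n))" for t :: real
    \<comment> \<open>small enough for \<open>1 + k t\<close> to stay positive\<close>
    define \<epsilon> where "\<epsilon> = 1 / (\<bar>k\<bar> + 1)"
    have "c 0 = \<gamma>"
      by (simp add: c_def V_def)
    moreover have "0 < \<epsilon>"
      by (simp add: \<epsilon>_def)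
    moreover have "c t \<in> G_curv_null" if t: "t \<in> {-\<epsilon><..<\<epsilon>}" for t
    proof -
      have "\<bar>k * t\<bar> < 1"
      proof -
        have "\<bar>t\<bar> * (\<bar>k\<bar> + 1) < 1"
          using t by (simp add: \<epsilon>_def field_simps abs_if split: if_splits)
        then show ?thesis
          using abs_ge_zero[of t] by (simp add: abs_mult algebra_simps)
      qed
      then have pos: "0 < 1 + k * t"
        by linarith
      define Z where "Z = V + t *\<^sub>R W + (t * t) *\<^sub>R m *\<^sub>R n"
      have c: "snd (c t) = (1 + k * t) *\<^sub>R Z"
        by (simp add: c_def Z_def)
      have "mink n Z = mink n V"
        using n W by (simp add: Z_def)
      then have "Z \<noteq> 0"
        using n by auto
      moreover have "mink Z Z = t * t * (mink W W + 2 * m * mink n V)"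
        using n W V by (simp add: Z_def mink_sym[of W V] mink_sym[of V n] mink_sym[of W n] algebra_simps)
      moreover have "mink W W + 2 * m * mink n V = 0"
        using n by (simp add: m_def)
      ultimately show ?thesis
        using pos by (simp add: mem_G_curv_null snd_G_curv c)
    qed
    moreover have "smooth_on {-\<epsilon><..<\<epsilon>} c"
    proof -
      have t: "smooth_on {-\<epsilon><..<\<epsilon>} (\<lambda>t. t)"
        by (rule smooth_on_linear) (auto intro: linearI)
      show ?thesis
        unfolding c_def
        by (intro smooth_on_Pair smooth_on_add smooth_on_scaleR smooth_on_mult smooth_on_const t open_greaterThanLessThan)
    qed
    moreover have "(c has_vector_derivative \<delta>) (at 0)"
    proof -
      have "((\<lambda>t. fst \<gamma> + t *\<^sub>R fst \<delta>) has_vector_derivative fst \<delta>) (at 0)"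
        unfolding has_vector_derivative_def by (auto intro!: derivative_eq_intros)
      moreover have "((\<lambda>t. (1 + k * t) *\<^sub>R (V + t *\<^sub>R W + (t * t) *\<^sub>R m *\<^sub>R n)) has_vector_derivative snd \<delta>) (at 0)"
        unfolding has_vector_derivative_def
        by (auto intro!: derivative_eq_intros simp: W_def algebra_simps)
      ultimately have "(c has_vector_derivative (fst \<delta>, snd \<delta>)) (at 0)"
        unfolding c_def by (rule has_vector_derivative_Pair)
      then show ?thesis by simp
    qed
    ultimately show "\<delta> \<in> velocities G_curv_null \<gamma>"
      unfolding velocities_def by blast
  qed
qed

text \<open>Curves of null trajectories and curves in the null part of \<open>G_curv\<close> determine each other's velocities:
  the former lift by a local section, the latter project.\<close>

lemma sub_tangent_space_null:
  assumes \<gamma>: "\<gamma> \<in> G_curv_null"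
  shows "sub_tangent_space traj_atlas G_traj_null (traj_of \<gamma>) = D_traj \<gamma> ` {\<delta>. mink (snd \<gamma>) (snd \<delta>) = 0}"
proof
  have \<gamma>': "\<gamma> \<in> G_curv"
    using \<gamma> by (simp add: mem_G_curv_null)
  show "sub_tangent_space traj_atlas G_traj_null (traj_of \<gamma>) \<subseteq> D_traj \<gamma> ` {\<delta>. mink (snd \<gamma>) (snd \<delta>) = 0}"
  proof
    fix v assume v: "v \<in> sub_tangent_space traj_atlas G_traj_null (traj_of \<gamma>)"
    then have vT: "v \<in> Tan (traj_of \<gamma>)"
      by (simp add: sub_tangent_space_def)
    obtain U \<phi> where c: "(U, \<phi>) \<in> traj_atlas" "traj_of \<gamma> \<in> U"
      using traj_chart_exists[OF \<gamma>'] by (metis prod.collapse)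
    have cA: "(U, \<phi>) \<in> quotient_atlas G_curv traj_of" and q: "traj_of \<gamma> \<in> fst (U, \<phi>)"
      using c by (simp_all add: traj_atlas_def)
    obtain s where s: "local_section G_curv traj_of (U, \<phi>) s" "s (snd (U, \<phi>) (traj_of \<gamma>)) = \<gamma>"
      using local_section_through[OF c(1) \<gamma>' q] .
    have "(U, \<phi>) \<in> charts_at traj_atlas (traj_of \<gamma>)"
      using c by (simp add: charts_at_def)
    then obtain k \<epsilon> where k: "k 0 = traj_of \<gamma>" "0 < \<epsilon>" "k ` {-\<epsilon><..<\<epsilon>} \<subseteq> G_traj_null \<inter> U"
        "smooth_on {-\<epsilon><..<\<epsilon>} (\<phi> \<circ> k)" "(\<phi> \<circ> k has_vector_derivative v (U, \<phi>)) (at (0::real))"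
      using v unfolding sub_tangent_space_def by blast
    let ?\<delta> = "frechet_derivative s (at (\<phi> (traj_of \<gamma>))) (v (U, \<phi>))"
    have "v = D_traj \<gamma> ?\<delta>"
      using tangent_eq_push_tangent[OF cA s(1) q vT[unfolded traj_atlas_def]] s(2) by (simp add: traj_atlas_def)
    moreover have "?\<delta> \<in> velocities G_curv_null \<gamma>"
    proof -
      let ?c = "\<lambda>t. s ((\<phi> \<circ> k) t)"
      have D: "(s has_derivative frechet_derivative s (at (\<phi> (traj_of \<gamma>)))) (at ((\<phi> \<circ> k) 0))"
        using local_section_has_derivative[OF cA s(1) q] k(1) by simp
      have "(?c has_derivative (\<lambda>r. frechet_derivative s (at (\<phi> (traj_of \<gamma>))) (r *\<^sub>R v (U, \<phi>)))) (at 0)"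
        by (rule has_derivative_compose[OF k(5)[unfolded has_vector_derivative_def] D])
      then have "(?c has_vector_derivative ?\<delta>) (at 0)"
        unfolding has_vector_derivative_def by (simp only: linear_scale[OF has_derivative_linear[OF D]])
      moreover have "smooth_on {-\<epsilon><..<\<epsilon>} ?c"
        by (rule smooth_on_compose[OF _ quotient_atlasD(4)[OF cA] k(4) local_sectionD(1)[OF s(1)]])
          (use k(3) in auto)
      moreover have "?c ` {-\<epsilon><..<\<epsilon>} \<subseteq> G_curv_null"
      proof
        fix x assume "x \<in> ?c ` {-\<epsilon><..<\<epsilon>}"
        then obtain t where t: "t \<in> {-\<epsilon><..<\<epsilon>}" "x = s (\<phi> (k t))" by auto
        then have "k t \<in> fst (U, \<phi>)" "k t \<in> G_traj_null"
          using k(3) by auto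
        then show "x \<in> G_curv_null"
          using local_sectionD(2,3)[OF s(1), of "k t"] t by (simp add: G_curv_null_def)
      qed
      moreover have "?c 0 = \<gamma>"
        using s(2) k(1) by simp
      ultimately have "0 < \<epsilon> \<and> ?c 0 = \<gamma> \<and> ?c ` {-\<epsilon><..<\<epsilon>} \<subseteq> G_curv_null \<and>
          smooth_on {-\<epsilon><..<\<epsilon>} ?c \<and> (?c has_vector_derivative ?\<delta>) (at 0)"
        using k(2) by (intro conjI)
      then show ?thesis
        unfolding velocities_def mem_Collect_eq by (intro exI[of _ ?c] exI[of _ \<epsilon>])
    qed
    ultimately show "v \<in> D_traj \<gamma> ` {\<delta>. mink (snd \<gamma>) (snd \<delta>) = 0}"
      unfolding velocities_G_curv_null[OF \<gamma>] by blast
  qed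
  show "D_traj \<gamma> ` {\<delta>. mink (snd \<gamma>) (snd \<delta>) = 0} \<subseteq> sub_tangent_space traj_atlas G_traj_null (traj_of \<gamma>)"
  proof
    fix v assume "v \<in> D_traj \<gamma> ` {\<delta>. mink (snd \<gamma>) (snd \<delta>) = 0}"
    then obtain \<delta> where \<delta>: "\<delta> \<in> velocities G_curv_null \<gamma>" and v: "v = D_traj \<gamma> \<delta>"
      unfolding velocities_G_curv_null[OF \<gamma>] by blast
    then obtain k \<epsilon> where k: "k 0 = \<gamma>" "0 < \<epsilon>" "k ` {-\<epsilon><..<\<epsilon>} \<subseteq> G_curv_null"
        "smooth_on {-\<epsilon><..<\<epsilon>} k" "(k has_vector_derivative \<delta>) (at (0::real))"
      unfolding velocities_def by blast
    show "v \<in> sub_tangent_space traj_atlas G_traj_null (traj_of \<gamma>)"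
      unfolding sub_tangent_space_def mem_Collect_eq
    proof (intro conjI exI[of _ "\<lambda>t. traj_of (k t)"] ballI)
      show "v \<in> Tan (traj_of \<gamma>)"
        unfolding v by (rule D_traj_in_Tan[OF \<gamma>'])
      show "traj_of (k 0) = traj_of \<gamma>"
        by (simp add: k(1))
      fix c :: "(phase set, model) chart" assume "c \<in> charts_at traj_atlas (traj_of \<gamma>)"
      then have cA: "c \<in> quotient_atlas G_curv traj_of" "traj_of \<gamma> \<in> fst c"
        by (simp_all add: charts_at_def traj_atlas_def)
      obtain \<delta>' where d: "0 < \<delta>'" "\<delta>' \<le> \<epsilon>" "k ` {-\<delta>'<..<\<delta>'} \<subseteq> G_curv \<inter> traj_of -` fst c"
        "smooth_on {-\<delta>'<..<\<delta>'} (snd c \<circ> (\<lambda>t. traj_of (k t)))"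
        "(snd c \<circ> (\<lambda>t. traj_of (k t)) has_vector_derivative v c) (at 0)"
        using push_tangent_curve_coordinate[OF cA(1) \<gamma>' cA(2) k(1,2,4,5)] unfolding v traj_atlas_def by blast
      have "(\<lambda>t. traj_of (k t)) ` {-\<delta>'<..<\<delta>'} \<subseteq> G_traj_null \<inter> fst c"
      proof
        fix x assume "x \<in> (\<lambda>t. traj_of (k t)) ` {-\<delta>'<..<\<delta>'}"
        then obtain t where t: "t \<in> {-\<delta>'<..<\<delta>'}" "x = traj_of (k t)" by blast
        then have "t \<in> {-\<epsilon><..<\<epsilon>}" using d(2) by simp
        then have "k t \<in> G_curv_null" using k(3) by blast
        then have "traj_of (k t) \<in> G_traj_null"
          by (simp add: G_curv_null_def)
        moreover have "traj_of (k t) \<in> fst c"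
          using t(1) d(3) by blast
        ultimately show "x \<in> G_traj_null \<inter> fst c"
          by (simp add: t(2))
      qed
      with d show "case c of (U, \<phi>) \<Rightarrow> \<exists>\<epsilon>>0. (\<lambda>t. traj_of (k t)) ` {-\<epsilon><..<\<epsilon>} \<subseteq> G_traj_null \<inter> U \<and>
          smooth_on {-\<epsilon><..<\<epsilon>} (\<phi> \<circ> (\<lambda>t. traj_of (k t))) \<and>
          (\<phi> \<circ> (\<lambda>t. traj_of (k t)) has_vector_derivative v (U, \<phi>)) (at 0)"
        by (cases c) auto
    qed
  qed
qed

lemma Im_cosymp_liouville:
  assumes \<gamma>: "\<gamma> \<in> G_curv_null"
  shows "Im_cosymp (traj_of \<gamma>) = liouville_plane \<gamma>"
proof -
  have "vertical_orthogonal \<gamma> = {\<delta>. liouville \<gamma> \<delta> = 0} \<inter> velocities G_curv_null \<gamma>"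
    unfolding velocities_G_curv_null[OF \<gamma>] by (auto simp: vertical_orthogonal_def liouville_def)
  then show ?thesis
    using \<gamma> by (simp add: Im_cosymp_traj_of mem_G_curv_null liouville_plane_def)
qed

text \<open>When \<open>V\<close> is null, \<open>g(V, \<delta>X)\<close> is unchanged by vertical vectors, so the Liouville form can be tested on
  any lift.\<close>

lemma D_traj_in_Im_cosymp_null:
  assumes \<gamma>: "\<gamma> \<in> G_curv_null" and \<delta>: "mink (snd \<gamma>) (snd \<delta>) = 0"
  shows "D_traj \<gamma> \<delta> \<in> Im_cosymp (traj_of \<gamma>) \<longleftrightarrow> mink (snd \<gamma>) (fst \<delta>) = 0"
proof -
  have \<gamma>': "\<gamma> \<in> G_curv" "mink (snd \<gamma>) (snd \<gamma>) = 0"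
    using \<gamma> by (simp_all add: mem_G_curv_null)
  show ?thesis
  proof
    assume "mink (snd \<gamma>) (fst \<delta>) = 0"
    with \<delta> have "\<delta> \<in> vertical_orthogonal \<gamma>"
      by (simp add: vertical_orthogonal_def)
    then show "D_traj \<gamma> \<delta> \<in> Im_cosymp (traj_of \<gamma>)"
      unfolding Im_cosymp_traj_of[OF \<gamma>'(1)] by blast
  next
    assume "D_traj \<gamma> \<delta> \<in> Im_cosymp (traj_of \<gamma>)"
    then obtain \<delta>' where \<delta>': "\<delta>' \<in> vertical_orthogonal \<gamma>" "D_traj \<gamma> \<delta>' = D_traj \<gamma> \<delta>"
      unfolding Im_cosymp_traj_of[OF \<gamma>'(1)] by force
    then obtain x y where "\<delta> = \<delta>' + (x *\<^sub>R snd \<gamma>, y *\<^sub>R snd \<gamma>)"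
      using D_traj_eq_imp[OF \<gamma>'(1)] by blast
    then show "mink (snd \<gamma>) (fst \<delta>) = 0"
      using \<delta>'(1) \<gamma>'(2) by (simp add: vertical_orthogonal_def)
  qed
qed

text \<open>Tangent vectors live in an infinite-dimensional type of functions on charts; the finite set \<open>B\<close> keeps
  \<open>dim\<close> meaningful.\<close>

lemma dim_eq_Suc_dim:
  assumes H: "subspace H" "H \<subseteq> span B" "finite B" and z: "z \<notin> H" and T: "T = span (insert z H)"
  shows "dim T = dim H + 1"
proof -
  obtain C where C: "C \<subseteq> H" "independent C" "H \<subseteq> span C" "card C = dim H"
    using basis_exists by blast
  have fin: "finite C"
    using independent_span_bound[OF H(3) C(2)] C(1) H(2) by blast
  have sp: "span C = H"
    using C H(1) by (metis span_eq_iff span_mono subset_antisym)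
  have ind: "independent (insert z C)"
    using C(2) z sp by (simp add: independent_insertI)
  have "span (insert z C) = T"
    unfolding T span_insert sp using H(1) by (simp only: span_eq_iff[THEN iffD2])
  moreover have "span T = T"
    unfolding T by (rule span_span)
  ultimately have "dim T = card (insert z C)"
    by (intro dim_eq_card[OF _ ind]) (simp only:)
  also have "\<dots> = card C + 1"
    using fin z C(1) by (metis Suc_eq_plus1 card_insert_disjoint subsetD)
  finally show ?thesis
    using C(4) by simp
qed

lemma hyperplane_distribution_null: "hyperplane_distribution traj_atlas G_traj_null Im_cosymp"
  unfolding hyperplane_distribution_def
proof (intro ballI conjI)
  fix q assume "q \<in> G_traj_null"
  then obtain \<gamma> where \<gamma>': "\<gamma> \<in> G_curv" "mink (snd \<gamma>) (snd \<gamma>) = 0" and q: "q = traj_of \<gamma>"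
    by (auto simp: G_traj_null_def)
  then have \<gamma>: "\<gamma> \<in> G_curv_null"
    by (simp add: mem_G_curv_null)
  let ?H = "Im_cosymp q" and ?T = "sub_tangent_space traj_atlas G_traj_null q"
  have H: "?H = D_traj \<gamma> ` vertical_orthogonal \<gamma>"
    unfolding q by (rule Im_cosymp_traj_of[OF \<gamma>'(1)])
  have T: "?T = D_traj \<gamma> ` {\<delta>. mink (snd \<gamma>) (snd \<delta>) = 0}"
    unfolding q by (rule sub_tangent_space_null[OF \<gamma>])
  show sub: "subspace ?H"
    unfolding H by (rule linear_subspace_image[OF D_traj_linear[OF \<gamma>'(1)] subspace_vertical_orthogonal])
  show "?H \<subseteq> ?T"
    unfolding H T by (rule image_mono) (auto simp: vertical_orthogonal_def)
  have subT: "subspace ?T"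
    unfolding T by (rule linear_subspace_image[OF D_traj_linear[OF \<gamma>'(1)]]) (rule subspaceI; simp)
  obtain n where n: "0 < mink n (snd \<gamma>)"
    using null_frame_exists \<gamma>'(1) snd_G_curv by metis
  let ?z = "D_traj \<gamma> (n, 0)"
  have z: "?z \<notin> ?H"
    unfolding q using D_traj_in_Im_cosymp_null[OF \<gamma>, of "(n, 0)"] n by (simp add: mink_sym[of _ n])
  have "?T = span (insert ?z ?H)"
  proof
    show "span (insert ?z ?H) \<subseteq> ?T"
      using \<open>?H \<subseteq> ?T\<close> by (intro span_minimal subT) (auto simp: T)
    show "?T \<subseteq> span (insert ?z ?H)"
    proof
      fix v assume "v \<in> ?T"
      then obtain \<delta> where \<delta>: "mink (snd \<gamma>) (snd \<delta>) = 0" "v = D_traj \<gamma> \<delta>"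
        unfolding T by blast
      define k where "k = mink (snd \<gamma>) (fst \<delta>) / mink n (snd \<gamma>)"
      have "\<delta> - k *\<^sub>R (n, 0) \<in> vertical_orthogonal \<gamma>"
        using \<delta>(1) n by (simp add: vertical_orthogonal_def k_def mink_sym[of _ n])
      then have "D_traj \<gamma> (\<delta> - k *\<^sub>R (n, 0)) \<in> span (insert ?z ?H)"
        unfolding H by (intro span_base) blast
      moreover have "k *\<^sub>R ?z \<in> span (insert ?z ?H)"
        by (intro span_scale span_base) simp
      ultimately have "D_traj \<gamma> (\<delta> - k *\<^sub>R (n, 0)) + k *\<^sub>R ?z \<in> span (insert ?z ?H)"
        by (rule span_add)
      then show "v \<in> span (insert ?z ?H)"
        unfolding \<delta>(2) linear_diff[OF D_traj_linear[OF \<gamma>'(1)]] linear_scale[OF D_traj_linear[OF \<gamma>'(1)]]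
        by simp
    qed
  qed
  moreover have "?H \<subseteq> span (D_traj \<gamma> ` Basis)"
    unfolding H linear_span_image[OF D_traj_linear[OF \<gamma>'(1)]] by auto
  ultimately show "dim ?T = dim ?H + 1"
    by (intro dim_eq_Suc_dim[OF sub _ _ z, where B = "D_traj \<gamma> ` Basis"]) simp_all
qed

section \<open>The conformal class of symplectic forms\<close>

text \<open>Space-like and time-like trajectories are the cases \<open>\<epsilon> = 1\<close> and \<open>\<epsilon> = -1\<close>.\<close>

definition signed_trajs :: "real \<Rightarrow> phase set set" where
  "signed_trajs \<epsilon> = traj_of ` {\<gamma> \<in> G_curv. 0 < \<epsilon> * mink (snd \<gamma>) (snd \<gamma>)}"

lemma signed_trajs_simps: "G_traj_pos = signed_trajs 1" "G_traj_neg = signed_trajs (- 1)"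
  by (simp_all add: signed_trajs_def G_traj_pos_def G_traj_neg_def)

lemma traj_of_in_signed_trajs:
  assumes "\<gamma> \<in> G_curv"
  shows "traj_of \<gamma> \<in> signed_trajs \<epsilon> \<longleftrightarrow> 0 < \<epsilon> * mink (snd \<gamma>) (snd \<gamma>)"
proof
  assume "traj_of \<gamma> \<in> signed_trajs \<epsilon>"
  then obtain \<gamma>' where \<gamma>': "traj_of \<gamma>' = traj_of \<gamma>" "0 < \<epsilon> * mink (snd \<gamma>') (snd \<gamma>')"
    unfolding signed_trajs_def by force
  obtain k where k: "0 < k" "mink (snd \<gamma>) (snd \<gamma>) = k * mink (snd \<gamma>') (snd \<gamma>')"
    using traj_sign_invariant[OF \<gamma>'(1)] by blast
  have "0 < k * (\<epsilon> * mink (snd \<gamma>') (snd \<gamma>'))"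
    using k(1) \<gamma>'(2) by (rule mult_pos_pos)
  then show "0 < \<epsilon> * mink (snd \<gamma>) (snd \<gamma>)"
    unfolding k(2) by (simp add: mult.left_commute)
next
  assume "0 < \<epsilon> * mink (snd \<gamma>) (snd \<gamma>)"
  with assms show "traj_of \<gamma> \<in> signed_trajs \<epsilon>"
    unfolding signed_trajs_def by blast
qed

definition unit_over :: "phase set \<Rightarrow> phase \<Rightarrow> bool" where
  "unit_over \<tau> \<gamma> \<longleftrightarrow> \<gamma> \<in> G_curv \<and> traj_of \<gamma> = \<tau> \<and> \<bar>mink (snd \<gamma>) (snd \<gamma>)\<bar> = 1"

definition unit_rescale :: "phase \<Rightarrow> phase" where
  "unit_rescale \<gamma> = aff_act (\<bar>mink (snd \<gamma>) (snd \<gamma>)\<bar> powr (- 1 / 2)) 0 \<gamma>"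

lemma unit_rescale:
  assumes "mink (snd \<gamma>) (snd \<gamma>) \<noteq> 0"
  shows "mink (snd (unit_rescale \<gamma>)) (snd (unit_rescale \<gamma>)) = sgn (mink (snd \<gamma>) (snd \<gamma>))"
    and "traj_of (unit_rescale \<gamma>) = traj_of \<gamma>"
    and "unit_rescale \<gamma> \<in> G_curv"
proof -
  let ?N = "mink (snd \<gamma>) (snd \<gamma>)"
  have "\<bar>?N\<bar> powr (- 1 / 2) * (\<bar>?N\<bar> powr (- 1 / 2)) = \<bar>?N\<bar> powr (- 1 / 2 + - 1 / 2)"
    by (rule powr_add[symmetric])
  also have "\<dots> = 1 / \<bar>?N\<bar>"
    using assms by (simp add: powr_minus_divide)
  finally have "\<bar>?N\<bar> powr (- 1 / 2) * (\<bar>?N\<bar> powr (- 1 / 2)) = 1 / \<bar>?N\<bar>" .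
  moreover have "mink (snd (unit_rescale \<gamma>)) (snd (unit_rescale \<gamma>)) =
      (\<bar>?N\<bar> powr (- 1 / 2) * (\<bar>?N\<bar> powr (- 1 / 2))) * ?N"
    unfolding unit_rescale_def aff_act_sel mink_linear_simps by (simp only: mult.assoc)
  ultimately show "mink (snd (unit_rescale \<gamma>)) (snd (unit_rescale \<gamma>)) = sgn ?N"
    by (simp add: sgn_real_def abs_if)
  have pos: "0 < \<bar>?N\<bar> powr (- 1 / 2)"
    using assms by simp
  show "traj_of (unit_rescale \<gamma>) = traj_of \<gamma>"
    unfolding unit_rescale_def by (rule traj_of_aff_act[OF pos])
  have "\<gamma> \<in> G_curv"
    using assms snd_G_curv by fastforce
  then show "unit_rescale \<gamma> \<in> G_curv"
    unfolding unit_rescale_def aff_act_in_G_curv[OF pos] .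
qed

lemma unit_over_exists:
  assumes "\<tau> \<in> signed_trajs \<epsilon>"
  obtains \<gamma> where "unit_over \<tau> \<gamma>"
proof -
  obtain \<gamma> where \<gamma>: "\<tau> = traj_of \<gamma>" "0 < \<epsilon> * mink (snd \<gamma>) (snd \<gamma>)"
    using assms unfolding signed_trajs_def by blast
  then have "mink (snd \<gamma>) (snd \<gamma>) \<noteq> 0" by auto
  from unit_rescale[OF this] this have "unit_over \<tau> (unit_rescale \<gamma>)"
    by (simp add: unit_over_def \<gamma>(1) sgn_real_def)
  then show ?thesis by (rule that)
qed

lemma unit_overD:
  assumes "unit_over \<tau> \<gamma>"
  shows "\<gamma> \<in> G_curv" "traj_of \<gamma> = \<tau>" "mink (snd \<gamma>) (snd \<gamma>) \<noteq> 0"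
  using assms by (auto simp: unit_over_def)

lemma tangent_level_lift:
  assumes \<gamma>: "unit_over \<tau> \<gamma>" and u: "u \<in> Tan \<tau>"
  obtains \<delta> where "D_traj \<gamma> \<delta> = u" "mink (snd \<gamma>) (snd \<delta>) = 0"
proof -
  note g = unit_overD[OF \<gamma>]
  obtain \<delta> where \<delta>: "D_traj \<gamma> \<delta> = u"
    using tangent_lift[OF g(1)] u g(2) by blast
  define y where "y = mink (snd \<gamma>) (snd \<delta>) / mink (snd \<gamma>) (snd \<gamma>)"
  show ?thesis
  proof (rule that)
    show "D_traj \<gamma> (\<delta> - (0 *\<^sub>R snd \<gamma>, y *\<^sub>R snd \<gamma>)) = u"
      using \<delta> D_traj_vertical[OF g(1), of 0 y] by (simp add: linear_diff[OF D_traj_linear[OF g(1)]])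
    show "mink (snd \<gamma>) (snd (\<delta> - (0 *\<^sub>R snd \<gamma>, y *\<^sub>R snd \<gamma>))) = 0"
      using g(3) by (simp add: y_def)
  qed
qed

text \<open>The restriction of \<open>omega\<close> to the level set \<open>\<bar>g(V, V)\<bar> = 1\<close>, evaluated on lifts tangent to it. The choices
  do not matter by \<open>reduced_form_eq\<close>.\<close>

definition reduced_form :: "phase set set \<Rightarrow> (phase set, model) two_form" where
  "reduced_form W \<tau> u v = (if \<tau> \<in> W \<and> u \<in> Tan \<tau> \<and> v \<in> Tan \<tau> then
     (let \<gamma> = SOME \<gamma>. unit_over \<tau> \<gamma> in
       omega \<gamma> (SOME \<delta>. D_traj \<gamma> \<delta> = u \<and> mink (snd \<gamma>) (snd \<delta>) = 0)
         (SOME \<delta>. D_traj \<gamma> \<delta> = v \<and> mink (snd \<gamma>) (snd \<delta>) = 0)) else 0)"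

text \<open>The level set meets a non-null orbit in a line \<open>X + b V\<close>, because \<open>a\<^sup>2 = 1\<close> forces \<open>a = 1\<close>. Translations along it
  preserve \<open>omega\<close>, and two level lifts of a vector differ by a multiple of \<open>(V, 0)\<close>, which \<open>omega\<close> does not see on
  level vectors. The value of \<open>omega\<close> is independent of its base point, here \<open>\<gamma>'\<close>.\<close>

lemma reduced_form_eq:
  assumes \<gamma>: "unit_over \<tau> \<gamma>" and W: "\<tau> \<in> W"
    and \<delta>: "mink (snd \<gamma>) (snd \<delta>) = 0" and \<delta>': "mink (snd \<gamma>) (snd \<delta>') = 0"
  shows "reduced_form W \<tau> (D_traj \<gamma> \<delta>) (D_traj \<gamma> \<delta>') = omega \<gamma>' \<delta> \<delta>'"
proof -
  define \<gamma>0 where "\<gamma>0 = (SOME \<gamma>. unit_over \<tau> \<gamma>)"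
  define pick where "pick u = (SOME \<delta>. D_traj \<gamma>0 \<delta> = u \<and> mink (snd \<gamma>0) (snd \<delta>) = 0)" for u
  have \<gamma>0: "unit_over \<tau> \<gamma>0"
    unfolding \<gamma>0_def using \<gamma> by (rule someI[of "unit_over \<tau>"])
  note g = unit_overD[OF \<gamma>] and g0 = unit_overD[OF \<gamma>0]
  have pick: "D_traj \<gamma>0 (pick u) = u \<and> mink (snd \<gamma>0) (snd (pick u)) = 0" if "u \<in> Tan \<tau>" for u
    unfolding pick_def by (rule someI_ex) (use tangent_level_lift[OF \<gamma>0 that] in metis)
  obtain a b where ab: "0 < a" "\<gamma>0 = aff_act a b \<gamma>"
    using traj_of_eqE[of \<gamma> \<gamma>0] g(2) g0(2) by metis
  have "a * a = 1"
  proof -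
    have "\<bar>mink (snd \<gamma>0) (snd \<gamma>0)\<bar> = a * a * \<bar>mink (snd \<gamma>) (snd \<gamma>)\<bar>"
      using ab by (simp add: abs_mult)
    then show ?thesis
      using \<gamma> \<gamma>0 by (simp add: unit_over_def)
  qed
  then have "a = 1"
    using ab(1) by (metis abs_of_pos real_sqrt_abs2 real_sqrt_one)
  with ab have b: "\<gamma>0 = aff_act 1 b \<gamma>" by simp
  have shift: "\<exists>x. aff_act 1 b \<delta> = pick (D_traj \<gamma> \<delta>) + (x *\<^sub>R snd \<gamma>0, 0 *\<^sub>R snd \<gamma>0)"
    if "mink (snd \<gamma>) (snd \<delta>) = 0" for \<delta>
  proof -
    have u: "D_traj \<gamma> \<delta> \<in> Tan \<tau>"
      using D_traj_in_Tan[OF g(1)] g(2) by blast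
    have "D_traj \<gamma>0 (pick (D_traj \<gamma> \<delta>)) = D_traj \<gamma>0 (aff_act 1 b \<delta>)"
      using pick[OF u] D_traj_equivariant[OF zero_less_one g(1), of b \<delta>] by (simp add: b)
    then obtain x y where xy: "aff_act 1 b \<delta> = pick (D_traj \<gamma> \<delta>) + (x *\<^sub>R snd \<gamma>0, y *\<^sub>R snd \<gamma>0)"
      by (rule D_traj_eq_imp[OF g0(1)])
    have "mink (snd \<gamma>0) (snd (aff_act 1 b \<delta>)) = 0"
      using that by (simp add: b)
    then have "y * mink (snd \<gamma>0) (snd \<gamma>0) = 0"
      unfolding xy using pick[OF u] by simp
    with g0(3) xy show ?thesis by auto
  qed
  obtain x x' where x: "aff_act 1 b \<delta> = pick (D_traj \<gamma> \<delta>) + (x *\<^sub>R snd \<gamma>0, 0 *\<^sub>R snd \<gamma>0)"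
    and x': "aff_act 1 b \<delta>' = pick (D_traj \<gamma> \<delta>') + (x' *\<^sub>R snd \<gamma>0, 0 *\<^sub>R snd \<gamma>0)"
    using shift[OF \<delta>] shift[OF \<delta>'] by blast
  have T: "D_traj \<gamma> \<delta> \<in> Tan \<tau>" "D_traj \<gamma> \<delta>' \<in> Tan \<tau>"
    using D_traj_in_Tan[OF g(1)] g(2) by blast+
  have "omega \<gamma>' \<delta> \<delta>' = omega \<gamma>0 (aff_act 1 b \<delta>) (aff_act 1 b \<delta>')"
    using omega_aff_act[of \<gamma>0 1 b \<delta> \<delta>' \<gamma>'] by simp
  also have "\<dots> = omega \<gamma>0 (pick (D_traj \<gamma> \<delta>)) (pick (D_traj \<gamma> \<delta>'))"
    using pick[OF T(1)] pick[OF T(2)] unfolding x x'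
    by (simp add: omega_def mink_sym[of _ "snd \<gamma>0"])
  also have "\<dots> = reduced_form W \<tau> (D_traj \<gamma> \<delta>) (D_traj \<gamma> \<delta>')"
    using W T by (simp add: reduced_form_def pick_def \<gamma>0_def Let_def)
  finally show ?thesis ..
qed

lemma reduced_form_zero:
  "\<not> (\<tau> \<in> W \<and> u \<in> Tan \<tau> \<and> v \<in> Tan \<tau>) \<Longrightarrow> reduced_form W \<tau> u v = 0"
  unfolding reduced_form_def by (rule if_not_P)

lemma reduced_form_antisym:
  assumes \<gamma>: "unit_over \<tau> \<gamma>" and W: "\<tau> \<in> W" and uv: "u \<in> Tan \<tau>" "v \<in> Tan \<tau>"
  shows "reduced_form W \<tau> u v = - reduced_form W \<tau> v u"
proof -
  obtain \<delta> \<delta>' where \<delta>: "D_traj \<gamma> \<delta> = u" "mink (snd \<gamma>) (snd \<delta>) = 0"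
    and \<delta>': "D_traj \<gamma> \<delta>' = v" "mink (snd \<gamma>) (snd \<delta>') = 0"
    using tangent_level_lift[OF \<gamma>] uv by metis
  show ?thesis
    using reduced_form_eq[OF \<gamma> W \<delta>(2) \<delta>'(2)] reduced_form_eq[OF \<gamma> W \<delta>'(2) \<delta>(2)] \<delta>(1) \<delta>'(1)
      omega_antisym by metis
qed

lemma reduced_form_linear:
  assumes \<gamma>: "unit_over \<tau> \<gamma>" and W: "\<tau> \<in> W" and u: "u \<in> Tan \<tau>"
  shows "linear_form_on (Tan \<tau>) (reduced_form W \<tau> u)"
  unfolding linear_form_on_def
proof (intro conjI ballI allI)
  note g = unit_overD[OF \<gamma>]
  obtain \<delta> where \<delta>: "D_traj \<gamma> \<delta> = u" "mink (snd \<gamma>) (snd \<delta>) = 0"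
    using tangent_level_lift[OF \<gamma> u] .
  have eq: "reduced_form W \<tau> u (D_traj \<gamma> \<eta>) = omega \<gamma> \<delta> \<eta>" if "mink (snd \<gamma>) (snd \<eta>) = 0" for \<eta>
    using reduced_form_eq[OF \<gamma> W \<delta>(2) that] \<delta>(1) by simp
  fix v assume "v \<in> Tan \<tau>"
  then obtain \<eta> where \<eta>: "v = D_traj \<gamma> \<eta>" "mink (snd \<gamma>) (snd \<eta>) = 0"
    using tangent_level_lift[OF \<gamma>] by metis
  { fix v' assume "v' \<in> Tan \<tau>"
    then obtain \<eta>' where \<eta>': "v' = D_traj \<gamma> \<eta>'" "mink (snd \<gamma>) (snd \<eta>') = 0"
      using tangent_level_lift[OF \<gamma>] by metis
    show "reduced_form W \<tau> u (v + v') = reduced_form W \<tau> u v + reduced_form W \<tau> u v'"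
      using \<eta>(2) \<eta>'(2) unfolding \<eta>(1) \<eta>'(1) linear_add[OF D_traj_linear[OF g(1)], symmetric]
      by (simp add: eq) }
  fix r
  show "reduced_form W \<tau> u (r *\<^sub>R v) = r * reduced_form W \<tau> u v"
    using \<eta>(2) unfolding \<eta>(1) linear_scale[OF D_traj_linear[OF g(1)], symmetric]
    by (simp add: eq)
qed

lemma reduced_form_in_Cotan:
  assumes "unit_over \<tau> \<gamma>" "\<tau> \<in> W" "u \<in> Tan \<tau>"
  shows "reduced_form W \<tau> u \<in> Cotan \<tau>"
  unfolding cotangent_space_def using reduced_form_linear[OF assms] reduced_form_zero by blast

text \<open>The level lift \<open>\<delta>\<close> represents the pulled-back covector only on level vectors. Adding the multiple \<open>k (V, 0)\<close>,
  which is invisible downstairs, makes it vanish on \<open>(0, V)\<close> and hence correct on all vectors.\<close>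

lemma pushed_inverse_reduced_form:
  assumes \<gamma>: "unit_over \<tau> \<gamma>" and W: "\<tau> \<in> W" and u: "u \<in> Tan \<tau>"
  shows "pushed_inverse \<gamma> (reduced_form W \<tau> u) = u"
proof -
  note g = unit_overD[OF \<gamma>]
  let ?V = "snd \<gamma>"
  let ?N = "mink ?V ?V"
  obtain \<delta> where \<delta>: "D_traj \<gamma> \<delta> = u" "mink ?V (snd \<delta>) = 0"
    using tangent_level_lift[OF \<gamma> u] .
  define k where "k = omega \<gamma> \<delta> (0 *\<^sub>R ?V, 1 *\<^sub>R ?V) / ?N"
  have "omega \<gamma> (\<delta> + (k *\<^sub>R ?V, 0 *\<^sub>R ?V)) \<eta> = reduced_form W \<tau> u (D_traj \<gamma> \<eta>)" for \<eta>
  proof -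
    define m where "m = mink ?V (snd \<eta>) / ?N"
    have level: "mink ?V (snd (\<eta> - (0 *\<^sub>R ?V, m *\<^sub>R ?V))) = 0"
      using g(3) by (simp add: m_def)
    have "D_traj \<gamma> (\<eta> - (0 *\<^sub>R ?V, m *\<^sub>R ?V)) = D_traj \<gamma> \<eta>"
      using D_traj_vertical[OF g(1), of 0 m] by (simp add: linear_diff[OF D_traj_linear[OF g(1)]])
    then have "reduced_form W \<tau> u (D_traj \<gamma> \<eta>) = omega \<gamma> \<delta> (\<eta> - (0 *\<^sub>R ?V, m *\<^sub>R ?V))"
      using reduced_form_eq[OF \<gamma> W \<delta>(2) level] \<delta>(1) by metis
    also have "\<dots> = omega \<gamma> \<delta> \<eta> + m * mink ?V (fst \<delta>)"
      unfolding omega_simps omega_vertical by simp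
    also have "m * mink ?V (fst \<delta>) = - k * mink ?V (snd \<eta>)"
      unfolding k_def omega_vertical m_def by simp
    also have "omega \<gamma> \<delta> \<eta> + - k * mink ?V (snd \<eta>) = omega \<gamma> (\<delta> + (k *\<^sub>R ?V, 0 *\<^sub>R ?V)) \<eta>"
      unfolding omega_simps omega_antisym[of \<gamma> "(k *\<^sub>R ?V, 0 *\<^sub>R ?V)"] omega_vertical by simp
    finally show ?thesis ..
  qed
  then have "pushed_inverse \<gamma> (reduced_form W \<tau> u) = D_traj \<gamma> (\<delta> + (k *\<^sub>R ?V, 0 *\<^sub>R ?V))"
    by (rule pushed_inverse_eq)
  also have "\<dots> = u"
    unfolding linear_add[OF D_traj_linear[OF g(1)]] D_traj_vertical[OF g(1)] using \<delta>(1) by simp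
  finally show ?thesis .
qed

lemma reduced_form_pushed_inverse:
  assumes \<gamma>: "unit_over \<tau> \<gamma>" and W: "\<tau> \<in> W" and \<theta>: "\<theta> \<in> Cotan \<tau>"
  shows "reduced_form W \<tau> (pushed_inverse \<gamma> \<theta>) = \<theta>"
proof (rule ext)
  note g = unit_overD[OF \<gamma>]
  obtain \<delta> where \<delta>: "\<delta> \<in> vertical_orthogonal \<gamma>" "\<And>\<eta>. omega \<gamma> \<delta> \<eta> = \<theta> (D_traj \<gamma> \<eta>)"
    using covector_lift[OF g(1)] \<theta> g(2) by blast
  have level: "mink (snd \<gamma>) (snd \<delta>) = 0"
    using \<delta>(1) by (simp add: vertical_orthogonal_def)
  have p: "pushed_inverse \<gamma> \<theta> = D_traj \<gamma> \<delta>"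
    by (rule pushed_inverse_eq[OF \<delta>(2)])
  fix v
  show "reduced_form W \<tau> (pushed_inverse \<gamma> \<theta>) v = \<theta> v"
  proof (cases "v \<in> Tan \<tau>")
    case True
    then obtain \<eta> where \<eta>: "D_traj \<gamma> \<eta> = v" "mink (snd \<gamma>) (snd \<eta>) = 0"
      using tangent_level_lift[OF \<gamma>] by metis
    show ?thesis
      using reduced_form_eq[OF \<gamma> W level \<eta>(2), of \<gamma>] \<delta>(2)[of \<eta>] unfolding p \<eta>(1) by simp
  next
    case False
    then show ?thesis
      using \<theta> reduced_form_zero[of \<tau> W _ v] by (simp add: cotangent_space_def)
  qed
qed

lemma Im_cosymp_signed:
  assumes "\<tau> \<in> signed_trajs \<epsilon>"
  shows "Im_cosymp \<tau> = Tan \<tau>"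
proof -
  obtain \<gamma> where \<gamma>: "unit_over \<tau> \<gamma>"
    using unit_over_exists[OF assms] .
  show ?thesis
    using Im_cosymp_nonnull[OF unit_overD(1,3)[OF \<gamma>]] unfolding unit_overD(2)[OF \<gamma>] .
qed

lemma nondegenerate_nonnull:
  assumes "\<tau> \<in> signed_trajs \<epsilon>"
  shows "nondegenerate_at \<tau>"
proof -
  obtain \<gamma> where \<gamma>: "unit_over \<tau> \<gamma>"
    using unit_over_exists[OF assms] .
  note g = unit_overD[OF \<gamma>]
  let ?r = "restrict (\<lambda>\<theta>. 1 *\<^sub>R pushed_inverse \<gamma> \<theta>) (Cotan \<tau>)"
  have "?r \<in> cosymp \<tau>"
    using mem_cosympI[OF g(1) zero_less_one] unfolding g(2) .
  moreover have "bij_betw ?r (Cotan \<tau>) (Tan \<tau>)"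
  proof (rule bij_betwI[where g = "reduced_form {\<tau>} \<tau>"])
    show "?r \<in> Cotan \<tau> \<rightarrow> Tan \<tau>"
      using D_traj_in_Tan[OF g(1)] unfolding g(2) by (auto simp: pushed_inverse_def)
    show "reduced_form {\<tau>} \<tau> \<in> Tan \<tau> \<rightarrow> Cotan \<tau>"
      using reduced_form_in_Cotan[OF \<gamma>] by blast
    show "reduced_form {\<tau>} \<tau> (?r \<theta>) = \<theta>" if "\<theta> \<in> Cotan \<tau>" for \<theta>
      using that reduced_form_pushed_inverse[OF \<gamma> _ that] by simp
    show "?r (reduced_form {\<tau>} \<tau> u) = u" if "u \<in> Tan \<tau>" for u
      using reduced_form_in_Cotan[OF \<gamma> _ that] pushed_inverse_reduced_form[OF \<gamma> _ that] by simp
  qed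
  ultimately show ?thesis
    unfolding nondegenerate_at_def by blast
qed

subsection \<open>Unit sections\<close>

lemma open_signed_phase: "open {\<gamma> \<in> G_curv. 0 < \<epsilon> * mink (snd \<gamma>) (snd \<gamma>)}"
proof -
  have "open {\<gamma>::phase. 0 < \<epsilon> * mink (snd \<gamma>) (snd \<gamma>)}"
    unfolding mink_def by (intro open_Collect_less continuous_intros)
  then show ?thesis
    using open_Int[OF open_G_curv] unfolding Collect_conj_eq Collect_mem_eq by blast
qed

lemma signed_chart_image:
  assumes c: "c \<in> traj_atlas" and s: "local_section G_curv traj_of c s"
  shows "snd c ` (fst c \<inter> signed_trajs \<epsilon>) =
    snd c ` fst c \<inter> s -` {\<gamma> \<in> G_curv. 0 < \<epsilon> * mink (snd \<gamma>) (snd \<gamma>)}"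
proof -
  have "s (snd c q) \<in> {\<gamma> \<in> G_curv. 0 < \<epsilon> * mink (snd \<gamma>) (snd \<gamma>)} \<longleftrightarrow> q \<in> signed_trajs \<epsilon>" if "q \<in> fst c" for q
    using local_sectionD(2,3)[OF s that] traj_of_in_signed_trajs[of "s (snd c q)" \<epsilon>] by simp
  then show ?thesis by blast
qed

lemma open_signed_chart_image:
  assumes c: "c \<in> traj_atlas"
  shows "open (snd c ` (fst c \<inter> signed_trajs \<epsilon>))"
proof -
  obtain s where s: "local_section G_curv traj_of c s"
    using quotient_atlasD(6) c unfolding traj_atlas_def by blast
  show ?thesis
    unfolding signed_chart_image[OF c s]
    using open_overlap[OF c[unfolded traj_atlas_def] s open_signed_phase] by blast
qed

lemma open_submanifold_signed: "open_submanifold traj_atlas (signed_trajs \<epsilon>)"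
  unfolding open_submanifold_def
proof
  show "signed_trajs \<epsilon> \<subseteq> \<Union> (fst ` traj_atlas)"
  proof
    fix q assume "q \<in> signed_trajs \<epsilon>"
    then obtain \<gamma> where "\<gamma> \<in> G_curv" "q = traj_of \<gamma>"
      unfolding signed_trajs_def by blast
    then show "q \<in> \<Union> (fst ` traj_atlas)"
      using traj_chart_exists by blast
  qed
  show "\<forall>(U, \<phi>)\<in>traj_atlas. open (\<phi> ` (U \<inter> signed_trajs \<epsilon>))"
    using open_signed_chart_image by fastforce
qed

text \<open>The atlas is closed under restriction of charts, so unit sections, which exist only over trajectories
  of the given sign, are again local sections of charts.\<close>

lemma restricted_chart:
  assumes c: "c \<in> traj_atlas"
  shows "(fst c \<inter> signed_trajs \<epsilon>, snd c) \<in> traj_atlas"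
proof -
  note cA = c[unfolded traj_atlas_def]
  obtain s where s: "local_section G_curv traj_of c s"
    using quotient_atlasD(6)[OF cA] by blast
  have pre: "G_curv \<inter> traj_of -` (fst c \<inter> signed_trajs \<epsilon>) =
      (G_curv \<inter> traj_of -` fst c) \<inter> {\<gamma> \<in> G_curv. 0 < \<epsilon> * mink (snd \<gamma>) (snd \<gamma>)}"
    using traj_of_in_signed_trajs by blast
  have "open (G_curv \<inter> traj_of -` (fst c \<inter> signed_trajs \<epsilon>))"
    unfolding pre by (rule open_Int[OF quotient_atlasD(2)[OF cA] open_signed_phase])
  moreover have "smooth_on (G_curv \<inter> traj_of -` (fst c \<inter> signed_trajs \<epsilon>)) (snd c \<circ> traj_of)"
    by (rule smooth_on_subset[OF quotient_atlasD(5)[OF cA]]) blast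
  moreover have "smooth_on (snd c ` (fst c \<inter> signed_trajs \<epsilon>)) s"
    by (rule smooth_on_subset[OF local_sectionD(1)[OF s]]) blast
  moreover have "inj_on (snd c) (fst c \<inter> signed_trajs \<epsilon>)"
    by (rule inj_on_subset[OF quotient_atlasD(3)[OF cA]]) blast
  moreover have "fst c \<inter> signed_trajs \<epsilon> \<subseteq> traj_of ` G_curv"
    using quotient_atlasD(1)[OF cA] by blast
  ultimately show ?thesis
    unfolding traj_atlas_def quotient_atlas_def mem_Collect_eq prod.case
    using open_signed_chart_image[OF c] local_sectionD(2,3)[OF s] by blast
qed

lemma unit_section_exists:
  assumes c: "c \<in> traj_atlas" and \<epsilon>: "\<bar>\<epsilon>\<bar> = 1"
  obtains s where "local_section G_curv traj_of (fst c \<inter> signed_trajs \<epsilon>, snd c) s"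
    "\<forall>q\<in>fst c \<inter> signed_trajs \<epsilon>. mink (snd (s (snd c q))) (snd (s (snd c q))) = \<epsilon>"
proof -
  obtain s where s: "local_section G_curv traj_of c s"
    using quotient_atlasD(6) c unfolding traj_atlas_def by blast
  let ?S = "snd c ` (fst c \<inter> signed_trajs \<epsilon>)"
  have S: "open ?S"
    by (rule open_signed_chart_image[OF c])
  have pos: "0 < \<epsilon> * mink (snd (s (snd c q))) (snd (s (snd c q)))" if "q \<in> fst c \<inter> signed_trajs \<epsilon>" for q
    using traj_of_in_signed_trajs[of "s (snd c q)" \<epsilon>] local_sectionD(2,3)[OF s, of q] that by simp
  have sm: "smooth_on ?S s"
    by (rule smooth_on_subset[OF local_sectionD(1)[OF s]]) blast
  have "smooth_on ?S (\<lambda>x. (fst (s x), (\<epsilon> * mink (snd (s x)) (snd (s x))) powr (- 1 / 2) *\<^sub>R snd (s x)))"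
    by (rule smooth_on_Pair[OF S smooth_on_fst[OF S sm] smooth_on_scaleR[OF S smooth_on_powr[OF S
          smooth_on_mult[OF S smooth_on_const smooth_on_bounded_bilinear[OF bounded_bilinear_mink S
            smooth_on_snd[OF S sm] smooth_on_snd[OF S sm]]]] smooth_on_snd[OF S sm]]])
      (use pos in blast)
  then have smooth: "smooth_on ?S (\<lambda>x. unit_rescale (s x))"
  proof (rule smooth_on_cong_open[OF S])
    fix x assume "x \<in> ?S"
    then have "0 < \<epsilon> * mink (snd (s x)) (snd (s x))"
      using pos by blast
    then have "\<bar>mink (snd (s x)) (snd (s x))\<bar> = \<epsilon> * mink (snd (s x)) (snd (s x))"
      using \<epsilon> by (metis abs_mult abs_of_pos mult_1)
    then show "(fst (s x), (\<epsilon> * mink (snd (s x)) (snd (s x))) powr (- 1 / 2) *\<^sub>R snd (s x)) = unit_rescale (s x)"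
      by (simp add: unit_rescale_def aff_act_def)
  qed
  show ?thesis
  proof (rule that)
    have ne: "mink (snd (s (snd c q))) (snd (s (snd c q))) \<noteq> 0" if "q \<in> fst c \<inter> signed_trajs \<epsilon>" for q
      using pos[OF that] by auto
    show "local_section G_curv traj_of (fst c \<inter> signed_trajs \<epsilon>, snd c) (\<lambda>x. unit_rescale (s x))"
      unfolding local_section_def fst_conv snd_conv
    proof (intro conjI ballI)
      fix q assume q: "q \<in> fst c \<inter> signed_trajs \<epsilon>"
      show "unit_rescale (s (snd c q)) \<in> G_curv"
        by (rule unit_rescale(3)[OF ne[OF q]])
      show "traj_of (unit_rescale (s (snd c q))) = q"
        using unit_rescale(2)[OF ne[OF q]] local_sectionD(3)[OF s] q by simp
    qed (rule smooth)
    show "\<forall>q\<in>fst c \<inter> signed_trajs \<epsilon>.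
        mink (snd (unit_rescale (s (snd c q)))) (snd (unit_rescale (s (snd c q)))) = \<epsilon>"
    proof
      fix q assume q: "q \<in> fst c \<inter> signed_trajs \<epsilon>"
      show "mink (snd (unit_rescale (s (snd c q)))) (snd (unit_rescale (s (snd c q)))) = \<epsilon>"
        using unit_rescale(1)[OF ne[OF q]] pos[OF q] \<epsilon>
        by (auto simp: sgn_real_def abs_if zero_less_mult_iff split: if_splits)
    qed
  qed
qed

text \<open>The velocities of a unit section are automatically level lifts, since \<open>g(V, V)\<close> is constant along it.\<close>

lemma unit_section_coordinates:
  assumes c: "c \<in> traj_atlas" and \<epsilon>: "\<bar>\<epsilon>\<bar> = 1"
    and s: "local_section G_curv traj_of (fst c \<inter> signed_trajs \<epsilon>, snd c) s"
    and unit: "\<forall>q\<in>fst c \<inter> signed_trajs \<epsilon>. mink (snd (s (snd c q))) (snd (s (snd c q))) = \<epsilon>"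
    and q: "q \<in> fst c \<inter> signed_trajs \<epsilon>"
  shows "unit_over q (s (snd c q))"
    and "coord_vector traj_atlas c q w = D_traj (s (snd c q)) (frechet_derivative s (at (snd c q)) w)"
    and "mink (snd (s (snd c q))) (snd (frechet_derivative s (at (snd c q)) w)) = 0"
proof -
  let ?c = "(fst c \<inter> signed_trajs \<epsilon>, snd c)" and ?x = "snd c q"
  let ?v = "D_traj (s ?x) (frechet_derivative s (at ?x) w)"
  have c': "?c \<in> quotient_atlas G_curv traj_of"
    using restricted_chart[OF c] by (simp add: traj_atlas_def)
  have q': "q \<in> fst ?c" using q by simp
  have g: "s ?x \<in> G_curv" "traj_of (s ?x) = q"
    using local_sectionD(2,3)[OF s q'] by simp_all
  show "unit_over q (s ?x)"
    using g unit q \<epsilon> by (simp add: unit_over_def)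
  have at: "c \<in> charts_at traj_atlas q" "?c \<in> charts_at traj_atlas q"
    using c restricted_chart[OF c] q by (simp_all add: charts_at_def)
  have "?v c = ?v ?c"
    using at g(2) by (simp add: push_tangent_def)
  also have "\<dots> = w"
    using push_tangent_coordinate[OF c' s q'] by (simp add: traj_atlas_def)
  finally have w: "?v c = w" .
  have "?v \<in> Tan q"
    using D_traj_in_Tan[OF g(1)] g(2) by metis
  from tangent_eq_coord_vector[OF this at(1)] show "coord_vector traj_atlas c q w = ?v"
    unfolding w by (rule sym)
  let ?S = "snd c ` (fst c \<inter> signed_trajs \<epsilon>)"
  have S: "open ?S" "?x \<in> ?S"
    using open_signed_chart_image[OF c] q by blast+
  have "(s has_derivative frechet_derivative s (at ?x)) (at ?x)"
    using local_section_has_derivative[OF c' s q'] by simp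
  then have D: "((\<lambda>x. snd (s x)) has_derivative (\<lambda>w. snd (frechet_derivative s (at ?x) w))) (at ?x)"
    by (rule has_derivative_snd)
  have "((\<lambda>x. mink (snd (s x)) (snd (s x))) has_derivative
      (\<lambda>w. mink (snd (s ?x)) (snd (frechet_derivative s (at ?x) w)) +
        mink (snd (frechet_derivative s (at ?x) w)) (snd (s ?x)))) (at ?x)"
    by (rule bounded_bilinear.FDERIV[OF bounded_bilinear_mink D D])
  moreover have "((\<lambda>x. mink (snd (s x)) (snd (s x))) has_derivative (\<lambda>w. 0)) (at ?x)"
    by (rule has_derivative_transform_within_open[OF has_derivative_const[of \<epsilon>] S])
      (use unit in auto)
  ultimately have "(\<lambda>w. mink (snd (s ?x)) (snd (frechet_derivative s (at ?x) w)) +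
        mink (snd (frechet_derivative s (at ?x) w)) (snd (s ?x))) = (\<lambda>w. 0)"
    by (rule has_derivative_unique)
  from fun_cong[OF this, of w] show "mink (snd (s ?x)) (snd (frechet_derivative s (at ?x) w)) = 0"
    by (simp add: mink_sym[of _ "snd (s ?x)"])
qed

lemma coord_form_reduced:
  assumes c: "c \<in> traj_atlas" and \<epsilon>: "\<bar>\<epsilon>\<bar> = 1"
    and s: "local_section G_curv traj_of (fst c \<inter> signed_trajs \<epsilon>, snd c) s"
    and unit: "\<forall>q\<in>fst c \<inter> signed_trajs \<epsilon>. mink (snd (s (snd c q))) (snd (s (snd c q))) = \<epsilon>"
    and x: "x \<in> snd c ` (fst c \<inter> signed_trajs \<epsilon>)"
  shows "coord_form traj_atlas (reduced_form (signed_trajs \<epsilon>)) c x [w, w'] =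
    omega 0 (frechet_derivative s (at x) w) (frechet_derivative s (at x) w')"
proof -
  obtain q where q: "q \<in> fst c \<inter> signed_trajs \<epsilon>" "x = snd c q"
    using x by blast
  have "inv_into (fst c) (snd c) x = q"
    unfolding q(2) by (rule inv_into_f_f[OF quotient_atlasD(3)[OF c[unfolded traj_atlas_def]]]) (use q in simp)
  then show ?thesis
    using unit_section_coordinates[OF c \<epsilon> s unit q(1)] q
    by (simp add: coord_form_def reduced_form_eq[where \<gamma>' = 0])
qed

lemma bounded_bilinear_omega: "bounded_bilinear (omega \<gamma>)"
  by (rule bilinear_conv_bounded_bilinear[THEN iffD1]) (unfold bilinear_def, intro conjI allI linearI; simp)

text \<open>Closedness: in a chart the form is \<open>omega (Ds w) (Ds w')\<close> for a unit section \<open>s\<close>. Its exterior derivative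
  consists of six terms with second derivatives of \<open>s\<close>, which cancel in pairs by symmetry of second derivatives
  and antisymmetry of \<open>omega\<close>.\<close>

lemma symplectic_reduced_form:
  assumes \<epsilon>: "\<bar>\<epsilon>\<bar> = 1"
  shows "symplectic_form traj_atlas (signed_trajs \<epsilon>) (reduced_form (signed_trajs \<epsilon>))"
  unfolding symplectic_form_def smooth_two_form_def
proof (intro conjI ballI allI impI)
  let ?W = "signed_trajs \<epsilon>"
  let ?\<beta> = "reduced_form ?W"
  show "?\<beta> \<tau> u v = 0" if "\<not> (\<tau> \<in> ?W \<and> u \<in> Tan \<tau> \<and> v \<in> Tan \<tau>)" for \<tau> u v
    using that by (rule reduced_form_zero)
  show "linear_form_on (Tan \<tau>) (?\<beta> \<tau> u)" if "\<tau> \<in> ?W" "u \<in> Tan \<tau>" for \<tau> u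
    using unit_over_exists[OF that(1)] reduced_form_linear that by metis
  show "?\<beta> \<tau> u v = - ?\<beta> \<tau> v u" if "\<tau> \<in> ?W" "u \<in> Tan \<tau>" "v \<in> Tan \<tau>" for \<tau> u v
    using unit_over_exists[OF that(1)] reduced_form_antisym[OF _ that] by metis
  show "u = 0" if \<tau>: "\<tau> \<in> ?W" and u: "u \<in> Tan \<tau>" and 0: "\<forall>v\<in>Tan \<tau>. ?\<beta> \<tau> u v = 0" for \<tau> u
  proof -
    obtain \<gamma> where \<gamma>: "unit_over \<tau> \<gamma>"
      using unit_over_exists[OF \<tau>] .
    have z: "?\<beta> \<tau> u v = 0" for v
      using 0 reduced_form_zero[of \<tau> ?W u v] by blast
    have "pushed_inverse \<gamma> (?\<beta> \<tau> u) = D_traj \<gamma> 0"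
      by (rule pushed_inverse_eq) (simp add: z omega_def)
    then show ?thesis
      using pushed_inverse_reduced_form[OF \<gamma> \<tau> u] linear_0[OF D_traj_linear[OF unit_overD(1)[OF \<gamma>]]]
      by simp
  qed
  fix c :: "(phase set, model) chart" assume c: "c \<in> traj_atlas"
  let ?S = "snd c ` (fst c \<inter> ?W)"
  obtain s where s: "local_section G_curv traj_of (fst c \<inter> ?W, snd c) s"
    and unit: "\<forall>q\<in>fst c \<inter> ?W. mink (snd (s (snd c q))) (snd (s (snd c q))) = \<epsilon>"
    using unit_section_exists[OF c \<epsilon>] .
  have S: "open ?S" by (rule open_signed_chart_image[OF c])
  have sm: "smooth_on ?S s"
    using local_sectionD(1)[OF s] by simp
  let ?D = "\<lambda>w x. frechet_derivative s (at x) w"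
  have form: "coord_form traj_atlas ?\<beta> c x [w, w'] = omega 0 (?D w x) (?D w' x)" if "x \<in> ?S" for x w w'
    by (rule coord_form_reduced[OF c \<epsilon> s unit that])
  show "smooth_on ?S (\<lambda>x. coord_form traj_atlas ?\<beta> c x [w, w'])" for w w'
  proof (rule smooth_on_cong_open[OF S])
    show "smooth_on ?S (\<lambda>x. omega 0 (?D w x) (?D w' x))"
      by (rule smooth_on_bounded_bilinear[OF bounded_bilinear_omega S smooth_on_frechet_derivative[OF sm]
            smooth_on_frechet_derivative[OF sm]])
  qed (simp add: form)
  fix x w1 w2 w3 assume x: "x \<in> ?S"
  let ?H = "\<lambda>w h. frechet_derivative (?D w) (at x) h"
  have D: "frechet_derivative (\<lambda>y. coord_form traj_atlas ?\<beta> c y [w, w']) (at x) h =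
      omega 0 (?D w x) (?H w' h) + omega 0 (?H w h) (?D w' x)" for w w' h
  proof -
    have 1: "((\<lambda>y. omega 0 (?D w y) (?D w' y)) has_derivative
        (\<lambda>h. omega 0 (?D w x) (?H w' h) + omega 0 (?H w h) (?D w' x))) (at x)"
      by (rule bounded_bilinear.FDERIV[OF bounded_bilinear_omega
            smooth_on_imp_has_derivative[OF smooth_on_frechet_derivative[OF sm] x]
            smooth_on_imp_has_derivative[OF smooth_on_frechet_derivative[OF sm] x]])
    have "((\<lambda>y. coord_form traj_atlas ?\<beta> c y [w, w']) has_derivative
        (\<lambda>h. omega 0 (?D w x) (?H w' h) + omega 0 (?H w h) (?D w' x))) (at x)"
      by (rule has_derivative_transform_within_open[OF 1 S x]) (simp add: form)
    from fun_cong[OF frechet_derivative_at[OF this], of h] show ?thesis by simp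
  qed
  have H: "?H w h = ?H h w" for w h
    by (rule second_derivative_symmetric[OF S sm x])
  have "ext_deriv (coord_form traj_atlas ?\<beta> c) x [w1, w2, w3] =
      frechet_derivative (\<lambda>y. coord_form traj_atlas ?\<beta> c y [w2, w3]) (at x) w1 -
      frechet_derivative (\<lambda>y. coord_form traj_atlas ?\<beta> c y [w1, w3]) (at x) w2 +
      frechet_derivative (\<lambda>y. coord_form traj_atlas ?\<beta> c y [w1, w2]) (at x) w3"
    by (simp add: ext_deriv_def lessThan_Suc)
  also have "\<dots> = 0"
    unfolding D H[of w2 w1] H[of w3 w1] H[of w3 w2]
    by (simp add: omega_antisym[of 0 "?H w1 w2"] omega_antisym[of 0 "?H w1 w3"] omega_antisym[of 0 "?H w2 w3"])
  finally show "ext_deriv (coord_form traj_atlas ?\<beta> c) x [w1, w2, w3] = 0" .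
qed

subsection \<open>Inverse forms\<close>

lemma scaled_covector:
  assumes "\<theta> \<in> Cotan \<tau>"
  shows "(\<lambda>v. k * \<theta> v) \<in> Cotan \<tau>"
  using assms by (simp add: cotangent_space_def linear_form_on_def algebra_simps)

lemma pushed_inverse_scale:
  assumes \<gamma>: "\<gamma> \<in> G_curv" and \<theta>: "\<theta> \<in> Cotan (traj_of \<gamma>)"
  shows "pushed_inverse \<gamma> (\<lambda>v. k * \<theta> v) = k *\<^sub>R pushed_inverse \<gamma> \<theta>"
proof -
  obtain \<delta> where \<delta>: "\<And>\<eta>. omega \<gamma> \<delta> \<eta> = \<theta> (D_traj \<gamma> \<eta>)"
    using covector_lift[OF \<gamma> \<theta>] by blast
  have "pushed_inverse \<gamma> (\<lambda>v. k * \<theta> v) = D_traj \<gamma> (k *\<^sub>R \<delta>)"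
    by (rule pushed_inverse_eq) (simp add: \<delta>)
  then show ?thesis
    by (simp add: linear_scale[OF D_traj_linear[OF \<gamma>]] pushed_inverse_eq[OF \<delta>])
qed

lemma coord_form_scale:
  "coord_form A (\<lambda>q u v. f q * \<beta> q u v) c x ws = f (inv_into (fst c) (snd c) x) * coord_form A \<beta> c x ws"
  by (simp add: coord_form_def Let_def)

lemma conformal_class_subset_inverse_forms:
  assumes \<epsilon>: "\<bar>\<epsilon>\<bar> = 1"
  shows "conformal_class traj_atlas (signed_trajs \<epsilon>) (reduced_form (signed_trajs \<epsilon>)) \<subseteq> inverse_forms (signed_trajs \<epsilon>)"
proof
  let ?W = "signed_trajs \<epsilon>"
  let ?\<beta> = "reduced_form ?W"
  fix \<beta>' assume "\<beta>' \<in> conformal_class traj_atlas ?W ?\<beta>"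
  then obtain f where \<beta>': "\<beta>' = (\<lambda>q u v. f q * ?\<beta> q u v)" and f: "smooth_function traj_atlas ?W f"
    and pos: "\<And>q. q \<in> ?W \<Longrightarrow> 0 < f q"
    unfolding conformal_class_def by blast
  have form: "smooth_two_form traj_atlas ?W ?\<beta>"
    using symplectic_reduced_form[OF \<epsilon>] by (simp add: symplectic_form_def)
  have "smooth_two_form traj_atlas ?W \<beta>'"
    unfolding smooth_two_form_def
  proof (intro conjI ballI allI impI)
    show "\<beta>' \<tau> u v = 0" if "\<not> (\<tau> \<in> ?W \<and> u \<in> Tan \<tau> \<and> v \<in> Tan \<tau>)" for \<tau> u v
      unfolding \<beta>' using reduced_form_zero[OF that] by simp
    fix \<tau> u assume \<tau>: "\<tau> \<in> ?W" "u \<in> Tan \<tau>"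
    obtain \<gamma> where \<gamma>: "unit_over \<tau> \<gamma>"
      using unit_over_exists[OF \<tau>(1)] .
    show "linear_form_on (Tan \<tau>) (\<beta>' \<tau> u)"
      using scaled_covector[OF reduced_form_in_Cotan[OF \<gamma> \<tau>], of "f \<tau>"] by (simp add: \<beta>' cotangent_space_def)
    show "\<beta>' \<tau> u v = - \<beta>' \<tau> v u" if "v \<in> Tan \<tau>" for v
      unfolding \<beta>' using reduced_form_antisym[OF \<gamma> \<tau> that] by simp
  next
    fix c :: "(phase set, model) chart" and w w' assume c: "c \<in> traj_atlas"
    have S: "open (snd c ` (fst c \<inter> ?W))" by (rule open_signed_chart_image[OF c])
    have 1: "smooth_on (snd c ` (fst c \<inter> ?W)) (\<lambda>x. f (inv_into (fst c) (snd c) x))"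
      using f c by (auto simp: smooth_function_def o_def split: prod.splits)
    have 2: "smooth_on (snd c ` (fst c \<inter> ?W)) (\<lambda>x. coord_form traj_atlas ?\<beta> c x [w, w'])"
      using form c unfolding smooth_two_form_def by blast
    show "smooth_on (snd c ` (fst c \<inter> ?W)) (\<lambda>x. coord_form traj_atlas \<beta>' c x [w, w'])"
      unfolding \<beta>' coord_form_scale by (rule smooth_on_mult[OF S 1 2])
  qed
  moreover have "\<exists>r\<in>cosymp \<tau>. (\<forall>v\<in>Tan \<tau>. r (\<beta>' \<tau> v) = v) \<and> (\<forall>\<theta>\<in>Cotan \<tau>. \<beta>' \<tau> (r \<theta>) = \<theta>)" if \<tau>: "\<tau> \<in> ?W" for \<tau>
  proof -
    obtain \<gamma> where \<gamma>: "unit_over \<tau> \<gamma>"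
      using unit_over_exists[OF \<tau>] .
    note g = unit_overD[OF \<gamma>]
    have k: "0 < 1 / f \<tau>" using pos[OF \<tau>] by simp
    let ?r = "restrict (\<lambda>\<theta>. (1 / f \<tau>) *\<^sub>R pushed_inverse \<gamma> \<theta>) (Cotan \<tau>)"
    have "?r \<in> cosymp \<tau>"
      using mem_cosympI[OF g(1) k] unfolding g(2) .
    moreover have "?r (\<beta>' \<tau> v) = v" if v: "v \<in> Tan \<tau>" for v
    proof -
      have \<theta>: "?\<beta> \<tau> v \<in> Cotan \<tau>"
        by (rule reduced_form_in_Cotan[OF \<gamma> \<tau> v])
      have "\<beta>' \<tau> v = (\<lambda>u. f \<tau> * ?\<beta> \<tau> v u)"
        by (simp add: \<beta>')
      then show ?thesis
        using scaled_covector[OF \<theta>, of "f \<tau>"] pushed_inverse_scale[OF g(1), of "?\<beta> \<tau> v" "f \<tau>"] \<theta> k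
          pushed_inverse_reduced_form[OF \<gamma> \<tau> v] g(2) by simp
    qed
    moreover have "\<beta>' \<tau> (?r \<theta>) = \<theta>" if \<theta>: "\<theta> \<in> Cotan \<tau>" for \<theta>
    proof -
      have "?r \<theta> = pushed_inverse \<gamma> (\<lambda>v. (1 / f \<tau>) * \<theta> v)"
        using pushed_inverse_scale[OF g(1), of \<theta> "1 / f \<tau>"] \<theta> g(2) by simp
      then have "?\<beta> \<tau> (?r \<theta>) = (\<lambda>v. (1 / f \<tau>) * \<theta> v)"
        using reduced_form_pushed_inverse[OF \<gamma> \<tau> scaled_covector[OF \<theta>], of "1 / f \<tau>"] by (simp only:)
      then show ?thesis
        using k by (simp add: \<beta>')
    qed
    ultimately show ?thesis by blast
  qed
  ultimately show "\<beta>' \<in> inverse_forms ?W"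
    unfolding inverse_forms_def by blast
qed

lemma inverse_forms_pointwise:
  assumes \<beta>': "\<beta>' \<in> inverse_forms W" and \<tau>: "\<tau> \<in> W" and \<gamma>: "unit_over \<tau> \<gamma>"
  obtains k where "0 < k" "\<And>u v. \<beta>' \<tau> u v = k * reduced_form W \<tau> u v"
proof -
  note g = unit_overD[OF \<gamma>]
  have form: "smooth_two_form traj_atlas W \<beta>'"
    using \<beta>' by (simp add: inverse_forms_def)
  obtain r where r: "r \<in> cosymp \<tau>" "\<And>v. v \<in> Tan \<tau> \<Longrightarrow> r (\<beta>' \<tau> v) = v"
    using \<beta>' \<tau> unfolding inverse_forms_def by blast
  obtain k where k: "0 < k" "\<And>\<theta>. \<theta> \<in> Cotan \<tau> \<Longrightarrow> r \<theta> = k *\<^sub>R pushed_inverse \<gamma> \<theta>"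
    using mem_cosympE[OF g(1)] r(1) unfolding g(2) by metis
  have zero: "\<beta>' \<tau> u v = 0" if "\<not> (u \<in> Tan \<tau> \<and> v \<in> Tan \<tau>)" for u v
    using form that unfolding smooth_two_form_def by blast
  have "\<beta>' \<tau> u v = (1 / k) * reduced_form W \<tau> u v" for u v
  proof (cases "u \<in> Tan \<tau>")
    case True
    have \<theta>: "\<beta>' \<tau> u \<in> Cotan \<tau>"
      using form True \<tau> zero unfolding smooth_two_form_def cotangent_space_def by blast
    have "u = pushed_inverse \<gamma> (\<lambda>v. k * \<beta>' \<tau> u v)"
      using r(2)[OF True] k(2)[OF \<theta>] pushed_inverse_scale[OF g(1), of "\<beta>' \<tau> u" k] \<theta> g(2) by simp
    then have "reduced_form W \<tau> u = (\<lambda>v. k * \<beta>' \<tau> u v)"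
      using reduced_form_pushed_inverse[OF \<gamma> \<tau> scaled_covector[OF \<theta>], of k] by simp
    then show ?thesis
      using k(1) by simp
  next
    case False
    then show ?thesis
      using zero[of u v] reduced_form_zero[of \<tau> W u v] by simp
  qed
  then show ?thesis
    using that[of "1 / k"] k(1) by simp
qed

lemma coord_form_reduced_nonzero:
  assumes \<epsilon>: "\<bar>\<epsilon>\<bar> = 1" and c: "c \<in> traj_atlas" and x: "x \<in> snd c ` (fst c \<inter> signed_trajs \<epsilon>)"
  obtains b b' where "b \<in> Basis" "b' \<in> Basis" "coord_form traj_atlas (reduced_form (signed_trajs \<epsilon>)) c x [b, b'] \<noteq> 0"
proof (rule ccontr)
  let ?W = "signed_trajs \<epsilon>"
  let ?\<beta> = "reduced_form ?W"
  assume "\<not> thesis"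
  with that have zero: "coord_form traj_atlas ?\<beta> c x [b, b'] = 0" if "b \<in> Basis" "b' \<in> Basis" for b b'
    using that by blast
  obtain s where s: "local_section G_curv traj_of (fst c \<inter> ?W, snd c) s"
    and unit: "\<forall>q\<in>fst c \<inter> ?W. mink (snd (s (snd c q))) (snd (s (snd c q))) = \<epsilon>"
    using unit_section_exists[OF c \<epsilon>] .
  let ?D = "frechet_derivative s (at x)"
  obtain q where q: "q \<in> fst c \<inter> ?W" "x = snd c q"
    using x by blast
  note uc = unit_section_coordinates[OF c \<epsilon> s unit q(1), folded q(2)]
  have "(s has_derivative ?D) (at x)"
    using local_section_has_derivative[OF restricted_chart[OF c, unfolded traj_atlas_def] s] q by simp
  then have lin: "linear ?D"
    by (rule has_derivative_linear)
  have 0: "omega 0 (?D b) (?D b') = 0" if "b \<in> Basis" "b' \<in> Basis" for b b'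
    using zero[OF that] coord_form_reduced[OF c \<epsilon> s unit x] by simp
  have 1: "omega 0 (?D b) (?D w) = 0" if b: "b \<in> Basis" for b w
  proof -
    have "linear (\<lambda>w. omega 0 (?D b) (?D w))"
      by (rule linearI) (simp_all add: linear_add[OF lin] linear_scale[OF lin])
    moreover have "linear (\<lambda>w::model. 0::real)"
      by (rule linearI) simp_all
    ultimately have "(\<lambda>w. omega 0 (?D b) (?D w)) = (\<lambda>w. 0)"
      by (rule linear_eq_stdbasis) (rule 0[OF b])
    then show ?thesis
      by (rule fun_cong)
  qed
  obtain b :: model where b: "b \<in> Basis"
    using nonempty_Basis by blast
  let ?u = "coord_vector traj_atlas c q b"
  have at: "c \<in> charts_at traj_atlas q"
    using c q by (simp add: charts_at_def)
  have T: "coord_vector traj_atlas c q w \<in> Tan q" for w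
    using D_traj_in_Tan[OF unit_overD(1)[OF uc(1)]] unfolding uc(2) unit_overD(2)[OF uc(1)] .
  have "?\<beta> q ?u v = 0" if v: "v \<in> Tan q" for v
  proof -
    have v': "v = coord_vector traj_atlas c q (v c)"
      by (rule tangent_eq_coord_vector[OF v at])
    have "?\<beta> q (D_traj (s x) (?D b)) (D_traj (s x) (?D (v c))) = omega 0 (?D b) (?D (v c))"
      by (rule reduced_form_eq[OF uc(1) _ uc(3) uc(3)]) (use q in simp)
    also have "\<dots> = 0"
      by (rule 1[OF b])
    finally show ?thesis
      unfolding uc(2)[symmetric] v'[symmetric] .
  qed
  then have "?u = 0"
    using symplectic_reduced_form[OF \<epsilon>] q(1) T unfolding symplectic_form_def by blast
  then have "?u c = 0" by simp
  moreover have "?u c = b"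
  proof -
    have "(fst c \<inter> ?W, snd c) \<in> charts_at traj_atlas q"
      using restricted_chart[OF c] q by (simp add: charts_at_def)
    then have "?u c = ?u (fst c \<inter> ?W, snd c)"
      using at unit_overD(2)[OF uc(1)] unfolding uc(2) by (simp add: push_tangent_def)
    also have "\<dots> = b"
      unfolding uc(2) using push_tangent_coordinate[OF restricted_chart[OF c, unfolded traj_atlas_def] s, of q b] q
      by (simp add: traj_atlas_def)
    finally show ?thesis .
  qed
  ultimately show False
    using b by simp
qed

text \<open>The pointwise factor \<open>f\<close> in \<open>\<beta>' = f \<beta>\<close> is smooth because in a chart it equals
  \<open>\<langle>\<beta>', \<beta>\<rangle> / \<langle>\<beta>, \<beta>\<rangle>\<close> for the Euclidean product of coefficients, and \<open>\<beta>\<close> has a nonzero coefficient everywhere.\<close>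

lemma inverse_forms_subset_conformal_class:
  assumes \<epsilon>: "\<bar>\<epsilon>\<bar> = 1"
  shows "inverse_forms (signed_trajs \<epsilon>) \<subseteq> conformal_class traj_atlas (signed_trajs \<epsilon>) (reduced_form (signed_trajs \<epsilon>))"
proof
  let ?W = "signed_trajs \<epsilon>"
  let ?\<beta> = "reduced_form ?W"
  fix \<beta>' assume \<beta>': "\<beta>' \<in> inverse_forms ?W"
  have "\<exists>k. 0 < k \<and> (\<forall>u v. \<beta>' \<tau> u v = k * ?\<beta> \<tau> u v)" if "\<tau> \<in> ?W" for \<tau>
    using unit_over_exists[OF that] inverse_forms_pointwise[OF \<beta>' that] by metis
  then obtain f where f: "\<And>\<tau>. \<tau> \<in> ?W \<Longrightarrow> 0 < f \<tau>" "\<And>\<tau> u v. \<tau> \<in> ?W \<Longrightarrow> \<beta>' \<tau> u v = f \<tau> * ?\<beta> \<tau> u v"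
    by metis
  have form: "smooth_two_form traj_atlas ?W ?\<beta>" "smooth_two_form traj_atlas ?W \<beta>'"
    using symplectic_reduced_form[OF \<epsilon>] \<beta>' by (simp_all add: symplectic_form_def inverse_forms_def)
  have eq: "\<beta>' = (\<lambda>q u v. f q * ?\<beta> q u v)"
  proof (intro ext)
    fix q u v
    show "\<beta>' q u v = f q * ?\<beta> q u v"
    proof (cases "q \<in> ?W")
      case False
      then have "\<beta>' q u v = 0" "?\<beta> q u v = 0"
        using form unfolding smooth_two_form_def by blast+
      then show ?thesis by simp
    qed (rule f(2))
  qed
  have "smooth_on (snd c ` (fst c \<inter> ?W)) (\<lambda>x. f (inv_into (fst c) (snd c) x))" if c: "c \<in> traj_atlas" for c
  proof -
    let ?S = "snd c ` (fst c \<inter> ?W)"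
    let ?g = "\<lambda>x b b'. coord_form traj_atlas ?\<beta> c x [b, b']" and ?g' = "\<lambda>x b b'. coord_form traj_atlas \<beta>' c x [b, b']"
    have S: "open ?S" by (rule open_signed_chart_image[OF c])
    have sm: "smooth_on ?S (\<lambda>x. ?g x b b')" "smooth_on ?S (\<lambda>x. ?g' x b b')" for b b'
      using form c unfolding smooth_two_form_def by blast+
    have pos: "0 < (\<Sum>b\<in>Basis. \<Sum>b'\<in>Basis. ?g x b b' * ?g x b b')" if x: "x \<in> ?S" for x
    proof -
      obtain b b' where b: "b \<in> Basis" "b' \<in> Basis" "?g x b b' \<noteq> 0"
        using coord_form_reduced_nonzero[OF \<epsilon> c x] .
      have "0 < ?g x b b' * ?g x b b'"
        using b(3) by (metis not_real_square_gt_zero)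
      then have "0 < (\<Sum>b'\<in>Basis. ?g x b b' * ?g x b b')"
        by (rule sum_pos2[OF finite_Basis b(2)]) simp
      then show ?thesis
        by (rule sum_pos2[OF finite_Basis b(1)]) (intro sum_nonneg zero_le_square)
    qed
    have 1: "smooth_on ?S (\<lambda>x. \<Sum>b\<in>Basis. \<Sum>b'\<in>Basis. ?g' x b b' * ?g x b b')"
      by (rule smooth_on_sum[OF S finite_Basis smooth_on_sum[OF S finite_Basis smooth_on_mult[OF S sm(2) sm(1)]]])
    have 2: "smooth_on ?S (\<lambda>x. \<Sum>b\<in>Basis. \<Sum>b'\<in>Basis. ?g x b b' * ?g x b b')"
      by (rule smooth_on_sum[OF S finite_Basis smooth_on_sum[OF S finite_Basis smooth_on_mult[OF S sm(1) sm(1)]]])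
    show ?thesis
    proof (rule smooth_on_cong_open[OF S smooth_on_divide[OF S 1 2 pos]])
      fix x assume x: "x \<in> ?S"
      let ?f = "f (inv_into (fst c) (snd c) x)" and ?G = "\<Sum>b\<in>Basis. \<Sum>b'\<in>Basis. ?g x b b' * ?g x b b'"
      have "?g' x b b' = ?f * ?g x b b'" for b b'
        unfolding eq by (rule coord_form_scale)
      then have "(\<Sum>b\<in>Basis. \<Sum>b'\<in>Basis. ?g' x b b' * ?g x b b') = ?f * ?G"
        by (simp only: sum_distrib_left mult.assoc)
      then show "(\<Sum>b\<in>Basis. \<Sum>b'\<in>Basis. ?g' x b b' * ?g x b b') / ?G = ?f"
        using pos[OF x] by simp
    qed
  qed
  then have "smooth_function traj_atlas ?W f"
    by (auto simp: smooth_function_def o_def)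
  with f(1) eq show "\<beta>' \<in> conformal_class traj_atlas ?W ?\<beta>"
    unfolding conformal_class_def by blast
qed

lemma conformal_symplectic_inverse_forms:
  assumes "\<bar>\<epsilon>\<bar> = 1"
  shows "conformal_symplectic_class traj_atlas (signed_trajs \<epsilon>) (inverse_forms (signed_trajs \<epsilon>))"
  unfolding conformal_symplectic_class_def
  using symplectic_reduced_form[OF assms] conformal_class_subset_inverse_forms[OF assms]
    inverse_forms_subset_conformal_class[OF assms] by blast

section \<open>The contact structure\<close>

lemma sum_permutations_4:
  fixes g :: "nat \<Rightarrow> nat \<Rightarrow> nat \<Rightarrow> nat \<Rightarrow> real"
  assumes d: "a \<noteq> b" "a \<noteq> c" "a \<noteq> d" "b \<noteq> c" "b \<noteq> d" "c \<noteq> d"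
  shows "(\<Sum>\<pi> | \<pi> permutes {a, b, c, d}. of_int (sign \<pi>) * g (\<pi> a) (\<pi> b) (\<pi> c) (\<pi> d)) =
    g a b c d - g a b d c - g a c b d + g a c d b + g a d b c - g a d c b - g b a c d + g b a d c +
g b c a d - g b c d a - g b d a c + g b d c a + g c a b d - g c a d b - g c b a d + g c b d a +
g c d a b - g c d b a - g d a b c + g d a c b + g d b a c - g d b c a - g d c a b + g d c b a"
proof -
  have 1: "finite {b, c, d}" "a \<notin> {b, c, d}" and 2: "finite {c, d}" "b \<notin> {c, d}"
    and 3: "finite {d}" "c \<notin> {d}"
    using d by auto
  show ?thesis
    unfolding sum_over_permutations_insert[OF 1] sum_over_permutations_insert[OF 2]
      sum_over_permutations_insert[OF 3] permutes_sing
    using d d[symmetric]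
    by (simp add: sign_swap_id permutation_swap_id sign_compose sign_id permutation_compose
        Transposition.transpose_def)
qed

text \<open>The form \<open>dc + p da + q db\<close> in the coordinates \<open>(a, b, c, p, q)\<close>.\<close>

definition contact_form :: "(real^5) form" where
  "contact_form x ws = ws ! 0 $ 3 + x $ 4 * ws ! 0 $ 1 + x $ 5 * ws ! 0 $ 2"

definition contact_form_d :: "real^5 \<Rightarrow> real^5 \<Rightarrow> real" where
  "contact_form_d v w = v $ 4 * w $ 1 + v $ 5 * w $ 2 - w $ 4 * v $ 1 - w $ 5 * v $ 2"

lemma smooth_contact_form: "smooth_one_form S contact_form"
  unfolding smooth_one_form_def
proof (intro conjI ballI allI)
  show "linear (\<lambda>w. contact_form x [w])" for x
    by (rule linearI) (simp_all add: contact_form_def algebra_simps)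
  fix w :: "real^5"
  have n: "smooth_on UNIV (\<lambda>x::real^5. x $ i)" for i
    by (rule smooth_on_linear) (auto intro: linearI)
  have "smooth_on UNIV (\<lambda>x. contact_form x [w])"
    unfolding contact_form_def nth_Cons_0
    by (rule smooth_on_add[OF open_UNIV smooth_on_add[OF open_UNIV smooth_on_const
          smooth_on_mult[OF open_UNIV n smooth_on_const]] smooth_on_mult[OF open_UNIV n smooth_on_const]])
  then show "smooth_on S (\<lambda>x. contact_form x [w])"
    by (rule smooth_on_subset) simp
qed

lemma ext_deriv_contact_form: "ext_deriv contact_form x [v, w] = contact_form_d v w"
proof -
  have "frechet_derivative (\<lambda>y. contact_form y [u]) (at x) h = h $ 4 * u $ 1 + h $ 5 * u $ 2" for u h
  proof -
    have "linear (\<lambda>y. y $ 4 * u $ 1 + y $ 5 * u $ 2)"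
      by (rule linearI) (simp_all add: algebra_simps)
    then have "((\<lambda>y. y $ 4 * u $ 1 + y $ 5 * u $ 2) has_derivative (\<lambda>y. y $ 4 * u $ 1 + y $ 5 * u $ 2)) (at x)"
      by (rule linear_imp_has_derivative)
    from has_derivative_add[OF has_derivative_const[of "u $ 3"] this]
    have "((\<lambda>y. contact_form y [u]) has_derivative (\<lambda>h. 0 + (h $ 4 * u $ 1 + h $ 5 * u $ 2))) (at x)"
      by (simp add: contact_form_def add.assoc)
    from fun_cong[OF frechet_derivative_at[OF this], of h] show ?thesis by simp
  qed
  then show ?thesis
    by (simp add: ext_deriv_def lessThan_Suc contact_form_d_def)
qed

lemma wedge_power_1_contact_form:
  "wedge_power 2 (ext_deriv contact_form) (Suc 0) x [v, w] = contact_form_d v w"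
proof -
  have s: "{..<2 + 2 * 0} = {0, 1::nat}" by auto
  have f: "finite {1::nat}" "0 \<notin> {1::nat}" by auto
  have u: "[0..<2] = [0, 1::nat]" by (simp add: upt_rec)
  show ?thesis
    unfolding wedge_power.simps wedge_def s sum_over_permutations_insert[OF f] permutes_sing u
    by (simp add: sign_swap_id sign_id ext_deriv_contact_form contact_form_d_def Transposition.transpose_def)
qed

text \<open>Twice the Pfaffian of the four vectors: of the 24 terms, eight fall on each of the three pairings.\<close>

lemma wedge_power_2_contact_form:
  "wedge_power 2 (ext_deriv contact_form) 2 x [v0, v1, v2, v3] =
    2 * (contact_form_d v0 v1 * contact_form_d v2 v3 - contact_form_d v0 v2 * contact_form_d v1 v3 +
      contact_form_d v0 v3 * contact_form_d v1 v2)"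
proof -
  let ?v = "\<lambda>i::nat. [v0, v1, v2, v3] ! i"
  have s: "{..<2 + 2 * Suc 0} = {0, 1, 2, 3::nat}" by auto
  have u: "[0..<2] = [0, 1::nat]" "[2..<2 + 2 * Suc 0] = [2, 3::nat]" by (simp_all add: upt_rec)
  have "wedge_power 2 (ext_deriv contact_form) 2 x [v0, v1, v2, v3] =
      (\<Sum>\<pi> | \<pi> permutes {0, 1, 2, 3}. of_int (sign \<pi>) *
        (contact_form_d (?v (\<pi> 0)) (?v (\<pi> 1)) * contact_form_d (?v (\<pi> 2)) (?v (\<pi> 3)))) / 4"
    unfolding numeral_2_eq_2[of] wedge_power.simps(2)[of _ _ "Suc 0"]
    unfolding numeral_2_eq_2[symmetric] wedge_def[of 2 "2 * Suc 0"] s u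
    by (simp add: ext_deriv_contact_form wedge_power_1_contact_form mult.assoc del: wedge_power.simps)
  also have "\<dots> = 2 * (contact_form_d v0 v1 * contact_form_d v2 v3 - contact_form_d v0 v2 * contact_form_d v1 v3 +
      contact_form_d v0 v3 * contact_form_d v1 v2)"
  proof -
    have anti: "contact_form_d v w = - contact_form_d w v" for v w
      by (simp add: contact_form_d_def)
    show ?thesis
      by (subst sum_permutations_4[where g = "\<lambda>i j k l. contact_form_d (?v i) (?v j) * contact_form_d (?v k) (?v l)"])
        (simp_all add: anti[of v1 v0] anti[of v2 v0] anti[of v3 v0] anti[of v2 v1] anti[of v3 v1] anti[of v3 v2])
  qed
  finally show ?thesis .
qed

text \<open>The vectors are the Reeb direction \<open>\<partial>\<^sub>c\<close> followed by two symplectic pairs \<open>\<partial>\<^sub>p, \<partial>\<^sub>a - p \<partial>\<^sub>c\<close> and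
  \<open>\<partial>\<^sub>q, \<partial>\<^sub>b - q \<partial>\<^sub>c\<close> in the kernel of the contact form. Only permutations fixing the first vector contribute.\<close>

lemma contact_form_nondegenerate:
  "\<exists>vs. length vs = 2 * 2 + 1 \<and>
    wedge 1 (2 * 2) contact_form (wedge_power 2 (ext_deriv contact_form) 2) x vs \<noteq> 0"
proof -
  define e where "e = vec5 0 0 1 0 0"
  define v where "v = [e, vec5 0 0 0 1 0, vec5 1 0 (- x $ 4) 0 0, vec5 0 0 0 0 1, vec5 0 1 (- x $ 5) 0 0]"
  let ?\<Omega> = "wedge_power 2 (ext_deriv contact_form) 2"
  have \<alpha>: "contact_form x [v ! i] = (if i = 0 then 1 else 0)" if "i < 5" for i
    using that by (auto simp: v_def e_def contact_form_def numeral_eq_Suc less_Suc_eq)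
  have s: "{..<1 + 2 * 2} = insert 0 {1, 2, 3, 4::nat}" by auto
  have f: "finite {1, 2, 3, 4::nat}" "0 \<notin> {1, 2, 3, 4::nat}" by auto
  have u: "[0..<1] = [0::nat]" "[1..<1 + 2 * 2] = [1, 2, 3, 4::nat]" by (simp_all add: upt_rec)
  let ?F = "\<lambda>\<pi>. of_int (sign \<pi>) * contact_form x [v ! \<pi> 0] * ?\<Omega> x [v ! \<pi> 1, v ! \<pi> 2, v ! \<pi> 3, v ! \<pi> 4]"
  have vanish: "?F (Transposition.transpose 0 b \<circ> \<pi>) = 0" if "b \<in> {1, 2, 3, 4}" "\<pi> permutes {1, 2, 3, 4}" for b \<pi>
  proof -
    have "(Transposition.transpose 0 b \<circ> \<pi>) 0 = b"
      using permutes_not_in[OF that(2), of 0] by simp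
    then show ?thesis
      using \<alpha>[of b] that(1) by auto
  qed
  have id: "?F (Transposition.transpose 0 0 \<circ> \<pi>) = of_int (sign \<pi>) * ?\<Omega> x [v ! \<pi> 1, v ! \<pi> 2, v ! \<pi> 3, v ! \<pi> 4]"
    if "\<pi> permutes {1, 2, 3, 4}" for \<pi>
    using permutes_not_in[OF that, of 0] \<alpha>[of 0] by simp
  have "wedge 1 (2 * 2) contact_form ?\<Omega> x v = (\<Sum>\<pi> | \<pi> permutes insert 0 {1, 2, 3, 4}. ?F \<pi>) / (fact 1 * fact (2 * 2))"
    unfolding wedge_def s u by simp
  also have "(\<Sum>\<pi> | \<pi> permutes insert 0 {1, 2, 3, 4}. ?F \<pi>) =
      (\<Sum>b\<in>insert 0 {1, 2, 3, 4}. \<Sum>\<pi> | \<pi> permutes {1, 2, 3, 4}. ?F (Transposition.transpose 0 b \<circ> \<pi>))"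
    by (rule sum_over_permutations_insert[OF f])
  also have "\<dots> = (\<Sum>\<pi> | \<pi> permutes {1, 2, 3, 4}. ?F (Transposition.transpose 0 0 \<circ> \<pi>))"
  proof -
    let ?G = "\<lambda>b. \<Sum>\<pi> | \<pi> permutes {1, 2, 3, 4}. ?F (Transposition.transpose 0 b \<circ> \<pi>)"
    have "sum ?G {1, 2, 3, 4} = 0"
      by (intro sum.neutral ballI vanish) auto
    then show ?thesis
      unfolding sum.insert[OF f, of ?G] by simp
  qed
  also have "\<dots> = (\<Sum>\<pi> | \<pi> permutes {1, 2, 3, 4}.
      of_int (sign \<pi>) * ?\<Omega> x [v ! \<pi> 1, v ! \<pi> 2, v ! \<pi> 3, v ! \<pi> 4])"
    by (rule sum.cong[OF refl]) (use id in blast)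
  also have "\<dots> = 48"
    by (subst sum_permutations_4[where g = "\<lambda>i j k l. ?\<Omega> x [v ! i, v ! j, v ! k, v ! l]"])
      (simp_all add: wedge_power_2_contact_form v_def contact_form_d_def)
  finally have "wedge 1 (2 * 2) contact_form ?\<Omega> x v \<noteq> 0"
    by (simp add: fact_numeral)
  moreover have "length v = 2 * 2 + 1"
    by (simp add: v_def)
  ultimately show ?thesis by blast
qed

lemma frame_chart_slice:
  assumes fr: "null_frame n l e f"
  shows "slice_chart traj_atlas G_traj_null (frame_chart n l e f)"
proof -
  let ?c = "frame_chart n l e f"
  have "q \<in> G_traj_null \<longleftrightarrow> snd (snd ?c q) = 0" if "q \<in> fst ?c" for q
  proof -
    obtain \<gamma> where \<gamma>: "q = traj_of \<gamma>" "0 < mink n (snd \<gamma>)"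
      using \<open>q \<in> fst ?c\<close> by (auto simp: frame_chart_def)
    then have "\<gamma> \<in> G_curv"
      by (auto simp: snd_G_curv)
    moreover have "snd (snd ?c q) = mink (snd (gauge n \<gamma>)) (snd (gauge n \<gamma>))"
      unfolding \<gamma>(1) frame_chart_traj_of[OF \<gamma>(2)] by (simp add: frame_coords_def case_prod_beta Let_def)
    ultimately show ?thesis
      using \<gamma> by (simp add: traj_of_in_G_traj_null gauge_sel)
  qed
  then show ?thesis
    unfolding slice_chart_def using frame_chart_in_traj_atlas[OF fr] by auto
qed

text \<open>The section satisfies \<open>g(n, V) = 1\<close> and \<open>g(n, X) = 0\<close>, so among the components of \<open>V\<close> only those along
  \<open>l\<close>, \<open>e\<close>, \<open>f\<close>, namely \<open>1, p, q\<close>, pair with \<open>dX = da e + db f + dc n\<close>.\<close>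

lemma liouville_frame_section:
  assumes fr: "null_frame n l e f"
  shows "mink (snd (frame_section n l e f z)) (fst (frechet_derivative (frame_section n l e f) (at z) \<zeta>)) =
    contact_form (fst z) [fst \<zeta>]"
proof -
  let ?s = "frame_section n l e f"
  have lin: "linear (\<lambda>z. fst (?s z))"
    by (rule linearI) (simp_all add: frame_section_def case_prod_beta algebra_simps)
  have "((\<lambda>z. fst (?s z)) has_derivative (\<lambda>\<zeta>. fst (frechet_derivative ?s (at z) \<zeta>))) (at z)"
    by (rule has_derivative_fst[OF smooth_on_imp_has_derivative[OF smooth_on_frame_section]]) simp
  from has_derivative_unique[OF this linear_imp_has_derivative[OF lin]]
  have "fst (frechet_derivative ?s (at z) \<zeta>) = fst (?s \<zeta>)"
    by (rule fun_cong)
  then show ?thesis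
    by (simp add: frame_section_def case_prod_beta contact_form_def null_frame_rules[OF fr])
qed

lemma Im_cosymp_contact_form:
  assumes fr: "null_frame n l e f" and q: "q \<in> fst (frame_chart n l e f)" "q \<in> G_traj_null"
  shows "Im_cosymp q = {v \<in> sub_tangent_space traj_atlas G_traj_null q.
    contact_form (fst (snd (frame_chart n l e f) q)) [fst (v (frame_chart n l e f))] = 0}"
proof -
  let ?c = "frame_chart n l e f" and ?s = "frame_section n l e f"
  let ?x = "snd ?c q"
  let ?T = "sub_tangent_space traj_atlas G_traj_null q"
  have c: "?c \<in> quotient_atlas G_curv traj_of"
    using frame_chart_in_traj_atlas[OF fr] by (simp add: traj_atlas_def)
  note s = local_section_frame[OF fr]
  define \<gamma> where "\<gamma> = ?s ?x"
  have \<gamma>: "\<gamma> \<in> G_curv" "traj_of \<gamma> = q"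
    using local_sectionD(2,3)[OF s q(1)] by (simp_all add: \<gamma>_def)
  then have null: "\<gamma> \<in> G_curv_null" "mink (snd \<gamma>) (snd \<gamma>) = 0"
    using q(2) traj_of_in_G_traj_null[OF \<gamma>(1)] by (simp_all add: mem_G_curv_null)
  have sub: "Im_cosymp q \<subseteq> ?T"
    using hyperplane_distribution_null q(2) unfolding hyperplane_distribution_def by blast
  have "v \<in> Im_cosymp q \<longleftrightarrow> contact_form (fst ?x) [fst (v ?c)] = 0" if v: "v \<in> ?T" for v
  proof -
    let ?\<delta> = "frechet_derivative ?s (at ?x) (v ?c)"
    have "v \<in> Tan q"
      using v by (simp add: sub_tangent_space_def)
    then have vD: "v = D_traj \<gamma> ?\<delta>"
      using tangent_eq_push_tangent[OF c s q(1), of v] unfolding \<gamma>_def traj_atlas_def by blast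
    obtain \<delta> where \<delta>: "mink (snd \<gamma>) (snd \<delta>) = 0" "v = D_traj \<gamma> \<delta>"
      using v sub_tangent_space_null[OF null(1)] unfolding \<gamma>(2) by blast
    have "D_traj \<gamma> \<delta> = D_traj \<gamma> ?\<delta>"
      by (rule trans[OF \<delta>(2)[symmetric] vD])
    then obtain x y where "?\<delta> = \<delta> + (x *\<^sub>R snd \<gamma>, y *\<^sub>R snd \<gamma>)"
      by (rule D_traj_eq_imp[OF \<gamma>(1)])
    then have "mink (snd \<gamma>) (snd ?\<delta>) = 0"
      using \<delta>(1) null(2) by simp
    from D_traj_in_Im_cosymp_null[OF null(1) this] show ?thesis
      unfolding vD[symmetric] \<gamma>(2) unfolding \<gamma>_def liouville_frame_section[OF fr] .
  qed
  with sub show ?thesis by blast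
qed

lemma contact_structure_null: "contact_structure traj_atlas G_traj_null Im_cosymp"
  unfolding contact_structure_def
proof (intro conjI exI[of _ "2::nat"] ballI hyperplane_distribution_null)
  show "DIM(real^5) = 2 * 2 + 1" by simp
  fix p assume p: "p \<in> G_traj_null"
  then obtain \<gamma> where \<gamma>: "\<gamma> \<in> G_curv" "p = traj_of \<gamma>"
    unfolding G_traj_null_def by blast
  then obtain n l e f where fr: "null_frame n l e f" and pos: "0 < mink n (snd \<gamma>)"
    using null_frame_exists snd_G_curv by blast
  let ?c = "frame_chart n l e f"
  show "\<exists>U \<phi> \<alpha>. slice_chart traj_atlas G_traj_null (U, \<phi>) \<and> p \<in> U \<and>
      smooth_one_form ((fst \<circ> \<phi>) ` (U \<inter> G_traj_null)) \<alpha> \<and>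
      (\<forall>q\<in>U \<inter> G_traj_null. Im_cosymp q = {v \<in> sub_tangent_space traj_atlas G_traj_null q.
        \<alpha> (fst (\<phi> q)) [fst (v (U, \<phi>))] = 0}) \<and>
      (\<forall>x\<in>(fst \<circ> \<phi>) ` (U \<inter> G_traj_null). \<exists>vs. length vs = 2 * 2 + 1 \<and>
        wedge 1 (2 * 2) \<alpha> (wedge_power 2 (ext_deriv \<alpha>) 2) x vs \<noteq> 0)"
  proof (intro exI[of _ "fst ?c"] exI[of _ "snd ?c"] exI[of _ contact_form] conjI ballI)
    show "slice_chart traj_atlas G_traj_null (fst ?c, snd ?c)"
      using frame_chart_slice[OF fr] by simp
    show "p \<in> fst ?c"
      using pos by (simp add: \<gamma>(2) traj_of_in_frame_chart)
    show "Im_cosymp q = {v \<in> sub_tangent_space traj_atlas G_traj_null q.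
        contact_form (fst (snd ?c q)) [fst (v (fst ?c, snd ?c))] = 0}" if "q \<in> fst ?c \<inter> G_traj_null" for q
      using Im_cosymp_contact_form[OF fr] that by simp
  qed (rule smooth_contact_form contact_form_nondegenerate)+
qed

theorem mainTheorem1:
  shows "(\<forall>W\<in>{G_traj_pos, G_traj_neg}.
      open_submanifold traj_atlas W \<and>
      (\<forall>\<tau>\<in>W. Im_cosymp \<tau> = Tan \<tau> \<and> nondegenerate_at \<tau>) \<and>
      conformal_symplectic_class traj_atlas W (inverse_forms W)) \<and>
    (hyperplane_distribution traj_atlas G_traj_null Im_cosymp \<and>
      (\<forall>\<gamma>\<in>G_curv_null. Im_cosymp (traj_of \<gamma>) = liouville_plane \<gamma>) \<and>
      contact_structure traj_atlas G_traj_null Im_cosymp)"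
proof -
  have "open_submanifold traj_atlas (signed_trajs \<epsilon>) \<and>
      (\<forall>\<tau>\<in>signed_trajs \<epsilon>. Im_cosymp \<tau> = Tan \<tau> \<and> nondegenerate_at \<tau>) \<and>
      conformal_symplectic_class traj_atlas (signed_trajs \<epsilon>) (inverse_forms (signed_trajs \<epsilon>))"
    if "\<bar>\<epsilon>\<bar> = 1" for \<epsilon>
    using open_submanifold_signed Im_cosymp_signed nondegenerate_nonnull
      conformal_symplectic_inverse_forms[OF that] by blast
  from this[of 1] this[of "- 1"] show ?thesis
    using hyperplane_distribution_null Im_cosymp_liouville contact_structure_null
    by (simp add: signed_trajs_simps)
qed


end
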